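(* Let $f(\alpha,\mathcal{I})=\mathcal{L}(\alpha,\mathcal{I})+u\,r(\alpha)+\mathbb{I}_{[0,+\infty)}(\mathcal{I})$, where $u>0$; $\mathcal{L}$ is either the lognormal negative log-likelihood $$\mathcal{L}(\alpha,\mathcal{I})=\tfrac12\bigl\|\ln_\circ\mathcal{E}-\ln_\circ\mathcal{I}^{\mathrm{out}}(\alpha,\mathcal{I})\bigr\|_2^2$$ or the Poisson negative log-likelihood $$\mathcal{L}(\alpha,\mathcal{I})=\mathbf{1}^T\bigl[\mathcal{I}^{\mathrm{out}}(\alpha,\mathcal{I})-\mathcal{E}\bigr]-\mathcal{E}^T\bigl[\ln_\circ\mathcal{I}^{\mathrm{out}}(\alpha,\mathcal{I})-\ln_\circ\mathcal{E}\bigr];$$ and $r$ is either $$r(\alpha)=\sum_{i=1}^p\sqrt{\sum_{j\in\mathcal{N}_i}(\alpha_i-\alpha_j)^2}+\mathbb{I}_{[0,+\infty)}(\alpha)\qquad\text{or}\qquad r(\alpha)=\|\Psi^T\alpha\|_1+\mathbb{I}_{[0,+\infty)}(\alpha).$$ Then $f$ satisfies the Kurdyka–Łojasiewicz property in any compact subset $\mathbb{C}\subseteq\mathrm{dom}(f)$.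
   Context: Fix a real $q>1$, a real $\kappa_0>0$, and positive integers $J,N,p$. Put $\kappa_j=q^j\kappa_0$ for $j=0,\dots,J+1$. For $j=1,\dots,J$ the B1-spline $b_j$ is $b_j(\kappa)=\frac{\kappa-\kappa_{j-1}}{\kappa_j-\kappa_{j-1}}$ for $\kappa_{j-1}\le\kappa<\kappa_j$, $b_j(\kappa)=\frac{\kappa_{j+1}-\kappa}{\kappa_{j+1}-\kappa_j}$ for $\kappa_j\le\kappa<\kappa_{j+1}$, and $0$ otherwise; $b_j^{L}(s)=\int b_j(\kappa)e^{-s\kappa}\,d\kappa$. $\Phi\in\mathbb{R}^{N\times p}$ is a known matrix with nonnegative entries and rows $\phi_1^T,\dots,\phi_N^T$; $\mathcal{E}\in\mathbb{R}^N$ has positive entries. The vector $\mathcal{I}^{\mathrm{out}}(\alpha,\mathcal{I})\in\mathbb{R}^N$ has $n$th entry $\sum_{j=1}^J b_j^{L}(\phi_n^T\alpha)\,\mathcal{I}_j$, for $\alpha\in\mathbb{R}^p$, $\mathcal{I}\in\mathbb{R}^J$. $\mathbb{I}_{[0,+\infty)}(x)$ equals $0$ if all entries of $x$ are nonnegative and $+\infty$ otherwise; $\ln_\circ$ is the elementwise logarithm; $\mathbf 1$ is the all-ones vector. $f$ takes the value $+\infty$ when some entry of $\mathcal{I}^{\mathrm{out}}(\alpha,\mathcal{I})$ is not positive, and $\mathrm{dom}(f)=\{(\alpha,\mathcal{I}):f(\alpha,\mathcal{I})<+\infty\}$. The entries of $\alpha$ are the pixels of a 2-dimensional image, and $\mathcal{N}_i\subseteq\{1,\dots,p\}$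 is the set of indices of the pixel directly above and the pixel directly to the right of pixel $i$, whenever these exist (so $|\mathcal{N}_i|\le2$). $\Psi\in\mathbb{R}^{p\times p'}$, $p\le p'$, satisfies $\Psi\Psi^T=I_p$. Kurdyka–Łojasiewicz (KL) property: a proper lower semicontinuous $f:\mathbb{R}^n\to\mathbb{R}\cup\{+\infty\}$ with limiting subdifferential $\partial f$ satisfies the KL property at $\bar z\in\mathrm{dom}(\partial f)$ if there are $\eta\in(0,+\infty]$, a neighborhood $W$ of $\bar z$ and a continuous concave function $\varphi:[0,\eta)\to[0,\infty)$ with $\varphi(0)=0$, $\varphi$ continuously differentiable on $(0,\eta)$ with $\varphi'>0$ there, such that $\varphi'(f(z)-f(\bar z))\,\mathrm{dist}(0,\partial f(z))\ge1$ for all $z\in W$ with $f(\bar z)<f(z)<f(\bar z)+\eta$. It satisfies the KL property in a set $\mathbb{C}$ if it does so at every point of $\mathbb{C}\cap\mathrm{dom}(\partial f)$. *)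

theory Defs
  imports "HOL-Analysis.Analysis"
begin

section \<open>Limiting subdifferential and the Kurdyka--Lojasiewicz property\<close>

text \<open>Extended-valued functions have type \<open>'a \<Rightarrow> ereal\<close>; the value \<open>- \<infinity>\<close> is excluded by properness.\<close>

definition edom :: "('a \<Rightarrow> ereal) \<Rightarrow> 'a set" where
  "edom f = {x. f x < \<infinity>}"

definition proper_fun :: "('a \<Rightarrow> ereal) \<Rightarrow> bool" where
  "proper_fun f \<longleftrightarrow> (\<forall>x. f x \<noteq> -\<infinity>) \<and> edom f \<noteq> {}"

definition lower_semicont :: "('a::topological_space \<Rightarrow> ereal) \<Rightarrow> bool" where
  "lower_semicont f \<longleftrightarrow> (\<forall>x. f x \<le> Liminf (at x) f)"

definition frechet_subdiff :: "('a::euclidean_space \<Rightarrow> ereal) \<Rightarrow> 'a \<Rightarrow> 'a set" where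
  "frechet_subdiff f x =
     {v. x \<in> edom f \<and>
         0 \<le> Liminf (at x) (\<lambda>y. (f y - f x - ereal (v \<bullet> (y - x))) / ereal (norm (y - x)))}"

definition limiting_subdiff :: "('a::euclidean_space \<Rightarrow> ereal) \<Rightarrow> 'a \<Rightarrow> 'a set" where
  "limiting_subdiff f x =
     {v. x \<in> edom f \<and>
         (\<exists>X V. X \<longlonglongrightarrow> x \<and> (\<lambda>k. f (X k)) \<longlonglongrightarrow> f x \<and>
                (\<forall>k. V k \<in> frechet_subdiff f (X k)) \<and> V \<longlonglongrightarrow> v)}"

definition dom_subdiff :: "('a::euclidean_space \<Rightarrow> ereal) \<Rightarrow> 'a set" where
  "dom_subdiff f = {x. limiting_subdiff f x \<noteq> {}}"

text \<open>Extended-valued, so that the distance to the empty set is \<open>\<infinity>\<close>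
  (the library's \<open>infdist\<close> would give 0 there).\<close>

definition edist0 :: "'a::real_normed_vector set \<Rightarrow> ereal" where
  "edist0 S = (INF v\<in>S. ereal (norm v))"

definition desingularizing :: "ereal \<Rightarrow> (real \<Rightarrow> real) \<Rightarrow> (real \<Rightarrow> real) \<Rightarrow> bool" where
  "desingularizing \<eta> \<phi> \<phi>' \<longleftrightarrow>
     (let D = {t. 0 \<le> t \<and> ereal t < \<eta>}; D' = {t. 0 < t \<and> ereal t < \<eta>} in
        continuous_on D \<phi> \<and> concave_on D \<phi> \<and> (\<forall>t\<in>D. 0 \<le> \<phi> t) \<and> \<phi> 0 = 0 \<and>
        (\<forall>t\<in>D'. (\<phi> has_real_derivative \<phi>' t) (at t)) \<and>
        continuous_on D' \<phi>' \<and> (\<forall>t\<in>D'. 0 < \<phi>' t))"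

definition KL_property_at :: "('a::euclidean_space \<Rightarrow> ereal) \<Rightarrow> 'a \<Rightarrow> bool" where
  "KL_property_at f zb \<longleftrightarrow>
     (\<exists>\<eta> W \<phi> \<phi>'. 0 < \<eta> \<and> zb \<in> interior W \<and> desingularizing \<eta> \<phi> \<phi>' \<and>
        (\<forall>z\<in>W. f zb < f z \<and> f z < f zb + \<eta> \<longrightarrow>
           1 \<le> ereal (\<phi>' (real_of_ereal (f z - f zb))) * edist0 (limiting_subdiff f z)))"

text \<open>The property is only meaningful for proper lower semicontinuous functions, so these two
  requirements are part of it.\<close>

definition KL_property_in :: "('a::euclidean_space \<Rightarrow> ereal) \<Rightarrow> 'a set \<Rightarrow> bool" where
  "KL_property_in f C \<longleftrightarrow>
     proper_fun f \<and> lower_semicont f \<and> (\<forall>zb \<in> C \<inter> dom_subdiff f. KL_property_at f zb)"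


section \<open>Measurement model\<close>

definition knot :: "real \<Rightarrow> real \<Rightarrow> nat \<Rightarrow> real" where
  "knot q \<kappa>0 j = q ^ j * \<kappa>0"

definition B1_spline :: "real \<Rightarrow> real \<Rightarrow> nat \<Rightarrow> real \<Rightarrow> real" where
  "B1_spline q \<kappa>0 j \<kappa> =
     (if knot q \<kappa>0 (j - 1) \<le> \<kappa> \<and> \<kappa> < knot q \<kappa>0 j
      then (\<kappa> - knot q \<kappa>0 (j - 1)) / (knot q \<kappa>0 j - knot q \<kappa>0 (j - 1))
      else if knot q \<kappa>0 j \<le> \<kappa> \<and> \<kappa> < knot q \<kappa>0 (j + 1)
      then (knot q \<kappa>0 (j + 1) - \<kappa>) / (knot q \<kappa>0 (j + 1) - knot q \<kappa>0 j)
      else 0)"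

definition B1_laplace :: "real \<Rightarrow> real \<Rightarrow> nat \<Rightarrow> real \<Rightarrow> real" where
  "B1_laplace q \<kappa>0 j s = (LINT \<kappa>|lborel. B1_spline q \<kappa>0 j \<kappa> * exp (- s * \<kappa>))"

text \<open>The spline coefficients are indexed by a finite type \<open>'j\<close>; \<open>idx\<close> is its numbering by
  \<open>1, \<dots>, CARD('j)\<close>.\<close>

definition Iout ::
  "real \<Rightarrow> real \<Rightarrow> ('j::finite \<Rightarrow> nat) \<Rightarrow> real^'p^'n \<Rightarrow> real^'p \<Rightarrow> real^'j \<Rightarrow> real^'n" where
  "Iout q \<kappa>0 idx \<Phi> \<alpha> I =
     (\<chi> n. \<Sum>j\<in>UNIV. B1_laplace q \<kappa>0 (idx j) (row n \<Phi> \<bullet> \<alpha>) * I $ j)"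

definition ln_vec :: "real^'n \<Rightarrow> real^'n" where
  "ln_vec x = (\<chi> n. ln (x $ n))"

text \<open>Negative log-likelihoods as functions of the measurements \<open>E\<close> and the model output \<open>y\<close>.\<close>

definition lognormal_nll :: "real^'n \<Rightarrow> real^'n \<Rightarrow> ereal" where
  "lognormal_nll E y =
     (if \<forall>n. 0 < y $ n then ereal (1/2 * (norm (ln_vec E - ln_vec y))\<^sup>2) else \<infinity>)"

definition poisson_nll :: "real^'n \<Rightarrow> real^'n \<Rightarrow> ereal" where
  "poisson_nll E y =
     (if \<forall>n. 0 < y $ n then ereal (1 \<bullet> (y - E) - E \<bullet> (ln_vec y - ln_vec E)) else \<infinity>)"


section \<open>Regularizers and the objective\<close>

definition nonneg_ind :: "real^'k \<Rightarrow> ereal" where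
  "nonneg_ind x = (if \<forall>i. 0 \<le> x $ i then 0 else \<infinity>)"

text \<open>\<open>pos i\<close> is the grid position of pixel \<open>i\<close>, as horizontal coordinate (growing to the right)
  and vertical coordinate (growing upwards).\<close>

definition nbrs :: "('p \<Rightarrow> int \<times> int) \<Rightarrow> 'p \<Rightarrow> 'p set" where
  "nbrs pos i =
     {j. pos j = (fst (pos i), snd (pos i) + 1) \<or> pos j = (fst (pos i) + 1, snd (pos i))}"

definition tv_reg :: "('p \<Rightarrow> int \<times> int) \<Rightarrow> real^'p \<Rightarrow> ereal" where
  "tv_reg pos \<alpha> =
     ereal (\<Sum>i\<in>UNIV. sqrt (\<Sum>j\<in>nbrs pos i. (\<alpha> $ i - \<alpha> $ j)\<^sup>2)) + nonneg_ind \<alpha>"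

definition l1_reg :: "real^'m^'p \<Rightarrow> real^'p \<Rightarrow> ereal" where
  "l1_reg \<Psi> \<alpha> = ereal (\<Sum>k\<in>UNIV. \<bar>(transpose \<Psi> *v \<alpha>) $ k\<bar>) + nonneg_ind \<alpha>"

definition objective ::
  "(real^'n \<Rightarrow> ereal) \<Rightarrow> (real^'p \<Rightarrow> real^'j \<Rightarrow> real^'n) \<Rightarrow> real \<Rightarrow> (real^'p \<Rightarrow> ereal)
    \<Rightarrow> (real^'p) \<times> (real^'j) \<Rightarrow> ereal" where
  "objective nll out u r = (\<lambda>(\<alpha>, I). nll (out \<alpha> I) + ereal u * r \<alpha> + nonneg_ind I)"

end

theory Submission
  imports Defs "HOL-Complex_Analysis.Conformal_Mappings"
begin

text \<open>Near a point of its domain the objective is a real analytic function plus a sum of Euclidean norms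
  of plane vectors that depend linearly on the image, restricted to the nonnegative orthant. For the
  total variation these vectors are the pairs of differences to the two neighbours, for the
  \<open>l\<^sup>1\<close> norm they are the coefficients, with second component zero. The data term is analytic
  because the Laplace transform of a spline extends to an entire function
  (\<open>B1_laplace_holomorphic\<close>) and the model output is positive on the domain.

  The property is derived from the Lojasiewicz gradient inequality for analytic functions
  (\<open>lojasiewicz_real\<close>) by contradiction. A violating sequence of Frechet subgradients
  (\<open>KL_failure\<close>) may be assumed to stay on one stratum, given by the active constraints
  and the vanishing norms. On the linear span of the stratum the remaining norms need not extend
  analytically to the limit point. Each norm is therefore written as
  \<open>\<alpha> * cos \<theta> + \<beta> * sin \<theta>\<close>, with the angle as a new variable. The new function
  is analytic everywhere near the limit; at the true angle of the vector it is critical in the angle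
  and has the same derivatives along the stratum as the objective (\<open>KL_core\<close>).

  The gradient inequality itself holds because analytic germs can be monomialized. For a function
  of the form monomial times unit it is a computation with logarithmic derivatives
  (\<open>lojasiewicz_complex\<close>), and it descends along any map with bounded derivative. Hence it
  suffices to find, for each sequence tending to the origin, a holomorphic map through which a
  subsequence lifts and which turns the germ into a monomial times a unit
  (\<open>monomialization\<close>). Such a map is built by induction on the number of variables. A germ
  that is regular of order \<open>d\<close> in the last variable is freed from its Taylor coefficient of degree
  \<open>d - 1\<close> by a shift. The other coefficients depend on fewer variables and are monomialized, together
  with their mutual differences, by the induction hypothesis, which makes them comparable. If along the
  sequence the last variable is at most of the size of the Newton slope given by the coefficients,
  rescaling the variable by it lowers the order \<open>d\<close>; otherwise the leading term dominates after
  finitely many blow-ups.\<close>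

section \<open>Holomorphic germs in several complex variables\<close>

text \<open>The complex bilinear pairing, without conjugation.\<close>

definition cdot :: "complex^'n \<Rightarrow> complex^'n \<Rightarrow> complex" where
  "cdot g v = (\<Sum>i\<in>UNIV. g $ i * v $ i)"

text \<open>\<open>G\<close> is a holomorphic gradient of \<open>f\<close> near the origin. The representation of the
  derivative by \<open>cdot (G x)\<close> makes it complex linear, and continuity of \<open>G\<close> is part of the notion,
  so that integrals depending on parameters can be differentiated under the integral sign.\<close>

definition hol_grad :: "(complex^'n \<Rightarrow> complex) \<Rightarrow> (complex^'n \<Rightarrow> complex^'n) \<Rightarrow> bool" where
  "hol_grad f G \<longleftrightarrow> (\<forall>\<^sub>F x in nhds 0. isCont G x \<and> (f has_derivative cdot (G x)) (at x))"

text \<open>Holomorphic germs at the origin. Functions are total; only their values near \<open>0\<close> matter.\<close>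

definition hol_germ :: "(complex^'n \<Rightarrow> complex) \<Rightarrow> bool" where
  "hol_germ f \<longleftrightarrow> (\<exists>G. hol_grad f G)"

lemma hol_germI: "hol_grad f G \<Longrightarrow> hol_germ f"
  by (auto simp: hol_germ_def)

lemma hol_gradD0:
  assumes "hol_grad f G" shows "isCont G 0" "(f has_derivative cdot (G 0)) (at 0)"
  using eventually_nhds_x_imp_x[OF assms[unfolded hol_grad_def]] by auto

lemma hol_germ_isCont0: "hol_germ f \<Longrightarrow> isCont f 0"
  by (metis has_derivative_continuous hol_germ_def hol_gradD0(2))

lemma hol_germ_tendsto0: "hol_germ f \<Longrightarrow> (f \<longlongrightarrow> f 0) (nhds 0)"
  using hol_germ_isCont0 by (metis isCont_def tendsto_at_iff_tendsto_nhds)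

lemma hol_grad_cong:
  assumes "\<forall>\<^sub>F x in nhds 0. f x = g x" "hol_grad f G" shows "hol_grad g G"
proof -
  have "\<forall>\<^sub>F x in nhds 0. \<forall>\<^sub>F y in nhds x. f y = g y"
    using assms(1) by (simp add: eventually_eventually)
  then show ?thesis using assms(2) unfolding hol_grad_def
  proof eventually_elim
    case (elim x)
    have "(g has_derivative cdot (G x)) (at x)"
    proof (rule has_derivative_transform_eventually)
      show "(f has_derivative cdot (G x)) (at x)" using elim by blast
      show "\<forall>\<^sub>F y in at x. f y = g y"
        using elim(1) by (simp add: eventually_at_filter eventually_mono)
      show "f x = g x" using elim(1) by (rule eventually_nhds_x_imp_x)
    qed auto
    with elim show ?case by blast
  qed
qed

lemma hol_germ_cong:
  assumes "\<forall>\<^sub>F x in nhds 0. f x = g x" "hol_germ f" shows "hol_germ g"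
  using assms hol_grad_cong unfolding hol_germ_def by blast

lemma bounded_linear_cdot: "bounded_linear (cdot g)"
  unfolding cdot_def
  by (intro bounded_linear_sum bounded_linear_compose[OF bounded_linear_mult_right] bounded_linear_vec_nth)

lemma cdot_axis: "cdot g (axis i c) = g $ i * c"
proof -
  have "cdot g (axis i c) = (\<Sum>j\<in>UNIV. if j = i then g $ i * c else 0)"
    unfolding cdot_def by (intro sum.cong) (auto simp: axis_def)
  then show ?thesis by simp
qed

lemma cdot_add_left: "cdot (g + h) v = cdot g v + cdot h v"
  by (simp add: cdot_def sum.distrib algebra_simps)

lemma cdot_scale_left: "cdot (\<chi> i. c * g $ i) v = c * cdot g v"
  by (simp add: cdot_def sum_distrib_left algebra_simps)

lemma has_derivative_vec:
  fixes p :: "'a::real_normed_vector \<Rightarrow> complex^'n"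
  assumes "\<And>i. ((\<lambda>x. p x $ i) has_derivative D i) F"
  shows "(p has_derivative (\<lambda>v. \<chi> i. D i v)) F"
proof -
  have ax: "bounded_linear (axis i :: complex \<Rightarrow> complex^'n)" for i :: 'n
    unfolding linear_conv_bounded_linear[symmetric]
    by (rule linearI) (auto simp: vec_eq_iff axis_def)
  have eq: "(\<Sum>i\<in>UNIV. axis i (w i)) = (\<chi> i. w i)" for w :: "'n \<Rightarrow> complex"
    by (simp add: vec_eq_iff axis_def sum.delta)
  have "((\<lambda>x. \<Sum>i\<in>UNIV. axis i (p x $ i)) has_derivative (\<lambda>v. \<Sum>i\<in>UNIV. axis i (D i v))) F"
    by (intro has_derivative_sum bounded_linear.has_derivative[OF ax] assms)
  then show ?thesis by (simp add: eq)
qed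

lemma isCont_vec:
  fixes p :: "'a::t2_space \<Rightarrow> complex^'n"
  shows "(\<And>i. isCont (\<lambda>x. p x $ i) x) \<Longrightarrow> isCont p x"
  unfolding isCont_def by (rule vec_tendstoI) auto

lemma hol_germ_const [simp]: "hol_germ (\<lambda>x. c)"
proof -
  have [simp]: "cdot (0::complex^'n) = (\<lambda>v. 0)" by (auto simp: cdot_def)
  show ?thesis by (rule hol_germI[of _ "\<lambda>x. 0"]) (simp add: hol_grad_def)
qed

lemma hol_germ_coord [simp]: "hol_germ (\<lambda>x::complex^'n. x $ i)"
proof -
  have "cdot (axis i 1) = (\<lambda>v::complex^'n. v $ i)"
  proof
    fix v :: "complex^'n"
    have "cdot (axis i 1) v = (\<Sum>j\<in>UNIV. if j = i then v $ i else 0)"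
      unfolding cdot_def by (intro sum.cong) (auto simp: axis_def)
    then show "cdot (axis i 1) v = v $ i" by simp
  qed
  then show ?thesis
    by (intro hol_germI[of _ "\<lambda>x. axis i 1"])
      (simp add: hol_grad_def bounded_linear_imp_has_derivative[OF bounded_linear_vec_nth])
qed

lemma hol_grad_comp:
  fixes f :: "complex^'n \<Rightarrow> complex" and p :: "complex^'m \<Rightarrow> complex^'n"
  assumes f: "hol_grad f G" and p: "\<And>i. hol_grad (\<lambda>x. p x $ i) (H i)" and p0: "p 0 = 0"
  shows "hol_grad (\<lambda>x. f (p x)) (\<lambda>x. \<chi> k. \<Sum>i\<in>UNIV. G (p x) $ i * H i x $ k)"
proof -
  have c0: "isCont p 0"
    by (rule isCont_vec) (rule hol_germ_isCont0, rule hol_germI, rule p)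
  then have lim: "filterlim p (nhds 0) (nhds 0)"
    using p0 by (metis isCont_def tendsto_at_iff_tendsto_nhds)
  have 1: "\<forall>\<^sub>F x in nhds 0. isCont G (p x) \<and> (f has_derivative cdot (G (p x))) (at (p x))"
    using f[unfolded hol_grad_def] lim by (rule eventually_compose_filterlim)
  have 2: "\<forall>\<^sub>F x in nhds 0. \<forall>i. isCont (H i) x \<and> ((\<lambda>x. p x $ i) has_derivative cdot (H i x)) (at x)"
    using p[unfolded hol_grad_def] by (simp add: eventually_all_finite)
  show ?thesis unfolding hol_grad_def using 1 2
  proof eventually_elim
    case (elim x)
    have dp: "(p has_derivative (\<lambda>v. \<chi> i. cdot (H i x) v)) (at x)"
      by (rule has_derivative_vec) (use elim in auto)
    have cp: "isCont p x" using dp by (rule has_derivative_continuous)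
    have cG: "isCont (\<lambda>x. G (p x)) x" by (rule isCont_o2[OF cp]) (use elim in auto)
    have "isCont (\<lambda>x. \<chi> k. \<Sum>i\<in>UNIV. G (p x) $ i * H i x $ k) x"
      using elim cG by (intro isCont_vec) (simp add: isCont_vec_nth continuous_mult)
    moreover have "((\<lambda>x. f (p x)) has_derivative (\<lambda>v. cdot (G (p x)) (\<chi> i. cdot (H i x) v))) (at x)"
      by (rule has_derivative_compose[OF dp]) (use elim in auto)
    moreover have "(\<lambda>v. cdot (G (p x)) (\<chi> i. cdot (H i x) v)) =
        cdot (\<chi> k. \<Sum>i\<in>UNIV. G (p x) $ i * H i x $ k)"
    proof
      fix v
      have "cdot (G (p x)) (\<chi> i. cdot (H i x) v) = (\<Sum>i\<in>UNIV. \<Sum>k\<in>UNIV. G (p x) $ i * H i x $ k * v $ k)"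
        by (simp add: cdot_def sum_distrib_left mult.assoc)
      also have "\<dots> = (\<Sum>k\<in>UNIV. \<Sum>i\<in>UNIV. G (p x) $ i * H i x $ k * v $ k)"
        by (rule sum.swap)
      also have "\<dots> = cdot (\<chi> k. \<Sum>i\<in>UNIV. G (p x) $ i * H i x $ k) v"
        by (simp add: cdot_def sum_distrib_right)
      finally show "cdot (G (p x)) (\<chi> i. cdot (H i x) v) = cdot (\<chi> k. \<Sum>i\<in>UNIV. G (p x) $ i * H i x $ k) v" .
    qed
    ultimately show ?case by simp
  qed
qed

lemma hol_germ_comp:
  assumes "hol_germ f" "\<And>i. hol_germ (\<lambda>x. p x $ i)" "p 0 = 0"
  shows "hol_germ (\<lambda>x. f (p x))"
proof -
  obtain G where "hol_grad f G" using assms by (auto simp: hol_germ_def)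
  moreover have "\<forall>i. \<exists>H. hol_grad (\<lambda>x. p x $ i) H" using assms by (auto simp: hol_germ_def)
  then obtain H where "\<And>i. hol_grad (\<lambda>x. p x $ i) (H i)" by metis
  ultimately show ?thesis using hol_grad_comp assms(3) hol_germI by blast
qed

lemma hol_germ_add [simp, intro]:
  assumes "hol_germ f" "hol_germ g" shows "hol_germ (\<lambda>x. f x + g x)"
proof -
  obtain F G where "hol_grad f F" "hol_grad g G" using assms by (auto simp: hol_germ_def)
  then have "hol_grad (\<lambda>x. f x + g x) (\<lambda>x. F x + G x)" unfolding hol_grad_def
  proof eventually_elim
    case (elim x)
    then have "((\<lambda>x. f x + g x) has_derivative (\<lambda>v. cdot (F x) v + cdot (G x) v)) (at x)"
      by (intro has_derivative_add) auto
    with elim show ?case by (simp add: cdot_add_left[abs_def])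
  qed
  then show ?thesis by (rule hol_germI)
qed

lemma hol_germ_mult [simp, intro]:
  assumes "hol_germ f" "hol_germ g" shows "hol_germ (\<lambda>x. f x * g x)"
proof -
  obtain F G where "hol_grad f F" "hol_grad g G" using assms by (auto simp: hol_germ_def)
  then have "hol_grad (\<lambda>x. f x * g x) (\<lambda>x. (\<chi> i. f x * G x $ i) + (\<chi> i. g x * F x $ i))" unfolding hol_grad_def
  proof eventually_elim
    case (elim x)
    then have "((\<lambda>x. f x * g x) has_derivative (\<lambda>v. f x * cdot (G x) v + cdot (F x) v * g x)) (at x)"
      by (intro has_derivative_mult) auto
    moreover have "isCont f x" "isCont g x" using elim has_derivative_continuous by blast+
    with elim have "isCont (\<lambda>x. (\<chi> i. f x * G x $ i) + (\<chi> i. g x * F x $ i)) x"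
      by (intro isCont_vec) (simp add: isCont_vec_nth continuous_mult continuous_add)
    ultimately show ?case by (simp add: cdot_add_left[abs_def] cdot_scale_left mult.commute)
  qed
  then show ?thesis by (rule hol_germI)
qed

text \<open>Composition with a holomorphic function of one variable on the outside.\<close>

lemma hol_germ_comp1:
  assumes f: "hol_germ f" and S: "open S" "f 0 \<in> S" and h: "h holomorphic_on S"
  shows "hol_germ (\<lambda>x. h (f x))"
proof -
  obtain F where F: "hol_grad f F" using assms by (auto simp: hol_germ_def)
  have "filterlim f (nhds (f 0)) (nhds 0)" using f by (rule hol_germ_tendsto0)
  then have 1: "\<forall>\<^sub>F x in nhds 0. f x \<in> S" using S by (simp add: tendsto_def)
  have "hol_grad (\<lambda>x. h (f x)) (\<lambda>x. \<chi> i. deriv h (f x) * F x $ i)"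
    unfolding hol_grad_def using 1 F[unfolded hol_grad_def]
  proof eventually_elim
    case (elim x)
    have d: "(h has_field_derivative deriv h (f x)) (at (f x))"
      using h S elim holomorphic_derivI by blast
    have "((\<lambda>x. h (f x)) has_derivative (\<lambda>v. deriv h (f x) * cdot (F x) v)) (at x)"
      by (rule has_derivative_compose[of f "cdot (F x)"]) (use elim d in \<open>auto simp: has_field_derivative_def\<close>)
    moreover have "isCont (deriv h) (f x)"
      using holomorphic_deriv[OF h] S elim
      by (meson continuous_on_eq_continuous_at holomorphic_on_imp_continuous_on)
    moreover have "isCont f x" using elim has_derivative_continuous by blast
    ultimately have "isCont (\<lambda>x. deriv h (f x)) x" using isCont_o2 by blast
    with elim have "isCont (\<lambda>x. \<chi> i. deriv h (f x) * F x $ i) x"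
      by (intro isCont_vec) (simp add: isCont_vec_nth continuous_mult)
    then show ?case using \<open>((\<lambda>x. h (f x)) has_derivative _) _\<close> by (simp add: cdot_scale_left[abs_def])
  qed
  then show ?thesis by (rule hol_germI)
qed

lemma hol_germ_minus [simp, intro]: "hol_germ f \<Longrightarrow> hol_germ (\<lambda>x. - f x)"
  by (rule hol_germ_comp1[of f UNIV uminus]) (auto intro!: holomorphic_intros)

lemma hol_germ_diff [simp, intro]: "hol_germ f \<Longrightarrow> hol_germ g \<Longrightarrow> hol_germ (\<lambda>x. f x - g x)"
  using hol_germ_add[of f "\<lambda>x. - g x"] by simp

lemma hol_germ_power [simp, intro]: "hol_germ f \<Longrightarrow> hol_germ (\<lambda>x. f x ^ k)"
  by (rule hol_germ_comp1[of f UNIV "\<lambda>w. w ^ k"]) (auto intro!: holomorphic_intros)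

lemma hol_germ_inverse [intro]: "hol_germ f \<Longrightarrow> f 0 \<noteq> 0 \<Longrightarrow> hol_germ (\<lambda>x. inverse (f x))"
  by (rule hol_germ_comp1[of f "-{0}" inverse]) (auto intro!: holomorphic_intros)

lemma hol_germ_sum [intro]: "(\<And>i. i \<in> I \<Longrightarrow> hol_germ (f i)) \<Longrightarrow> hol_germ (\<lambda>x. \<Sum>i\<in>I. f i x)"
  by (induction I rule: infinite_finite_induct) auto

lemma hol_germ_prod [intro]: "(\<And>i. i \<in> I \<Longrightarrow> hol_germ (f i)) \<Longrightarrow> hol_germ (\<lambda>x. \<Prod>i\<in>I. f i x)"
  by (induction I rule: infinite_finite_induct) auto

lemma hol_germ_if [intro]: "(P \<Longrightarrow> hol_germ f) \<Longrightarrow> (\<not> P \<Longrightarrow> hol_germ g) \<Longrightarrow> hol_germ (\<lambda>x. if P then f x else g x)"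
  by (cases P) auto

section \<open>Taylor expansion in one coordinate\<close>

lemma hol_grad_ball:
  assumes "hol_grad f G"
  obtains e where "e > 0" "\<And>x. norm x < e \<Longrightarrow> isCont G x"
    "\<And>x. norm x < e \<Longrightarrow> (f has_derivative cdot (G x)) (at x)"
  using assms unfolding hol_grad_def eventually_nhds_metric by (metis dist_0_norm dist_commute)

lemma hol_gradI_ball:
  assumes "e > 0" "\<And>x. norm x < e \<Longrightarrow> isCont G x"
    "\<And>x. norm x < e \<Longrightarrow> (f has_derivative cdot (G x)) (at x)"
  shows "hol_grad f G"
  using assms unfolding hol_grad_def eventually_nhds_metric by (metis dist_0_norm dist_commute)

lemma hol_grad_integral:
  fixes H :: "complex^'n \<Rightarrow> real \<Rightarrow> complex"
  assumes e: "e > 0"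
    and der: "\<And>x t. norm x < e \<Longrightarrow> t \<in> {0..1} \<Longrightarrow> ((\<lambda>x. H x t) has_derivative cdot (K x t)) (at x)"
    and cont: "continuous_on (ball 0 e \<times> {0..1}) (\<lambda>(x, t). K x t)"
    and contH: "\<And>x. norm x < e \<Longrightarrow> continuous_on {0..1} (H x)"
  shows "hol_grad (\<lambda>x. integral {0..1} (H x)) (\<lambda>x. integral {0..1} (K x))"
proof (rule hol_gradI_ball[OF e])
  fix x :: "complex^'n" assume x: "norm x < e"
  have "continuous_on (ball 0 e) (\<lambda>x. integral (cbox 0 1) (K x))"
    by (rule integral_continuous_on_param) (use cont in simp)
  then show "isCont (\<lambda>x. integral {0..1} (K x)) x"
    using x by (simp add: continuous_on_eq_continuous_at)
  have blc: "blinfun_apply (Blinfun (cdot g)) = cdot g" for g :: "complex^'n"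
    by (rule bounded_linear_Blinfun_apply[OF bounded_linear_cdot])
  have cB: "continuous_on (ball 0 e \<times> cbox 0 1) (\<lambda>(x, t). Blinfun (cdot (K x t)))"
    unfolding split_beta
  proof (rule continuous_on_blinfun_componentwise)
    fix i :: "complex^'n"
    have "continuous_on (ball 0 e \<times> cbox 0 1) (\<lambda>p. K (fst p) (snd p))"
      using cont by (simp add: split_beta)
    then show "continuous_on (ball 0 e \<times> cbox 0 1) (\<lambda>p. blinfun_apply (Blinfun (cdot (K (fst p) (snd p)))) i)"
      unfolding blc unfolding cdot_def by (intro continuous_intros)
  qed
  have D: "((\<lambda>x. integral (cbox 0 1) (H x)) has_derivative
      blinfun_apply (integral (cbox 0 1) (\<lambda>t. Blinfun (cdot (K x t))))) (at x within ball 0 e)"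
  proof (rule leibniz_rule)
    show "((\<lambda>x. H x t) has_derivative blinfun_apply (Blinfun (cdot (K y t)))) (at y within ball 0 e)"
      if "y \<in> ball 0 e" "t \<in> cbox 0 1" for y t
      using der[of y t] that by (simp add: blc has_derivative_at_withinI)
    show "H y integrable_on cbox 0 1" if "y \<in> ball 0 e" for y
      using contH[of y] that by (intro integrable_continuous) simp
  qed (use x cB in auto)
  have cKx: "continuous_on {0..1} (K x)"
  proof -
    have "continuous_on {0..1} (\<lambda>t. (\<lambda>(x,t). K x t) (x, t))"
      by (rule continuous_on_compose2[OF cont]) (use x in \<open>auto intro!: continuous_intros\<close>)
    then show ?thesis by simp
  qed
  have cBx: "continuous_on {0..1} (\<lambda>t. Blinfun (cdot (K x t)))"
  proof -
    have "continuous_on {0..1} (\<lambda>t. (\<lambda>(x,t). Blinfun (cdot (K x t))) (x, t))"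
      by (rule continuous_on_compose2[OF cB]) (use x in \<open>auto intro!: continuous_intros\<close>)
    then show ?thesis by simp
  qed
  have "blinfun_apply (integral {0..1} (\<lambda>t. Blinfun (cdot (K x t)))) v = cdot (integral {0..1} (K x)) v" for v
  proof -
    have bl: "bounded_linear (\<lambda>g. cdot g v)"
      unfolding cdot_def
      by (intro bounded_linear_sum bounded_linear_compose[OF bounded_linear_mult_left] bounded_linear_vec_nth)
    have "blinfun_apply (integral {0..1} (\<lambda>t. Blinfun (cdot (K x t)))) v = integral {0..1} (\<lambda>t. cdot (K x t) v)"
      by (subst blinfun_apply_integral) (use cBx in \<open>auto simp: blc integrable_continuous_real\<close>)
    also have "\<dots> = cdot (integral {0..1} (K x)) v"
      using integral_linear[OF integrable_continuous_real[OF cKx] bl] by (simp add: o_def)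
    finally show ?thesis .
  qed
  then have "blinfun_apply (integral {0..1} (\<lambda>t. Blinfun (cdot (K x t)))) = cdot (integral {0..1} (K x))"
    by (rule ext)
  then show "((\<lambda>x. integral {0..1} (H x)) has_derivative cdot (integral {0..1} (K x))) (at x)"
    using D x by (simp add: at_within_open[of x "ball 0 e"])
qed

text \<open>The vector \<open>x\<close> with its \<open>n\<close>-th coordinate replaced by \<open>w\<close>.\<close>

definition vec_upd :: "complex^'n \<Rightarrow> 'n \<Rightarrow> complex \<Rightarrow> complex^'n" where
  "vec_upd x n w = (\<chi> i. if i = n then w else x $ i)"

lemma vec_upd_nth [simp]: "vec_upd x n w $ i = (if i = n then w else x $ i)"
  by (simp add: vec_upd_def)

lemma vec_upd_same [simp]: "vec_upd x n (x $ n) = x" by (simp add: vec_eq_iff)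
lemma vec_upd_upd [simp]: "vec_upd (vec_upd x n v) n w = vec_upd x n w" by (simp add: vec_eq_iff)
lemma vec_upd_0_0 [simp]: "vec_upd 0 n 0 = 0" by (simp add: vec_eq_iff)

lemma vec_upd_eq: "vec_upd x n w = vec_upd x n 0 + axis n w"
  by (simp add: vec_eq_iff axis_def)

lemma norm_vec_upd_0: "norm (vec_upd x n 0) \<le> norm x"
  by (rule norm_le_componentwise_cart) simp

lemma norm_axis_le: "norm (axis n (w::complex)) \<le> norm w"
proof -
  have "norm (axis n w) \<le> (\<Sum>i\<in>UNIV. norm (axis n w $ i))"
    unfolding norm_vec_def by (rule L2_set_le_sum) simp
  also have "\<dots> = (\<Sum>i\<in>UNIV. if i = n then norm w else 0)"
    by (intro sum.cong) (auto simp: axis_def)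
  finally show ?thesis by simp
qed

lemma norm_vec_upd: "norm (vec_upd x n w) \<le> norm x + norm w"
  using norm_triangle_ineq[of "vec_upd x n 0" "axis n w"] norm_vec_upd_0[of x n] norm_axis_le[of n w]
  by (simp add: vec_upd_eq[of x n w])

lemma continuous_on_vec_upd [continuous_intros]:
  "continuous_on S f \<Longrightarrow> continuous_on S g \<Longrightarrow> continuous_on S (\<lambda>x. vec_upd (f x) n (g x))"
  unfolding vec_upd_def
proof (rule continuous_on_vec_lambda)
  fix i assume "continuous_on S f" "continuous_on S g"
  then show "continuous_on S (\<lambda>x. if i = n then g x else f x $ i)"
    by (cases "i = n") (auto intro: continuous_intros)
qed

lemma vec_upd_0_tendsto: "((\<lambda>x::complex^'n. vec_upd x n 0) \<longlongrightarrow> 0) (nhds 0)"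
proof (rule vec_tendstoI)
  fix i
  have "((\<lambda>x::complex^'n. x $ i) \<longlongrightarrow> 0 $ i) (nhds 0)"
    by (rule tendsto_vec_nth[OF filterlim_ident])
  then show "((\<lambda>x::complex^'n. vec_upd x n 0 $ i) \<longlongrightarrow> 0 $ i) (nhds 0)" by (cases "i = n") auto
qed

lemma has_derivative_vec_upd: "((\<lambda>x. vec_upd x n w) has_derivative (\<lambda>v. vec_upd v n 0)) (at x)"
proof -
  have "((\<lambda>x. vec_upd x n w $ i) has_derivative (\<lambda>v. if i = n then 0 else v $ i)) (at x)" for i
    by (cases "i = n") (auto intro: bounded_linear_imp_has_derivative[OF bounded_linear_vec_nth])
  from has_derivative_vec[OF this] show ?thesis by (simp add: vec_upd_def)
qed

lemma has_field_derivative_vec_upd: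
  assumes "(g has_derivative cdot G) (at (vec_upd x n w))"
  shows "((\<lambda>w. g (vec_upd x n w)) has_field_derivative G $ n) (at w)"
proof -
  have "((\<lambda>w. vec_upd x n w $ i) has_derivative (\<lambda>v. if i = n then v else 0)) (at w)" for i
    by (cases "i = n") auto
  from has_derivative_vec[OF this] have "((\<lambda>w. vec_upd x n w) has_derivative (\<lambda>v. axis n v)) (at w)"
    by (simp add: axis_def)
  from has_derivative_compose[OF this assms] show ?thesis
    by (simp add: has_field_derivative_def cdot_axis)
qed

text \<open>Cauchy integrals in the \<open>n\<close>-th coordinate. The case \<open>l = 0\<close> gives Taylor coefficients at
  \<open>x $ n = 0\<close>, the case \<open>m = 0\<close> derivatives at \<open>x $ n\<close>, and \<open>l = 1\<close> Taylor remainders.\<close>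

lemma hol_germ_circle_integral:
  fixes g :: "complex^'n \<Rightarrow> complex"
  assumes r: "r > 0" and cG: "\<And>x. norm x < 2 * r \<Longrightarrow> isCont G x"
    and dg: "\<And>x. norm x < 2 * r \<Longrightarrow> (g has_derivative cdot (G x)) (at x)"
  shows "hol_germ (\<lambda>x. contour_integral (circlepath 0 r) (\<lambda>w. g (vec_upd x n w) / (w ^ m * (w - x $ n) ^ l)))"
proof -
  define c where "c = (\<lambda>t. circlepath 0 r t)"
  define c' where "c' = (\<lambda>t. vector_derivative (circlepath 0 r) (at t))"
  have c': "c' t = 2 * pi * \<i> * r * exp (2 * of_real pi * \<i> * t)" for t
    unfolding c'_def by (simp add: vector_derivative_circlepath)
  have cc: "continuous_on S c" for S
    unfolding c_def circlepath by (intro continuous_intros)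
  have cc': "continuous_on S c'" for S
    unfolding c' by (intro continuous_intros)
  have nc: "norm (c t) = r" for t
    unfolding c_def circlepath using r by (simp add: norm_mult)
  define k where "k = (\<lambda>s t. c' t / c t ^ m * inverse (c t - s) ^ l)"
  define k' where "k' = (\<lambda>s t. c' t / c t ^ m * (of_nat l * inverse (c t - s) ^ Suc l))"
  have ne: "c t \<noteq> 0" for t using nc[of t] r by auto
  have ne2: "c t - s \<noteq> 0" if "norm s < r" for s t using nc[of t] that by auto
  have dk: "((\<lambda>s. k s t) has_field_derivative k' s t) (at s)" if "norm s < r" for s t
  proof -
    have "((\<lambda>s. inverse (c t - s)) has_field_derivative inverse (c t - s) ^ 2) (at s)"
      using ne2[OF that, of t] by (auto intro!: derivative_eq_intros simp: power2_eq_square)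
    from DERIV_cmult[OF DERIV_power[OF this, of l], of "c' t / c t ^ m"]
    show ?thesis unfolding k_def k'_def
      by (rule DERIV_cong) (cases l, simp_all add: power2_eq_square)
  qed
  have xn: "norm (x $ n) < r" if "norm x < r" for x :: "complex^'n"
    using Finite_Cartesian_Product.norm_nth_le[of x n] that by linarith
  have ub: "norm (vec_upd x n (c t)) < 2 * r" if "norm x < r" for x t
    using norm_vec_upd[of x n "c t"] nc[of t] that by linarith
  define K where "K = (\<lambda>x t. (\<chi> i. if i = n then g (vec_upd x n (c t)) * k' (x $ n) t
    else G (vec_upd x n (c t)) $ i * k (x $ n) t))"
  have ev: "contour_integral (circlepath 0 r) (\<lambda>w. g (vec_upd x n w) / (w ^ m * (w - x $ n) ^ l)) =
      integral {0..1} (\<lambda>t. g (vec_upd x n (c t)) * k (x $ n) t)" for x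
    unfolding contour_integral_integral k_def c_def c'_def
    by (simp add: divide_inverse power_inverse mult_ac)
  have cg: "continuous_on (ball 0 (2*r)) g"
    by (rule continuous_at_imp_continuous_on) (auto intro: has_derivative_continuous[OF dg])
  have cG': "continuous_on (ball 0 (2*r)) G"
    by (rule continuous_at_imp_continuous_on) (use cG in auto)
  have "hol_grad (\<lambda>x. integral {0..1} (\<lambda>t. g (vec_upd x n (c t)) * k (x $ n) t)) (\<lambda>x. integral {0..1} (K x))"
  proof (rule hol_grad_integral[OF r])
    fix x :: "complex^'n" and t :: real assume x: "norm x < r" and "t \<in> {0..1}"
    have 1: "((\<lambda>x. g (vec_upd x n (c t))) has_derivative (\<lambda>v. cdot (G (vec_upd x n (c t))) (vec_upd v n 0))) (at x)"
      by (rule has_derivative_compose[OF has_derivative_vec_upd dg[OF ub[OF x]]])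
    have 2: "((\<lambda>x. k (x $ n) t) has_derivative (\<lambda>v. k' (x $ n) t * v $ n)) (at x)"
      by (rule has_derivative_compose[OF bounded_linear_imp_has_derivative[OF bounded_linear_vec_nth]])
        (use dk[OF xn[OF x]] in \<open>simp add: has_field_derivative_def\<close>)
    have "cdot (K x t) v = g (vec_upd x n (c t)) * (k' (x $ n) t * v $ n) + cdot (G (vec_upd x n (c t))) (vec_upd v n 0) * k (x $ n) t" for v
    proof -
      have "cdot (K x t) v = (\<Sum>i\<in>UNIV. (if i = n then g (vec_upd x n (c t)) * (k' (x $ n) t * v $ n) else 0) +
        G (vec_upd x n (c t)) $ i * vec_upd v n 0 $ i * k (x $ n) t)"
        unfolding cdot_def K_def by (intro sum.cong) auto
      also have "\<dots> = g (vec_upd x n (c t)) * (k' (x $ n) t * v $ n) + cdot (G (vec_upd x n (c t))) (vec_upd v n 0) * k (x $ n) t"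
        by (simp only: sum.distrib cdot_def sum_distrib_right) simp
      finally show ?thesis .
    qed
    then have "cdot (K x t) = (\<lambda>v. g (vec_upd x n (c t)) * (k' (x $ n) t * v $ n) + cdot (G (vec_upd x n (c t))) (vec_upd v n 0) * k (x $ n) t)"
      by (rule ext)
    then show "((\<lambda>x. g (vec_upd x n (c t)) * k (x $ n) t) has_derivative cdot (K x t)) (at x)"
      using has_derivative_mult[OF 1 2] by simp
  next
    let ?S = "ball (0::complex^'n) r \<times> {0..1::real}"
    have s: "continuous_on ?S (\<lambda>p. c (snd p))" "continuous_on ?S (\<lambda>p. c' (snd p))"
      by (rule continuous_on_compose2[OF cc] continuous_on_compose2[OF cc']; auto intro!: continuous_intros)+
    have u: "continuous_on ?S (\<lambda>p. vec_upd (fst p) n (c (snd p)))"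
      by (intro continuous_intros s)
    have gu: "continuous_on ?S (\<lambda>p. g (vec_upd (fst p) n (c (snd p))))"
      by (rule continuous_on_compose2[OF cg u]) (use ub in auto)
    have Gu: "continuous_on ?S (\<lambda>p. G (vec_upd (fst p) n (c (snd p))))"
      by (rule continuous_on_compose2[OF cG' u]) (use ub in auto)
    have k: "continuous_on ?S (\<lambda>p. k (fst p $ n) (snd p))" "continuous_on ?S (\<lambda>p. k' (fst p $ n) (snd p))"
      unfolding k_def k'_def by (intro continuous_intros s; use ne ne2 xn in auto)+
    have "continuous_on ?S (\<lambda>p. K (fst p) (snd p))"
      unfolding K_def
    proof (rule continuous_on_vec_lambda)
      fix i show "continuous_on ?S (\<lambda>p. if i = n then g (vec_upd (fst p) n (c (snd p))) * k' (fst p $ n) (snd p)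
          else G (vec_upd (fst p) n (c (snd p))) $ i * k (fst p $ n) (snd p))"
        by (cases "i = n") (simp_all, intro continuous_intros gu k, intro continuous_intros Gu k)
    qed
    then show "continuous_on ?S (\<lambda>(x, t). K x t)" by (simp add: split_beta)
  next
    fix x :: "complex^'n" assume x: "norm x < r"
    have "continuous_on {0..1} (\<lambda>t. g (vec_upd x n (c t)))"
      by (rule continuous_on_compose2[OF cg]) (use ub[OF x] in \<open>auto intro!: continuous_intros cc\<close>)
    then show "continuous_on {0..1} (\<lambda>t. g (vec_upd x n (c t)) * k (x $ n) t)"
      unfolding k_def by (intro continuous_intros cc cc') (use ne ne2[OF xn[OF x]] in auto)
  qed
  then show ?thesis unfolding ev by (rule hol_germI)
qed

lemma hol_germ_radius:
  assumes "hol_germ g"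
  obtains r G where "r > 0" "\<And>x. norm x < 2 * r \<Longrightarrow> isCont G x"
    "\<And>x. norm x < 2 * r \<Longrightarrow> (g has_derivative cdot (G x)) (at x)"
proof -
  obtain G where "hol_grad g G" using assms by (auto simp: hol_germ_def)
  then obtain e where "e > 0" "\<And>x. norm x < e \<Longrightarrow> isCont G x"
    "\<And>x. norm x < e \<Longrightarrow> (g has_derivative cdot (G x)) (at x)" using hol_grad_ball by blast
  then show thesis using that[of "e/2" G] by simp
qed

lemma holomorphic_vec_upd:
  fixes g :: "complex^'n \<Rightarrow> complex"
  assumes "\<And>x. norm x < 2 * r \<Longrightarrow> (g has_derivative cdot (G x)) (at x)"
  shows "(\<lambda>w. g (vec_upd x n w)) holomorphic_on ball 0 (2 * r - norm x)"
proof (rule holomorphic_onI)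
  fix w :: complex assume "w \<in> ball 0 (2 * r - norm x)"
  then have "norm (vec_upd x n w) < 2 * r" using norm_vec_upd[of x n w] by simp
  from has_field_derivative_vec_upd[OF assms[OF this]]
  show "(\<lambda>w. g (vec_upd x n w)) field_differentiable at w within ball 0 (2 * r - norm x)"
    using field_differentiable_at_within field_differentiable_def by blast
qed

text \<open>The value of \<open>f\<close> is determined by the coordinates in \<open>A\<close>. The ambient space stays fixed and
  inductions over the number of variables run over the set \<open>A\<close>. The condition is imposed on
  all of the space, not just near the origin.\<close>

definition depends_on :: "'n set \<Rightarrow> (complex^'n \<Rightarrow> complex) \<Rightarrow> bool" where
  "depends_on A f \<longleftrightarrow> (\<forall>x y. (\<forall>i\<in>A. x $ i = y $ i) \<longrightarrow> f x = f y)"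

lemma depends_onD: "depends_on A f \<Longrightarrow> (\<And>i. i \<in> A \<Longrightarrow> x $ i = y $ i) \<Longrightarrow> f x = f y"
  by (auto simp: depends_on_def)

lemma depends_on_superset: "depends_on A f \<Longrightarrow> A \<subseteq> B \<Longrightarrow> depends_on B f"
  by (auto simp: depends_on_def)

lemma depends_on_vec_upd: "depends_on A f \<Longrightarrow> n \<notin> A \<Longrightarrow> f (vec_upd x n w) = f x"
  by (rule depends_onD[of A]) auto

text \<open>The \<open>j\<close>-th Taylor coefficient of \<open>g\<close> in the variable \<open>x $ n\<close>, expanded at \<open>x $ n = 0\<close>; it is
  a function of the remaining coordinates.\<close>

definition taylor_coeff :: "'n \<Rightarrow> nat \<Rightarrow> (complex^'n \<Rightarrow> complex) \<Rightarrow> complex^'n \<Rightarrow> complex" where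
  "taylor_coeff n j g x = (deriv ^^ j) (\<lambda>w. g (vec_upd x n w)) 0 / fact j"

lemma depends_on_taylor_coeff: "depends_on (insert n A) g \<Longrightarrow> depends_on A (taylor_coeff n j g)"
  unfolding depends_on_def[of A] taylor_coeff_def
proof (intro allI impI)
  fix x y :: "complex^'a" assume "depends_on (insert n A) g" "\<forall>i\<in>A. x $ i = y $ i"
  then have "(\<lambda>w. g (vec_upd x n w)) = (\<lambda>w. g (vec_upd y n w))"
    by (intro ext depends_onD[of "insert n A" g]) auto
  then show "(deriv ^^ j) (\<lambda>w. g (vec_upd x n w)) 0 / fact j = (deriv ^^ j) (\<lambda>w. g (vec_upd y n w)) 0 / fact j"
    by simp
qed

lemma eventually_norm_less: "e > 0 \<Longrightarrow> \<forall>\<^sub>F x in nhds (0::'a::real_normed_vector). norm x < e"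
  unfolding eventually_nhds_metric by (intro exI[of _ e]) simp

lemma hol_germ_higher_deriv:
  assumes "hol_germ (g :: complex^'n \<Rightarrow> complex)"
  shows "hol_germ (\<lambda>x. (deriv ^^ k) (\<lambda>w. g (vec_upd x n w)) (x $ n))"
    and "hol_germ (taylor_coeff n k g)"
proof -
  obtain r G where r: "r > 0" and cG: "\<And>x. norm x < 2 * r \<Longrightarrow> isCont G x"
    and dg: "\<And>x. norm x < 2 * r \<Longrightarrow> (g has_derivative cdot (G x)) (at x)"
    using hol_germ_radius[OF assms] by blast
  have cauchy: "(deriv ^^ k) (\<lambda>w. g (vec_upd x n w)) s = fact k / (2 * pi * \<i>) *
      contour_integral (circlepath 0 r) (\<lambda>w. g (vec_upd x n w) / (w - s) ^ Suc k)"
    if x: "norm x < r" and "norm s < r" for x s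
  proof (rule Cauchy_higher_derivative_integral_circlepath(2))
    have h: "(\<lambda>w. g (vec_upd x n w)) holomorphic_on ball 0 (2 * r - norm x)"
      by (rule holomorphic_vec_upd[OF dg])
    have sub: "cball 0 r \<subseteq> ball 0 (2 * r - norm x)" using x by auto
    show "continuous_on (cball 0 r) (\<lambda>w. g (vec_upd x n w))"
      using holomorphic_on_subset[OF h sub] by (rule holomorphic_on_imp_continuous_on)
    show "(\<lambda>w. g (vec_upd x n w)) holomorphic_on ball 0 r"
      using holomorphic_on_subset[OF h sub] ball_subset_cball holomorphic_on_subset by blast
  qed (use that in auto)
  have ci: "hol_germ (\<lambda>x. contour_integral (circlepath 0 r) (\<lambda>w. g (vec_upd x n w) / (w ^ m * (w - x $ n) ^ l)))" for m l
    by (rule hol_germ_circle_integral[OF r cG dg])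
  have ev: "\<forall>\<^sub>F x in nhds 0. norm (x::complex^'n) < r" using r by (rule eventually_norm_less)
  have xn: "norm (x $ n) < r" if "norm x < r" for x :: "complex^'n"
    using Finite_Cartesian_Product.norm_nth_le[of x n] that by linarith
  show "hol_germ (\<lambda>x. (deriv ^^ k) (\<lambda>w. g (vec_upd x n w)) (x $ n))"
  proof (rule hol_germ_cong)
    show "hol_germ (\<lambda>x. fact k / (2 * pi * \<i>) *
      contour_integral (circlepath 0 r) (\<lambda>w. g (vec_upd x n w) / (w ^ 0 * (w - x $ n) ^ Suc k)))"
      by (intro hol_germ_mult hol_germ_const ci)
    show "\<forall>\<^sub>F x in nhds 0. fact k / (2 * pi * \<i>) *
      contour_integral (circlepath 0 r) (\<lambda>w. g (vec_upd x n w) / (w ^ 0 * (w - x $ n) ^ Suc k)) =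
      (deriv ^^ k) (\<lambda>w. g (vec_upd x n w)) (x $ n)"
      using ev by eventually_elim (simp add: cauchy xn)
  qed
  show "hol_germ (taylor_coeff n k g)"
  proof (rule hol_germ_cong)
    show "hol_germ (\<lambda>x. (fact k / (2 * pi * \<i>) / fact k) *
      contour_integral (circlepath 0 r) (\<lambda>w. g (vec_upd x n w) / (w ^ Suc k * (w - x $ n) ^ 0)))"
      by (intro hol_germ_mult hol_germ_const ci)
    show "\<forall>\<^sub>F x in nhds 0. (fact k / (2 * pi * \<i>) / fact k) *
      contour_integral (circlepath 0 r) (\<lambda>w. g (vec_upd x n w) / (w ^ Suc k * (w - x $ n) ^ 0)) = taylor_coeff n k g x"
      using ev by eventually_elim (use r in \<open>simp add: cauchy taylor_coeff_def\<close>)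
  qed
qed

text \<open>Taylor's formula in one coordinate with holomorphic coefficients and remainder, obtained from
  \<open>1 / (w - s) = 1 / w + s / (w * (w - s))\<close> under the Cauchy integral.\<close>

lemma taylor_remainder:
  assumes "hol_germ (g :: complex^'n \<Rightarrow> complex)"
  obtains R where "hol_germ R" "R 0 = taylor_coeff n m g 0"
    "\<forall>\<^sub>F x in nhds 0. g x = (\<Sum>j<m. taylor_coeff n j g x * x $ n ^ j) + x $ n ^ m * R x"
    "\<And>A. depends_on (insert n A) g \<Longrightarrow> depends_on (insert n A) R"
proof -
  obtain r G where r: "r > 0" and cG: "\<And>x. norm x < 2 * r \<Longrightarrow> isCont G x"
    and dg: "\<And>x. norm x < 2 * r \<Longrightarrow> (g has_derivative cdot (G x)) (at x)"
    using hol_germ_radius[OF assms] by blast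
  define C where "C = (\<lambda>x m l. contour_integral (circlepath 0 r) (\<lambda>w. g (vec_upd x n w) / (w ^ m * (w - x $ n) ^ l)))"
  define R where "R = (\<lambda>m x. inverse (2 * pi * \<i>) * C x m 1)"
  have hR: "hol_germ (R m)" for m
    unfolding R_def C_def by (intro hol_germ_mult hol_germ_const hol_germ_circle_integral[OF r cG dg])
  have h: "(\<lambda>w. g (vec_upd x n w)) holomorphic_on cball 0 r" if x: "norm x < r" for x
    by (rule holomorphic_on_subset[OF holomorphic_vec_upd[OF dg]]) (use x in auto)
  have cont: "continuous_on (cball 0 r) (\<lambda>w. g (vec_upd x n w))" if x: "norm x < r" for x
    using h[OF x] by (rule holomorphic_on_imp_continuous_on)
  have hb: "(\<lambda>w. g (vec_upd x n w)) holomorphic_on ball 0 r" if x: "norm x < r" for x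
    using h[OF x] ball_subset_cball holomorphic_on_subset by blast
  have tc: "inverse (2 * pi * \<i>) * C x (Suc m) 0 = taylor_coeff n m g x" if x: "norm x < r" for m x
    using Cauchy_contour_integral_circlepath[OF cont[OF x] hb[OF x], of 0 m] r
    by (simp add: C_def taylor_coeff_def field_simps)
  have xn: "norm (x $ n) < r" if "norm x < r" for x :: "complex^'n"
    using Finite_Cartesian_Product.norm_nth_le[of x n] that by linarith
  have R0: "R 0 x = g x" if x: "norm x < r" for x
    using Cauchy_contour_integral_circlepath[OF cont[OF x] hb[OF x], of "x $ n" 0] xn[OF x]
    by (simp add: R_def C_def field_simps)
  have int: "(\<lambda>w. g (vec_upd x n w) / (w ^ m * (w - x $ n) ^ l)) contour_integrable_on circlepath 0 r"
    if x: "norm x < r" for x m l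
  proof (rule contour_integrable_continuous_circlepath)
    show "continuous_on (path_image (circlepath 0 r)) (\<lambda>w. g (vec_upd x n w) / (w ^ m * (w - x $ n) ^ l))"
    proof (intro continuous_intros continuous_on_subset[OF cont[OF x]])
      show "\<forall>w\<in>path_image (circlepath 0 r). w ^ m * (w - x $ n) ^ l \<noteq> 0"
        using r xn[OF x] by auto
    qed (use r in auto)
  qed
  have R_Suc: "R m x = taylor_coeff n m g x + x $ n * R (Suc m) x" if x: "norm x < r" for m x
  proof -
    have "C x m 1 = contour_integral (circlepath 0 r) (\<lambda>w. g (vec_upd x n w) / (w ^ Suc m * (w - x $ n) ^ 0) +
        x $ n * (g (vec_upd x n w) / (w ^ Suc m * (w - x $ n) ^ 1)))"
      unfolding C_def
    proof (rule contour_integral_cong[OF refl])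
      fix w assume "w \<in> path_image (circlepath 0 r)"
      then have "w \<noteq> 0" "w - x $ n \<noteq> 0" using r xn[OF x] by auto
      then show "g (vec_upd x n w) / (w ^ m * (w - x $ n) ^ 1) = g (vec_upd x n w) / (w ^ Suc m * (w - x $ n) ^ 0) +
        x $ n * (g (vec_upd x n w) / (w ^ Suc m * (w - x $ n) ^ 1))"
        by (simp add: divide_simps) (simp add: algebra_simps)
    qed
    also have "\<dots> = C x (Suc m) 0 + x $ n * C x (Suc m) 1"
      unfolding C_def
      by (subst contour_integral_add[OF int[OF x] contour_integrable_lmul[OF int[OF x]]],
          subst contour_integral_lmul[OF int[OF x]]) simp
    finally show ?thesis
      using tc[OF x, of m] unfolding R_def by (simp add: algebra_simps)
  qed
  have T: "g x = (\<Sum>j<m. taylor_coeff n j g x * x $ n ^ j) + x $ n ^ m * R m x" if x: "norm x < r" for m x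
  proof (induction m)
    case (Suc m)
    then show ?case using R_Suc[OF x, of m] by (simp add: algebra_simps)
  qed (use R0[OF x] in simp)
  show thesis
  proof
    show "hol_germ (R m)" by (rule hR)
    show "R m 0 = taylor_coeff n m g 0" using R_Suc[of 0 m] r by simp
    show "\<forall>\<^sub>F x in nhds 0. g x = (\<Sum>j<m. taylor_coeff n j g x * x $ n ^ j) + x $ n ^ m * R m x"
      using eventually_norm_less[OF r] by (rule eventually_mono) (rule T)
    show "depends_on (insert n A) (R m)" if "depends_on (insert n A) g" for A
      unfolding depends_on_def
    proof (intro allI impI)
      fix x y :: "complex^'n" assume *: "\<forall>i\<in>insert n A. x $ i = y $ i"
      then have "g (vec_upd x n w) = g (vec_upd y n w)" for w
        by (intro depends_onD[OF that]) auto
      then show "R m x = R m y" using * by (simp add: R_def C_def)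
    qed
  qed
qed

section \<open>Zero divisors and implicit functions\<close>

lemma holomorphic_line:
  fixes p q :: "complex^'n"
  assumes dg: "\<And>x. norm x < r \<Longrightarrow> (g has_derivative cdot (G x)) (at x)"
  shows "(\<lambda>t. g (\<chi> i. p $ i + t * q $ i)) holomorphic_on {t. norm (\<chi> i. p $ i + t * q $ i) < r}"
    and "open {t. norm (\<chi> i. p $ i + t * q $ i) < r}"
    and "convex {t. norm (\<chi> i. p $ i + t * q $ i) < r}"
proof -
  let ?L = "\<lambda>t. (\<chi> i. p $ i + t * q $ i)"
  have dL: "(?L has_derivative (\<lambda>v. \<chi> i. v * q $ i)) (at t)" for t
    by (rule has_derivative_vec) (auto intro!: derivative_eq_intros)
  show "(\<lambda>t. g (?L t)) holomorphic_on {t. norm (?L t) < r}"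
  proof (rule holomorphic_onI)
    fix t assume "t \<in> {t. norm (?L t) < r}"
    then have "(g has_derivative cdot (G (?L t))) (at (?L t))" using dg by simp
    from has_derivative_compose[OF dL this]
    have "((\<lambda>t. g (?L t)) has_derivative (\<lambda>v. cdot (G (?L t)) (\<chi> i. v * q $ i))) (at t)" .
    moreover have "cdot (G (?L t)) (\<chi> i. v * q $ i) = cdot (G (?L t)) q * v" for v
      by (simp add: cdot_def sum_distrib_right sum_distrib_left mult_ac)
    ultimately have "((\<lambda>t. g (?L t)) has_field_derivative cdot (G (?L t)) q) (at t)"
      by (simp add: has_field_derivative_def)
    then show "(\<lambda>t. g (?L t)) field_differentiable at t within {t. norm (?L t) < r}"
      using field_differentiable_at_within field_differentiable_def by blast
  qed
  have "continuous_on UNIV ?L"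
    by (rule continuous_on_vec_lambda) (intro continuous_intros)
  then show "open {t. norm (?L t) < r}"
    by (intro open_Collect_less continuous_intros)
  show "convex {t. norm (?L t) < r}"
  proof (rule convexI)
    fix s t and u v :: real
    assume *: "s \<in> {t. norm (?L t) < r}" "t \<in> {t. norm (?L t) < r}" "0 \<le> u" "0 \<le> v" "u + v = 1"
    have v: "v = 1 - u" using * by simp
    have "?L (u *\<^sub>R s + v *\<^sub>R t) = u *\<^sub>R ?L s + v *\<^sub>R ?L t"
      unfolding v vec_eq_iff vector_scaleR_component vector_add_component vec_lambda_beta
      by (simp add: scaleR_conv_of_real algebra_simps)
    also have "norm \<dots> < r"
      using convexD[OF convex_ball[of 0 r], of "?L s" "?L t" u v] * by simp
    finally show "u *\<^sub>R s + v *\<^sub>R t \<in> {t. norm (?L t) < r}" by simp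
  qed
qed

text \<open>Holomorphic germs form an integral domain. On the complex line through a point where \<open>f\<close> does not
  vanish and a point where \<open>g\<close> does not vanish, the identity theorem in one variable applies.\<close>

lemma hol_germ_mult_eq_0:
  fixes f g :: "complex^'n \<Rightarrow> complex"
  assumes "hol_germ f" "hol_germ g" "\<forall>\<^sub>F x in nhds 0. f x * g x = 0"
  shows "(\<forall>\<^sub>F x in nhds 0. f x = 0) \<or> (\<forall>\<^sub>F x in nhds 0. g x = 0)"
proof (rule ccontr)
  assume neg: "\<not> ?thesis"
  obtain F G where "hol_grad f F" "hol_grad g G" using assms by (auto simp: hol_germ_def)
  with assms(3) have "\<forall>\<^sub>F x in nhds 0. f x * g x = 0 \<and> (f has_derivative cdot (F x)) (at x) \<and> (g has_derivative cdot (G x)) (at x)"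
    unfolding hol_grad_def by eventually_elim auto
  then obtain r where r: "r > 0" and R: "\<And>x. norm x < r \<Longrightarrow> f x * g x = 0"
    "\<And>x. norm x < r \<Longrightarrow> (f has_derivative cdot (F x)) (at x)" "\<And>x. norm x < r \<Longrightarrow> (g has_derivative cdot (G x)) (at x)"
    unfolding eventually_nhds_metric by (auto simp: dist_norm)
  have "\<exists>p. norm p < r \<and> f p \<noteq> 0" "\<exists>q. norm q < r \<and> g q \<noteq> 0"
    using neg eventually_mono[OF eventually_norm_less[OF r], of "\<lambda>x. f x = 0"]
      eventually_mono[OF eventually_norm_less[OF r], of "\<lambda>x. g x = 0"] by blast+
  then obtain p q where p: "norm p < r" "f p \<noteq> 0" and q: "norm q < r" "g q \<noteq> 0" by blast
  define d where "d = q - p"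
  define L where "L = (\<lambda>t. (\<chi> i. p $ i + t * d $ i))"
  define S where "S = {t. norm (L t) < r}"
  have hf: "(\<lambda>t. f (L t)) holomorphic_on S" and hg: "(\<lambda>t. g (L t)) holomorphic_on S"
    and S: "open S" "convex S"
    unfolding S_def L_def using holomorphic_line[OF R(2), where p = p and q = d]
      holomorphic_line[OF R(3), where p = p and q = d] by auto
  have L0: "L 0 = p" and L1: "L 1 = q" by (simp_all add: vec_eq_iff L_def d_def)
  have S0: "0 \<in> S" and S1: "1 \<in> S" unfolding S_def mem_Collect_eq L0 L1 by (rule p q)+
  have "isCont (\<lambda>t. f (L t)) 0"
    using holomorphic_on_imp_continuous_on[OF hf] S S0 by (simp add: continuous_on_eq_continuous_at)
  then have "\<forall>\<^sub>F t in at 0. f (L t) \<noteq> 0"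
    unfolding isCont_def L0 using p(2) by (rule tendsto_imp_eventually_ne)
  moreover have "\<forall>\<^sub>F t in at 0. t \<in> S"
    using S(1) S0 by (rule eventually_at_in_open')
  ultimately have ev: "\<forall>\<^sub>F t in at 0. t \<in> S \<and> f (L t) \<noteq> 0" by (rule eventually_conj[rotated])
  let ?U = "{t. t \<in> S \<and> f (L t) \<noteq> 0}"
  have lim: "0 islimpt ?U"
    unfolding islimpt_conv_frequently_at mem_Collect_eq
    by (rule eventually_frequently[OF _ ev]) (simp add: trivial_limit_at)
  have "g (L 1) = 0"
  proof (rule analytic_continuation[OF hg S(1) convex_connected[OF S(2)] _ S0 lim _ S1])
    show "g (L t) = 0" if "t \<in> ?U" for t using R(1)[of "L t"] that by (auto simp: S_def)
  qed auto
  then show False using q unfolding L1 by simp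
qed

text \<open>Sets the coordinates outside \<open>A\<close> to zero.\<close>

definition vec_restr :: "'n set \<Rightarrow> complex^'n \<Rightarrow> complex^'n" where
  "vec_restr A x = (\<chi> i. if i \<in> A then x $ i else 0)"

lemma vec_restr_nth [simp]: "vec_restr A x $ i = (if i \<in> A then x $ i else 0)"
  by (simp add: vec_restr_def)

lemma vec_restr_0 [simp]: "vec_restr A 0 = 0" by (simp add: vec_eq_iff)

lemma hol_germ_vec_restr: "hol_germ f \<Longrightarrow> hol_germ (\<lambda>x. f (vec_restr A x))"
  by (rule hol_germ_comp) (auto simp: hol_germ_if)

lemma depends_on_vec_restr: "depends_on A (\<lambda>x. f (vec_restr A x))"
  unfolding depends_on_def by (intro allI impI arg_cong[of _ _ f]) (simp add: vec_eq_iff)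

lemma filterlim_vec0:
  fixes p :: "complex^'n \<Rightarrow> complex^'n"
  assumes "\<And>i. hol_germ (\<lambda>x. p x $ i)" "p 0 = 0"
  shows "filterlim p (nhds 0) (nhds 0)"
proof (rule vec_tendstoI)
  show "((\<lambda>x. p x $ i) \<longlongrightarrow> 0 $ i) (nhds 0)" for i
    using hol_germ_tendsto0[OF assms(1)[of i]] assms(2) by simp
qed

text \<open>The implicit function theorem, from the real inverse function theorem applied to
  \<open>x \<mapsto> vec_upd x n (q x)\<close>. The real derivative of the local inverse is computed from
  uniqueness of derivatives, which exhibits it as complex linear.\<close>

lemma implicit_function:
  fixes q :: "complex^'n \<Rightarrow> complex"
  assumes q: "hol_germ q" and dq: "depends_on (insert n A) q" and n: "n \<notin> A" and q0: "q 0 = 0"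
    and der: "deriv (\<lambda>w. q (vec_upd 0 n w)) 0 \<noteq> 0"
  obtains a where "hol_germ a" "depends_on A a" "a 0 = 0" "\<forall>\<^sub>F x in nhds 0. q (vec_upd x n (a x)) = 0"
proof -
  obtain G where "hol_grad q G" using q by (auto simp: hol_germ_def)
  then obtain e where e: "e > 0" and cG: "\<And>x. norm x < e \<Longrightarrow> isCont G x"
    and dG: "\<And>x. norm x < e \<Longrightarrow> (q has_derivative cdot (G x)) (at x)" using hol_grad_ball by blast
  have G0: "G 0 $ n \<noteq> 0"
    using has_field_derivative_vec_upd[of q "G 0" 0 n 0] dG[of 0] e der by (auto dest: DERIV_imp_deriv)
  define P where "P = (\<lambda>x. vec_upd x n (q x))"
  define D where "D = (\<lambda>g v. vec_upd v n (cdot g v) :: complex^'n)"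
  have blD: "bounded_linear (D g)" for g
  proof -
    have "linear (D g)"
      using linear_add[OF bounded_linear.linear[OF bounded_linear_cdot[of g]]]
        linear_cmul[OF bounded_linear.linear[OF bounded_linear_cdot[of g]]]
      by (intro linearI) (auto simp: D_def vec_eq_iff)
    then show ?thesis by (simp add: linear_conv_bounded_linear)
  qed
  have appD: "blinfun_apply (Blinfun (D g)) = D g" for g
    by (rule bounded_linear_Blinfun_apply[OF blD])
  define I where "I = (\<lambda>v. vec_upd v n ((v $ n - cdot (vec_upd (G 0) n 0) v) * inverse (G 0 $ n)) :: complex^'n)"
  have blI: "bounded_linear I"
  proof -
    have "linear I"
      using linear_add[OF bounded_linear.linear[OF bounded_linear_cdot[of "vec_upd (G 0) n 0"]]]
        linear_cmul[OF bounded_linear.linear[OF bounded_linear_cdot[of "vec_upd (G 0) n 0"]]]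
      by (intro linearI) (auto simp: I_def vec_eq_iff algebra_simps)
    then show ?thesis by (simp add: linear_conv_bounded_linear)
  qed
  have split: "cdot g v = g $ n * v $ n + cdot (vec_upd g n 0) v" for g v :: "complex^'n"
  proof -
    have "cdot g v = (\<Sum>i\<in>UNIV. (if i = n then g $ n * v $ n else 0) + vec_upd g n 0 $ i * v $ i)"
      unfolding cdot_def by (intro sum.cong) auto
    then show ?thesis by (simp add: sum.distrib cdot_def)
  qed
  have cupd: "cdot (vec_upd g n 0) (vec_upd v n w) = cdot (vec_upd g n 0) v" for g v w
    unfolding cdot_def by (intro sum.cong) auto
  have inv: "Blinfun I o\<^sub>L Blinfun (D (G 0)) = id_blinfun"
  proof (rule blinfun_eqI)
    fix v
    have "I (D (G 0) v) = v"
      unfolding I_def D_def using G0 by (simp add: cupd split[of "G 0" v] vec_eq_iff)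
    then show "blinfun_apply (Blinfun I o\<^sub>L Blinfun (D (G 0))) v = blinfun_apply id_blinfun v"
      by (simp add: appD bounded_linear_Blinfun_apply[OF blI])
  qed
  define U where "U = ball (0::complex^'n) e"
  have cGU: "continuous_on U G" unfolding U_def
    by (rule continuous_at_imp_continuous_on) (use cG in auto)
  have cU: "continuous_on U (\<lambda>x. Blinfun (D (G x)))"
  proof (rule continuous_on_blinfun_componentwise)
    fix i :: "complex^'n"
    show "continuous_on U (\<lambda>x. blinfun_apply (Blinfun (D (G x))) i)"
      unfolding appD unfolding D_def cdot_def by (intro continuous_intros cGU)
  qed
  have dP: "(P has_derivative blinfun_apply (Blinfun (D (G x)))) (at x)" if "x \<in> U" for x
  proof -
    have "((\<lambda>x. P x $ i) has_derivative (\<lambda>v. D (G x) v $ i)) (at x)" for i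
      using dG[of x] that unfolding P_def D_def U_def
      by (cases "i = n") (auto intro: bounded_linear_imp_has_derivative[OF bounded_linear_vec_nth])
    from has_derivative_vec[OF this] show ?thesis by (simp add: appD)
  qed
  have "open U" "0 \<in> U" using e by (auto simp: U_def)
  then obtain U' V g g' where UV: "open U'" "U' \<subseteq> U" "0 \<in> U'" "open V" "P 0 \<in> V" "homeomorphism U' V P g"
    and g: "\<And>y. y \<in> V \<Longrightarrow> (g has_derivative (g' y)) (at y)"
    using inverse_function_theorem[OF _ dP cU _ inv] by metis
  have P0: "P 0 = 0" using q0 by (simp add: P_def)
  have Pg: "P (g y) = y" "g y \<in> U'" if "y \<in> V" for y
    using UV(6) that by (auto simp: homeomorphism_def)
  have g0: "g 0 = 0" using UV(3,6) P0 by (metis homeomorphism_apply1)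
  have V0: "0 \<in> V" using UV(5) P0 by simp
  have gi: "g y $ i = y $ i" if "y \<in> V" "i \<noteq> n" for y i
    using Pg(1)[OF that(1)] that(2) by (metis P_def vec_upd_nth)
  have qg: "q (g y) = y $ n" if "y \<in> V" for y
    using Pg(1)[OF that] by (metis P_def vec_upd_nth)
  have evV: "\<forall>\<^sub>F y in nhds 0. y \<in> V" using UV(4) V0 by (rule eventually_nhds_in_open)
  have cGg: "isCont (\<lambda>y. G (g y)) y" if "y \<in> V" for y
  proof (rule isCont_o2[where f = g and g = G])
    show "isCont g y" using g[OF that] by (rule has_derivative_continuous)
    show "isCont G (g y)" using cG Pg(2)[OF that] UV(2) by (auto simp: U_def)
  qed
  have "\<forall>\<^sub>F y in nhds 0. G (g y) $ n \<noteq> 0"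
  proof -
    have "((\<lambda>y. G (g y) $ n) \<longlongrightarrow> G (g 0) $ n) (nhds 0)"
      using isCont_vec_nth[OF cGg[OF V0], of n] by (metis isCont_def tendsto_at_iff_tendsto_nhds)
    then show ?thesis by (rule tendsto_imp_eventually_ne) (simp add: G0 g0)
  qed
  define H where "H = (\<lambda>y. \<chi> i. if i = n then 1 / G (g y) $ n else - G (g y) $ i / G (g y) $ n)"
  have "hol_grad (\<lambda>y. g y $ n) H"
    unfolding hol_grad_def using evV \<open>\<forall>\<^sub>F y in nhds 0. G (g y) $ n \<noteq> 0\<close>
  proof eventually_elim
    case (elim y)
    have ci: "isCont (\<lambda>y. G (g y) $ i) y" for i by (rule isCont_vec_nth[OF cGg[OF elim(1)]])
    have "isCont (\<lambda>y. if i = n then 1 / G (g y) $ n else - G (g y) $ i / G (g y) $ n) y" for i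
      by (cases "i = n") (use elim(2) in \<open>auto intro!: continuous_intros ci\<close>)
    then have "isCont H y" unfolding H_def by (intro isCont_vec) simp
    moreover have "((\<lambda>y. g y $ n) has_derivative cdot (H y)) (at y)"
    proof -
      have d1: "((\<lambda>y. g y $ i) has_derivative (\<lambda>v. g' y v $ i)) (at y)" for i
        by (rule bounded_linear.has_derivative[OF bounded_linear_vec_nth g[OF elim(1)]])
      have evy: "\<forall>\<^sub>F y' in nhds y. y' \<in> V" using UV(4) elim(1) by (rule eventually_nhds_in_open)
      have i: "g' y v $ i = v $ i" if "i \<noteq> n" for v i
      proof -
        have "((\<lambda>y. y $ i) has_derivative (\<lambda>v. g' y v $ i)) (at y)"
          by (rule has_derivative_transform_eventually[OF d1[of i]])
            (use evy elim gi that in \<open>auto simp: eventually_at_filter elim: eventually_mono\<close>)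
        moreover have "((\<lambda>y. y $ i) has_derivative (\<lambda>v. v $ i)) (at y)"
          by (rule bounded_linear_imp_has_derivative[OF bounded_linear_vec_nth])
        ultimately have "(\<lambda>v. g' y v $ i) = (\<lambda>v. v $ i)" by (rule has_derivative_unique)
        then show ?thesis by (rule fun_cong)
      qed
      have nn: "cdot (G (g y)) (g' y v) = v $ n" for v
      proof -
        have "(q has_derivative cdot (G (g y))) (at (g y))"
          using dG Pg(2)[OF elim(1)] UV(2) by (auto simp: U_def)
        from has_derivative_compose[OF g[OF elim(1)] this]
        have "((\<lambda>y. q (g y)) has_derivative (\<lambda>v. cdot (G (g y)) (g' y v))) (at y)" .
        then have "((\<lambda>y. y $ n) has_derivative (\<lambda>v. cdot (G (g y)) (g' y v))) (at y)"
          by (rule has_derivative_transform_eventually)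
            (use evy elim qg in \<open>auto simp: eventually_at_filter elim: eventually_mono\<close>)
        moreover have "((\<lambda>y. y $ n) has_derivative (\<lambda>v. v $ n)) (at y)"
          by (rule bounded_linear_imp_has_derivative[OF bounded_linear_vec_nth])
        ultimately have "(\<lambda>v. cdot (G (g y)) (g' y v)) = (\<lambda>v. v $ n)" by (rule has_derivative_unique)
        then show ?thesis by (rule fun_cong)
      qed
      have "g' y v $ n = cdot (H y) v" for v
      proof -
        have "cdot (vec_upd (G (g y)) n 0) (g' y v) = cdot (vec_upd (G (g y)) n 0) v"
          unfolding cdot_def by (intro sum.cong) (auto simp: i)
        with split[of "G (g y)" "g' y v"] nn[of v]
        have 1: "v $ n = G (g y) $ n * g' y v $ n + cdot (vec_upd (G (g y)) n 0) v" by simp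
        have "cdot (vec_upd (H y) n 0) v = - cdot (vec_upd (G (g y)) n 0) v / G (g y) $ n"
          unfolding cdot_def sum_divide_distrib sum_negf[symmetric] by (intro sum.cong) (auto simp: H_def)
        then have "cdot (H y) v = (v $ n - cdot (vec_upd (G (g y)) n 0) v) / G (g y) $ n"
          unfolding split[of "H y" v] by (simp add: H_def diff_divide_distrib)
        with 1 elim show ?thesis by simp
      qed
      then have "(\<lambda>v. g' y v $ n) = cdot (H y)" by (rule ext)
      with d1[of n] show ?thesis by simp
    qed
    ultimately show ?case by simp
  qed
  then have hg: "hol_germ (\<lambda>y. g y $ n)" by (rule hol_germI)
  show thesis
  proof (rule that[of "\<lambda>x. g (vec_restr A x) $ n"])
    show "hol_germ (\<lambda>x. g (vec_restr A x) $ n)" by (rule hol_germ_vec_restr[OF hg])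
    show "depends_on A (\<lambda>x. g (vec_restr A x) $ n)" by (rule depends_on_vec_restr)
    show "g (vec_restr A 0) $ n = 0" by (simp add: g0)
    have "filterlim (vec_restr A) (nhds (0::complex^'n)) (nhds 0)"
      by (rule filterlim_vec0) (auto simp: hol_germ_if)
    then have "\<forall>\<^sub>F x in nhds 0. vec_restr A x \<in> V" using evV by (rule eventually_compose_filterlim[rotated])
    then show "\<forall>\<^sub>F x in nhds 0. q (vec_upd x n (g (vec_restr A x) $ n)) = 0"
    proof eventually_elim
      case (elim x)
      have "q (vec_upd x n (g (vec_restr A x) $ n)) = q (g (vec_restr A x))"
      proof (rule depends_onD[OF dq])
        fix i assume "i \<in> insert n A"
        then show "vec_upd x n (g (vec_restr A x) $ n) $ i = g (vec_restr A x) $ i"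
          using gi[OF elim, of i] n by auto
      qed
      also have "\<dots> = 0" using qg[OF elim] n by simp
      finally show ?case .
    qed
  qed
qed

section \<open>Monomials times units\<close>

text \<open>The monomial with exponent vector \<open>b\<close> in the coordinates of \<open>A\<close>.\<close>

definition vmonom :: "'n set \<Rightarrow> ('n \<Rightarrow> nat) \<Rightarrow> complex^'n \<Rightarrow> complex" where
  "vmonom A b x = (\<Prod>i\<in>A. x $ i ^ b i)"

text \<open>Near the origin \<open>f\<close> is a monomial times a unit, both in the coordinates of \<open>A\<close>.\<close>

definition monom_unit :: "'n set \<Rightarrow> (complex^'n \<Rightarrow> complex) \<Rightarrow> bool" where
  "monom_unit A f \<longleftrightarrow> (\<exists>b u. hol_germ u \<and> depends_on A u \<and> u 0 \<noteq> 0 \<and> (\<forall>\<^sub>F x in nhds 0. f x = vmonom A b x * u x))"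

lemma hol_germ_vmonom [simp]: "hol_germ (vmonom A b)"
  unfolding vmonom_def[abs_def] by (intro hol_germ_prod) auto

lemma depends_on_vmonom: "depends_on A (vmonom A b)"
  unfolding depends_on_def vmonom_def by auto

lemma depends_on_mult: "depends_on A f \<Longrightarrow> depends_on A g \<Longrightarrow> depends_on A (\<lambda>x. f x * g x)"
  unfolding depends_on_def by metis

lemma depends_on_diff: "depends_on A f \<Longrightarrow> depends_on A g \<Longrightarrow> depends_on A (\<lambda>x. f x - g x)"
  unfolding depends_on_def by metis

lemma vmonom_add: "vmonom A (\<lambda>i. a i + b i) x = vmonom A a x * vmonom A b x"
  by (simp add: vmonom_def power_add prod.distrib)

lemma vmonom_scale: "vmonom A (\<lambda>i. k * b i) x = vmonom A b x ^ k"
  by (simp add: vmonom_def prod_power_distrib power_mult[symmetric] mult.commute)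

lemma vmonom_eq_0: "vmonom A b (x :: complex^'n) = 0 \<longleftrightarrow> (\<exists>i\<in>A. b i > 0 \<and> x $ i = 0)"
  unfolding vmonom_def by (subst prod_zero_iff) auto

lemma vmonom_Suc: "k \<in> A \<Longrightarrow> vmonom A (b(k := Suc (b k))) x = x $ k * vmonom A b (x :: complex^'n)"
proof -
  assume k: "k \<in> A"
  have "vmonom A (b(k := Suc (b k))) x = (\<Prod>i\<in>A. (if i = k then x $ k else 1) * x $ i ^ b i)"
    unfolding vmonom_def by (intro prod.cong) auto
  also have "\<dots> = x $ k * vmonom A b x"
    using k by (simp add: prod.distrib vmonom_def prod.delta)
  finally show ?thesis .
qed

text \<open>A test point all of whose coordinates outside a prescribed set are nonzero.\<close>

lemma eventually_nhds0_vec: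
  fixes Q :: "complex^'n \<Rightarrow> bool"
  assumes "\<forall>\<^sub>F x in nhds 0. Q x"
  shows "\<exists>e>0. \<forall>S. Q (\<chi> i. if i \<in> S then 0 else complex_of_real e)"
proof -
  obtain d where d: "d > 0" "\<And>x. norm x < d \<Longrightarrow> Q x"
    using assms unfolding eventually_nhds_metric by (metis dist_0_norm dist_commute)
  define e where "e = d / (2 * real CARD('n))"
  have "e > 0" using d by (simp add: e_def)
  have "Q (\<chi> i. if i \<in> S then 0 else complex_of_real e)" for S
  proof (rule d(2))
    have "norm ((\<chi> i. if i \<in> S then 0 else complex_of_real e) :: complex^'n) \<le>
        (\<Sum>i\<in>(UNIV::'n set). norm (if i \<in> S then 0 else complex_of_real e))"
      unfolding norm_vec_def by (rule order_trans[OF L2_set_le_sum]) auto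
    also have "\<dots> \<le> (\<Sum>i\<in>(UNIV::'n set). e)"
      by (rule sum_mono) (use \<open>e > 0\<close> in auto)
    also have "\<dots> < d" using d by (simp add: e_def)
    finally show "norm ((\<chi> i. if i \<in> S then 0 else complex_of_real e) :: complex^'n) < d" .
  qed
  then show ?thesis using \<open>e > 0\<close> by blast
qed

lemma vmonom_not_eventually_0: "\<not> (\<forall>\<^sub>F x in nhds (0 :: complex^'n). vmonom A b x = 0)"
proof
  assume "\<forall>\<^sub>F x in nhds (0 :: complex^'n). vmonom A b x = 0"
  from eventually_nhds0_vec[OF this] obtain e where "e > 0"
    "vmonom A b (\<chi> i. if i \<in> {} then 0 else complex_of_real e) = 0" by blast
  then show False by (simp add: vmonom_eq_0)
qed

lemma hol_germ_ev_nz: "hol_germ u \<Longrightarrow> u 0 \<noteq> 0 \<Longrightarrow> \<forall>\<^sub>F x in nhds 0. u x \<noteq> 0"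
  using hol_germ_tendsto0 tendsto_imp_eventually_ne by blast

lemma hol_germ_cancel_coord:
  fixes f g :: "complex^'n \<Rightarrow> complex"
  assumes "hol_germ f" "hol_germ g" "\<forall>\<^sub>F x in nhds 0. x $ k * f x = x $ k * g x"
  shows "\<forall>\<^sub>F x in nhds 0. f x = g x"
proof -
  have "\<forall>\<^sub>F x in nhds 0. x $ k * (f x - g x) = 0"
    using assms(3) by eventually_elim (simp add: algebra_simps)
  from hol_germ_mult_eq_0[OF hol_germ_coord _ this]
  have "(\<forall>\<^sub>F x in nhds (0::complex^'n). x $ k = 0) \<or> (\<forall>\<^sub>F x in nhds 0. f x - g x = 0)"
    using assms by simp
  moreover have "\<not> (\<forall>\<^sub>F x in nhds (0::complex^'n). x $ k = 0)"
    using vmonom_not_eventually_0[of "{k}" "\<lambda>_. 1"] by (simp add: vmonom_def)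
  ultimately show ?thesis by simp
qed

text \<open>Every factor of a monomial times a unit is itself a monomial times a unit: coordinates are prime
  elements in the ring of germs.\<close>

lemma monom_unit_factor:
  fixes f g :: "complex^'n \<Rightarrow> complex"
  assumes "hol_germ f" "depends_on A f" "hol_germ g" "depends_on A g"
    and "hol_germ u" "depends_on A u" "u 0 \<noteq> 0" "\<forall>\<^sub>F x in nhds 0. f x * g x = vmonom A b x * u x"
  shows "monom_unit A f \<and> monom_unit A g"
  using assms
proof (induction "\<Sum>i\<in>A. b i" arbitrary: f g b)
  case 0
  then have "vmonom A b x = 1" for x by (simp add: vmonom_def)
  then have ev: "\<forall>\<^sub>F x in nhds 0. f x * g x = u x" using 0 by simp
  from eventually_nhds_x_imp_x[OF this] have "f 0 \<noteq> 0" "g 0 \<noteq> 0" using 0 by auto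
  then show ?case using 0 unfolding monom_unit_def
    by (intro conjI exI[of _ "\<lambda>_. 0"] exI[of _ f] exI[of _ g]) (auto simp: vmonom_def)
next
  case (Suc m)
  then obtain k where k: "k \<in> A" "b k > 0"
    by (metis (no_types, lifting) bot_nat_0.not_eq_extremum nat.simps(3) sum.neutral)
  define b' where "b' = b(k := b k - 1)"
  have bb: "b = b'(k := Suc (b' k))" using k by (auto simp: b'_def)
  have m: "m = (\<Sum>i\<in>A. b' i)"
  proof -
    have "(\<Sum>i\<in>A. b i) = (\<Sum>i\<in>A. (if i = k then 1 else 0) + b' i)"
      using k by (intro sum.cong) (auto simp: b'_def)
    also have "\<dots> = 1 + (\<Sum>i\<in>A. b' i)" using k by (simp add: sum.distrib sum.delta)
    finally show ?thesis using Suc(2) by simp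
  qed
  have insk: "insert k A = A" using k by auto
  have step: "monom_unit A f \<and> monom_unit A g"
    if hf: "hol_germ f" "depends_on A f" and hg: "hol_germ g" "depends_on A g"
      and ev: "\<forall>\<^sub>F x in nhds 0. f x * g x = vmonom A b x * u x"
      and f0: "\<forall>\<^sub>F x in nhds 0. f (vec_upd x k 0) = 0" for f g
  proof -
    obtain R where R: "hol_germ R" "\<forall>\<^sub>F x in nhds 0. f x = (\<Sum>j<1. taylor_coeff k j f x * x $ k ^ j) + x $ k ^ 1 * R x"
      "\<And>A. depends_on (insert k A) f \<Longrightarrow> depends_on (insert k A) R"
      by (rule taylor_remainder[OF hf(1), of k 1]) blast
    have dR: "depends_on A R" using R(3)[of A] hf insk by simp
    have fR: "\<forall>\<^sub>F x in nhds 0. f x = x $ k * R x"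
      using R(2) f0 by eventually_elim (simp add: taylor_coeff_def)
    \<comment> \<open>Cancelling one factor \<open>x $ k\<close> on both sides lowers the degree of the monomial.\<close>
    have "\<forall>\<^sub>F x in nhds 0. x $ k * (R x * g x) = x $ k * (vmonom A b' x * u x)"
      using fR ev
    proof eventually_elim
      case (elim x)
      then show ?case using vmonom_Suc[OF k(1), of b' x] unfolding bb[symmetric] by (simp add: algebra_simps)
    qed
    then have "\<forall>\<^sub>F x in nhds 0. R x * g x = vmonom A b' x * u x"
      by (rule hol_germ_cancel_coord[rotated 2]) (use R hg Suc.prems in auto)
    from Suc.hyps(1)[OF m R(1) dR hg Suc.prems(5-7) this]
    have "monom_unit A R" "monom_unit A g" by auto
    from \<open>monom_unit A R\<close> obtain c v where c: "hol_germ v" "depends_on A v" "v 0 \<noteq> 0" "\<forall>\<^sub>F x in nhds 0. R x = vmonom A c x * v x"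
      unfolding monom_unit_def by blast
    have "\<forall>\<^sub>F x in nhds 0. f x = vmonom A (c(k := Suc (c k))) x * v x"
      using fR c(4) by eventually_elim (simp add: vmonom_Suc[OF k(1)] mult.assoc)
    with c \<open>monom_unit A g\<close> show ?thesis unfolding monom_unit_def by blast
  qed
  have hu: "hol_germ (\<lambda>x. h (vec_upd x k 0))" if "hol_germ h" for h :: "complex^'n \<Rightarrow> complex"
    by (rule hol_germ_comp[OF that]) (auto simp: hol_germ_if)
  have "\<forall>\<^sub>F x in nhds 0. f (vec_upd x k 0) * g (vec_upd x k 0) = 0"
  proof -
    have "\<forall>\<^sub>F x in nhds 0. f (vec_upd x k 0) * g (vec_upd x k 0) = vmonom A b (vec_upd x k 0) * u (vec_upd x k 0)"
      using Suc.prems(8) vec_upd_0_tendsto by (rule eventually_compose_filterlim)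
    moreover have "vmonom A b (vec_upd x k 0) = 0" for x using k by (auto simp: vmonom_eq_0)
    ultimately show ?thesis by simp
  qed
  from hol_germ_mult_eq_0[OF hu hu this] Suc.prems
  consider "\<forall>\<^sub>F x in nhds 0. f (vec_upd x k 0) = 0" | "\<forall>\<^sub>F x in nhds 0. g (vec_upd x k 0) = 0" by blast
  then show ?case
  proof cases
    case 1 then show ?thesis using step[of f g] Suc.prems by blast
  next
    case 2
    have "\<forall>\<^sub>F x in nhds 0. g x * f x = vmonom A b x * u x"
      using Suc.prems(8) by eventually_elim (simp add: mult.commute)
    then show ?thesis using step[of g f] 2 Suc.prems by blast
  qed
qed

lemma monom_unit_factors:
  fixes f g :: "complex^'n \<Rightarrow> complex"
  assumes "hol_germ f" "depends_on A f" "hol_germ g" "depends_on A g" "monom_unit A (\<lambda>x. f x * g x)"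
  shows "monom_unit A f" "monom_unit A g"
  using assms monom_unit_factor unfolding monom_unit_def[of A "\<lambda>x. f x * g x"] by blast+

lemma vmonom_split:
  assumes "\<And>i. i \<in> A \<Longrightarrow> m i \<le> a i"
  shows "vmonom A a x = vmonom A m x * vmonom A (\<lambda>i. a i - m i) x"
  unfolding vmonom_add[symmetric] unfolding vmonom_def using assms by (intro prod.cong) auto

text \<open>If two monomials times units differ by nothing or again by a monomial times a unit, then one of
  the monomials divides the other. After removing the common factor, the difference vanishes on some
  coordinate hyperplane, where the two sides can be told apart at a suitable point.\<close>

lemma vmonom_comparable:
  fixes u v :: "complex^'n \<Rightarrow> complex"
  assumes u: "hol_germ u" "depends_on A u" "u 0 \<noteq> 0" and v: "hol_germ v" "depends_on A v" "v 0 \<noteq> 0"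
    and d: "(\<forall>\<^sub>F x in nhds 0. vmonom A a x * u x - vmonom A b x * v x = 0) \<or>
      monom_unit A (\<lambda>x. vmonom A a x * u x - vmonom A b x * v x)"
  shows "(\<forall>i\<in>A. a i \<le> b i) \<or> (\<forall>i\<in>A. b i \<le> a i)"
proof (rule ccontr)
  assume "\<not> ?thesis"
  then obtain i j where ij: "i \<in> A" "a i < b i" "j \<in> A" "b j < a j" by (auto simp: not_le)
  define m where "m = (\<lambda>i. min (a i) (b i))"
  define a' where "a' = (\<lambda>i. a i - m i)"
  define b' where "b' = (\<lambda>i. b i - m i)"
  have ab: "vmonom A a x = vmonom A m x * vmonom A a' x" "vmonom A b x = vmonom A m x * vmonom A b' x" for x :: "complex^'n"
    unfolding a'_def b'_def by (rule vmonom_split; simp add: m_def)+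
  define F where "F = (\<lambda>x. vmonom A a' x * u x - vmonom A b' x * v x)"
  have hF: "hol_germ F" "depends_on A F"
    using u v unfolding F_def by (auto intro!: depends_on_diff depends_on_mult depends_on_vmonom)
  have mF: "vmonom A a x * u x - vmonom A b x * v x = vmonom A m x * F x" for x
    unfolding ab F_def by (simp add: algebra_simps)
  have F0: "F 0 = 0"
  proof -
    have "vmonom A a' 0 = 0" unfolding vmonom_eq_0
      by (rule bexI[OF _ ij(3)]) (use ij in \<open>auto simp: a'_def m_def\<close>)
    moreover have "vmonom A b' 0 = 0" unfolding vmonom_eq_0
      by (rule bexI[OF _ ij(1)]) (use ij in \<open>auto simp: b'_def m_def\<close>)
    ultimately show ?thesis by (simp add: F_def)
  qed
  have "\<exists>k\<in>A. \<forall>\<^sub>F x in nhds 0. x $ k = 0 \<longrightarrow> F x = 0"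
  proof (cases "\<forall>\<^sub>F x in nhds 0. vmonom A a x * u x - vmonom A b x * v x = 0")
    case True
    then have "\<forall>\<^sub>F x in nhds 0. F x = 0"
      using hol_germ_mult_eq_0[OF hol_germ_vmonom hF(1), of A m] vmonom_not_eventually_0[of A m] by (simp add: mF)
    then show ?thesis using ij(1) by (intro bexI[of _ i]) (auto elim: eventually_mono)
  next
    case False
    with d have "monom_unit A (\<lambda>x. vmonom A m x * F x)" by (simp add: mF)
    from monom_unit_factors(2)[OF hol_germ_vmonom depends_on_vmonom hF this]
    obtain e w where e: "w 0 \<noteq> 0" "\<forall>\<^sub>F x in nhds 0. F x = vmonom A e x * w x" unfolding monom_unit_def by blast
    from eventually_nhds_x_imp_x[OF e(2)] e(1) F0 have "vmonom A e 0 = 0" by simp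
    then obtain k where k: "k \<in> A" "e k > 0" by (auto simp: vmonom_eq_0)
    from e(2) have "\<forall>\<^sub>F x in nhds 0. x $ k = 0 \<longrightarrow> F x = 0"
      by eventually_elim (use k in \<open>auto simp: vmonom_eq_0\<close>)
    then show ?thesis using k by blast
  qed
  then obtain k where k: "k \<in> A" "\<forall>\<^sub>F x in nhds 0. x $ k = 0 \<longrightarrow> F x = 0" by blast
  have "\<forall>\<^sub>F x in nhds 0. (x $ k = 0 \<longrightarrow> F x = 0) \<and> u x \<noteq> 0 \<and> v x \<noteq> 0"
    using k(2) hol_germ_ev_nz[OF u(1,3)] hol_germ_ev_nz[OF v(1,3)] by eventually_elim auto
  from eventually_nhds0_vec[OF this] obtain e where e: "e > 0"
    "\<And>S. let x = (\<chi> i. if i \<in> S then 0 else complex_of_real e) in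
        (x $ k = 0 \<longrightarrow> F x = 0) \<and> u x \<noteq> 0 \<and> v x \<noteq> 0" unfolding Let_def by blast
  show False
  proof (cases "a' k > 0")
    case True
    then have bk: "b' k = 0" by (auto simp: a'_def b'_def m_def)
    define x :: "complex^'n" where "x = (\<chi> i. if i \<in> {k} then 0 else complex_of_real e)"
    have "vmonom A a' x = 0" using True k by (auto simp: vmonom_eq_0 x_def)
    moreover have "vmonom A b' x \<noteq> 0" using bk e(1) by (auto simp: vmonom_eq_0 x_def)
    moreover have "x $ k = 0" by (simp add: x_def)
    ultimately show False using e(2)[of "{k}"] unfolding Let_def x_def[symmetric] by (auto simp: F_def)
  next
    case False
    define x :: "complex^'n" where "x = (\<chi> l. if l \<in> {k, i} then 0 else complex_of_real e)"
    have "vmonom A b' x = 0" unfolding vmonom_eq_0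
      by (rule bexI[OF _ ij(1)]) (use ij in \<open>auto simp: x_def b'_def m_def\<close>)
    moreover have "vmonom A a' x \<noteq> 0" using False e(1) ij by (auto simp: vmonom_eq_0 x_def a'_def m_def)
    moreover have "x $ k = 0" by (simp add: x_def)
    ultimately show False using e(2)[of "{k, i}"] unfolding Let_def x_def[symmetric] by (auto simp: F_def)
  qed
qed

section \<open>Charts and lifted sequences\<close>

text \<open>A holomorphic germ of a map fixing the origin that mixes only the coordinates in \<open>A\<close> and leaves
  all the others alone. No invertibility is required: blow-ups and power maps are charts.\<close>

definition chart :: "'n set \<Rightarrow> (complex^'n \<Rightarrow> complex^'n) \<Rightarrow> bool" where
  "chart A p \<longleftrightarrow> (\<forall>i. hol_germ (\<lambda>x. p x $ i)) \<and> p 0 = 0 \<and>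
     (\<forall>i\<in>A. depends_on A (\<lambda>x. p x $ i)) \<and> (\<forall>i. i \<notin> A \<longrightarrow> (\<forall>x. p x $ i = x $ i))"

lemma depends_on_coord: "i \<in> A \<Longrightarrow> depends_on A (\<lambda>x. x $ i)" by (simp add: depends_on_def)
lemma depends_on_const [simp]: "depends_on A (\<lambda>x. c)" by (simp add: depends_on_def)
lemma depends_on_add: "depends_on A f \<Longrightarrow> depends_on A g \<Longrightarrow> depends_on A (\<lambda>x. f x + g x)" unfolding depends_on_def by metis
lemma depends_on_power: "depends_on A f \<Longrightarrow> depends_on A (\<lambda>x. f x ^ k)" unfolding depends_on_def by metis
lemma depends_on_inverse: "depends_on A f \<Longrightarrow> depends_on A (\<lambda>x. inverse (f x))" unfolding depends_on_def by metis
lemma depends_on_sum: "(\<And>i. i \<in> I \<Longrightarrow> depends_on A (f i)) \<Longrightarrow> depends_on A (\<lambda>x. \<Sum>i\<in>I. f i x)"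
  by (induction I rule: infinite_finite_induct) (auto intro: depends_on_add)
lemma depends_on_prod: "(\<And>i. i \<in> I \<Longrightarrow> depends_on A (f i)) \<Longrightarrow> depends_on A (\<lambda>x. \<Prod>i\<in>I. f i x)"
  by (induction I rule: infinite_finite_induct) (auto intro: depends_on_mult)

lemma chart_hol: "chart A p \<Longrightarrow> hol_germ f \<Longrightarrow> hol_germ (\<lambda>x. f (p x))"
  by (rule hol_germ_comp) (auto simp: chart_def)

lemma chart_lim: "chart A p \<Longrightarrow> filterlim p (nhds 0) (nhds 0)"
  by (rule filterlim_vec0) (auto simp: chart_def)

lemma chart_ev: "chart A p \<Longrightarrow> \<forall>\<^sub>F x in nhds 0. Q x \<Longrightarrow> \<forall>\<^sub>F x in nhds 0. Q (p x)"
  by (rule eventually_compose_filterlim[OF _ chart_lim])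

lemma chart_mono:
  assumes "chart A p" "A \<subseteq> B" shows "chart B p"
proof -
  have "depends_on B (\<lambda>x. p x $ i)" if "i \<in> B" for i
    using assms that by (cases "i \<in> A") (auto simp: chart_def intro: depends_on_superset depends_on_coord)
  with assms show ?thesis by (auto simp: chart_def)
qed

lemma chart_eqD: "chart A p \<Longrightarrow> (\<And>i. i \<in> A \<Longrightarrow> x $ i = y $ i) \<Longrightarrow> i \<in> A \<Longrightarrow> p x $ i = p y $ i"
  unfolding chart_def using depends_onD[of A "\<lambda>x. p x $ i" x y] by blast

lemma chart_dep:
  assumes "chart A p" "depends_on A f" shows "depends_on A (\<lambda>x. f (p x))"
  unfolding depends_on_def
proof (intro allI impI)
  fix x y :: "complex^'a" assume "\<forall>i\<in>A. x $ i = y $ i"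
  then show "f (p x) = f (p y)"
    by (intro depends_onD[OF assms(2)] chart_eqD[OF assms(1)]) auto
qed

lemma chart_id [simp]: "chart A (\<lambda>x. x)"
  by (auto simp: chart_def intro: depends_on_coord)

lemma chart_comp:
  assumes "chart A p" "chart A r" shows "chart A (\<lambda>x. p (r x))"
proof -
  have "hol_germ (\<lambda>x. p (r x) $ i)" for i
    using chart_hol[OF assms(2), of "\<lambda>x. p x $ i"] assms(1) by (simp add: chart_def)
  moreover have "depends_on A (\<lambda>x. p (r x) $ i)" if "i \<in> A" for i
    using chart_dep[OF assms(2), of "\<lambda>x. p x $ i"] assms(1) that by (simp add: chart_def)
  ultimately show ?thesis using assms by (auto simp: chart_def)
qed

lemma chart_vec_upd:
  assumes "k \<in> A" "hol_germ f" "depends_on A f" "f 0 = 0"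
  shows "chart A (\<lambda>x. vec_upd x k (f x))"
proof -
  have "depends_on A (\<lambda>x. vec_upd x k (f x) $ i)" if "i \<in> A" for i
    using assms that by (cases "i = k") (auto intro: depends_on_coord)
  moreover have "hol_germ (\<lambda>x. vec_upd x k (f x) $ i)" for i
    using assms by (cases "i = k") auto
  ultimately show ?thesis using assms unfolding chart_def by auto
qed

text \<open>\<open>y\<close> tends to the origin and lifts a subsequence of \<open>z\<close> through \<open>p\<close>. The indices \<open>\<sigma> k\<close> tend
  to infinity but need not be monotone.\<close>

definition lifts :: "(nat \<Rightarrow> complex^'n) \<Rightarrow> (complex^'n \<Rightarrow> complex^'n) \<Rightarrow> (nat \<Rightarrow> complex^'n) \<Rightarrow> bool" where
  "lifts z p y \<longleftrightarrow> y \<longlonglongrightarrow> 0 \<and> (\<exists>\<sigma>. filterlim \<sigma> at_top sequentially \<and> (\<forall>k. p (y k) = z (\<sigma> k)))"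

lemma lifts_id: "z \<longlonglongrightarrow> 0 \<Longrightarrow> lifts z (\<lambda>x. x) z"
  unfolding lifts_def by (auto intro!: exI[of _ "\<lambda>k. k"] filterlim_ident)

lemma lifts_comp:
  assumes "lifts z p y" "lifts y r w" shows "lifts z (\<lambda>x. p (r x)) w"
proof -
  obtain s t where "filterlim s at_top sequentially" "\<And>k. p (y k) = z (s k)"
    "filterlim t at_top sequentially" "\<And>k. r (w k) = y (t k)" "w \<longlonglongrightarrow> 0"
    using assms by (auto simp: lifts_def)
  then show ?thesis unfolding lifts_def
    by (auto intro!: exI[of _ "\<lambda>k. s (t k)"] intro: filterlim_compose)
qed

text \<open>After pulling back along a chart through which the given sequence lifts, \<open>f\<close> becomes a monomial
  times a unit. Working along one sequence replaces the finite covers by charts of classical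
  resolution theorems.\<close>

definition monomializable :: "'n set \<Rightarrow> (complex^'n \<Rightarrow> complex) \<Rightarrow> (nat \<Rightarrow> complex^'n) \<Rightarrow> bool" where
  "monomializable A f z \<longleftrightarrow> (\<exists>p y. chart A p \<and> lifts z p y \<and> monom_unit A (\<lambda>x. f (p x)))"

lemma monomializable_comp:
  assumes "chart A r" "lifts z r y" "monomializable A (\<lambda>x. f (r x)) y" shows "monomializable A f z"
proof -
  obtain p w where "chart A p" "lifts y p w" "monom_unit A (\<lambda>x. f (r (p x)))"
    using assms(3) by (auto simp: monomializable_def)
  then show ?thesis unfolding monomializable_def
    using chart_comp[OF assms(1)] lifts_comp[OF assms(2)] by blast
qed

lemma monomializable_monom_unit: "z \<longlonglongrightarrow> 0 \<Longrightarrow> monom_unit A f \<Longrightarrow> monomializable A f z"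
  unfolding monomializable_def using chart_id lifts_id by blast

lemma monom_unit_cong:
  assumes "\<forall>\<^sub>F x in nhds 0. f x = g x" "monom_unit A f" shows "monom_unit A g"
proof -
  obtain b u where "hol_germ u" "depends_on A u" "u 0 \<noteq> 0" and e: "\<forall>\<^sub>F x in nhds 0. f x = vmonom A b x * u x"
    using assms(2) by (auto simp: monom_unit_def)
  moreover have "\<forall>\<^sub>F x in nhds 0. g x = vmonom A b x * u x"
    using assms(1) e by eventually_elim simp
  ultimately show ?thesis by (auto simp: monom_unit_def)
qed

lemma monom_unit_unit: "hol_germ u \<Longrightarrow> depends_on A u \<Longrightarrow> u 0 \<noteq> 0 \<Longrightarrow> monom_unit A u"
  unfolding monom_unit_def by (intro exI[of _ "\<lambda>_. 0"] exI[of _ u]) (simp add: vmonom_def)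

lemma monom_unit_coord:
  assumes "i \<in> A" shows "monom_unit A (\<lambda>x. x $ i)"
  unfolding monom_unit_def
proof (intro exI conjI)
  show "\<forall>\<^sub>F x in nhds 0. x $ i = vmonom A ((\<lambda>_. 0)(i := Suc 0)) x * 1"
    using vmonom_Suc[OF assms, of "\<lambda>_. 0"] by (simp add: vmonom_def)
qed auto

lemma monom_unit_mult:
  assumes "monom_unit A f" "monom_unit A g" shows "monom_unit A (\<lambda>x. f x * g x)"
proof -
  obtain b u where 1: "hol_germ u" "depends_on A u" "u 0 \<noteq> 0" and e: "\<forall>\<^sub>F x in nhds 0. f x = vmonom A b x * u x"
    using assms by (auto simp: monom_unit_def)
  obtain c v where 2: "hol_germ v" "depends_on A v" "v 0 \<noteq> 0" and e': "\<forall>\<^sub>F x in nhds 0. g x = vmonom A c x * v x"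
    using assms by (auto simp: monom_unit_def)
  have "\<forall>\<^sub>F x in nhds 0. f x * g x = vmonom A (\<lambda>i. b i + c i) x * (u x * v x)"
    using e e' by eventually_elim (simp add: vmonom_add algebra_simps)
  moreover have "hol_germ (\<lambda>x. u x * v x)" "depends_on A (\<lambda>x. u x * v x)" "u 0 * v 0 \<noteq> 0"
    using 1 2 by (auto intro: depends_on_mult)
  ultimately show ?thesis unfolding monom_unit_def by (intro exI conjI)
qed

lemma monom_unit_power: "monom_unit A f \<Longrightarrow> monom_unit A (\<lambda>x. f x ^ k)"
  by (induction k) (auto intro: monom_unit_mult monom_unit_unit)

lemma monom_unit_prod: "(\<And>i. i \<in> I \<Longrightarrow> monom_unit A (f i)) \<Longrightarrow> monom_unit A (\<lambda>x. \<Prod>i\<in>I. f i x)"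
  by (induction I rule: infinite_finite_induct) (auto intro: monom_unit_mult monom_unit_unit)

lemma monom_unit_vmonom: "A \<subseteq> B \<Longrightarrow> monom_unit B (vmonom A a)"
  unfolding vmonom_def[abs_def] by (intro monom_unit_prod monom_unit_power monom_unit_coord) auto

lemma monom_unit_vmonom_comp:
  assumes "\<And>i. i \<in> A \<Longrightarrow> monom_unit B (\<lambda>x. p x $ i)" shows "monom_unit B (\<lambda>x. vmonom A a (p x))"
  unfolding vmonom_def using assms by (intro monom_unit_prod monom_unit_power)

lemma monom_unit_comp:
  assumes "monom_unit A f" "chart A p" "\<And>i. i \<in> A \<Longrightarrow> monom_unit A (\<lambda>x. p x $ i)"
  shows "monom_unit A (\<lambda>x. f (p x))"
proof -
  obtain b u where u: "hol_germ u" "depends_on A u" "u 0 \<noteq> 0" and e: "\<forall>\<^sub>F x in nhds 0. f x = vmonom A b x * u x"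
    using assms by (auto simp: monom_unit_def)
  have "monom_unit A (\<lambda>x. vmonom A b (p x) * u (p x))"
    by (intro monom_unit_mult monom_unit_vmonom_comp assms monom_unit_unit chart_hol[OF assms(2)] chart_dep[OF assms(2)])
      (use u assms(2) in \<open>auto simp: chart_def\<close>)
  moreover have "\<forall>\<^sub>F x in nhds 0. vmonom A b (p x) * u (p x) = f (p x)"
    using chart_ev[OF assms(2) e] by eventually_elim simp
  ultimately show ?thesis by (rule monom_unit_cong[rotated])
qed

lemma bounded_subseq:
  fixes t :: "nat \<Rightarrow> 'a::heine_borel"
  assumes "\<exists>\<^sub>F j in sequentially. Q j" "bounded (t ` {j. Q j})"
  obtains \<sigma> l where "filterlim \<sigma> at_top sequentially" "(\<lambda>j. t (\<sigma> j)) \<longlonglongrightarrow> l" "\<And>j. Q (\<sigma> j)"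
proof -
  have "infinite {j. Q j}"
    using assms(1) unfolding frequently_sequentially infinite_nat_iff_unbounded_le by blast
  then obtain r :: "nat \<Rightarrow> nat" where r: "strict_mono r" "\<And>j. r j \<in> {j. Q j}" using infinite_enumerate by blast
  have "bounded (range (\<lambda>j. t (r j)))" using r(2) by (intro bounded_subset[OF assms(2)]) auto
  then obtain l s where s: "strict_mono (s :: nat \<Rightarrow> nat)" "((\<lambda>j. t (r j)) \<circ> s) \<longlonglongrightarrow> l"
    using bounded_imp_convergent_subsequence by blast
  show thesis
  proof (rule that[of "\<lambda>j. r (s j)" l])
    show "filterlim (\<lambda>j. r (s j)) at_top sequentially"
      using filterlim_compose[OF filterlim_subseq[OF r(1)] filterlim_subseq[OF s(1)]] .
  qed (use r s in \<open>auto simp: o_def\<close>)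
qed

lemma tendsto_vec_upd:
  fixes z :: "nat \<Rightarrow> complex^'n"
  assumes "z \<longlonglongrightarrow> 0" "t \<longlonglongrightarrow> 0" shows "(\<lambda>j. vec_upd (z j) n (t j)) \<longlonglongrightarrow> 0"
proof (rule vec_tendstoI)
  fix i show "(\<lambda>j. vec_upd (z j) n (t j) $ i) \<longlonglongrightarrow> 0 $ i"
    using tendsto_vec_nth[OF assms(1), of i] assms(2) by (cases "i = n") auto
qed

lemma lifts_vec_upd:
  fixes z :: "nat \<Rightarrow> complex^'n"
  assumes z: "z \<longlonglongrightarrow> 0" and s: "filterlim \<sigma> at_top sequentially"
    and t: "(\<lambda>j. t (\<sigma> j)) \<longlonglongrightarrow> l"
    and eq: "\<And>j. p (vec_upd (z (\<sigma> j)) n (t (\<sigma> j) - l)) = z (\<sigma> j)"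
  shows "lifts z p (\<lambda>j. vec_upd (z (\<sigma> j)) n (t (\<sigma> j) - l))"
  unfolding lifts_def
proof (intro conjI exI[of _ \<sigma>] s allI eq)
  have "(\<lambda>j. t (\<sigma> j) - l) \<longlonglongrightarrow> 0" using t by (simp add: LIM_zero_iff)
  moreover have "(\<lambda>j. z (\<sigma> j)) \<longlonglongrightarrow> 0" using filterlim_compose[OF z s] .
  ultimately show "(\<lambda>j. vec_upd (z (\<sigma> j)) n (t (\<sigma> j) - l)) \<longlonglongrightarrow> 0" by (intro tendsto_vec_upd)
qed

section \<open>Blow-ups along a sequence\<close>

text \<open>If a monomial is negligible compared with the coordinate \<open>x $ n\<close> along the sequence, then finitely
  many blow-ups of codimension-two coordinate subspaces make it divisible by \<open>x $ n\<close>. Each step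
  compares \<open>x $ n\<close> with one coordinate occurring in the monomial; the induction is on the degree.\<close>

lemma blowup_chain:
  fixes z :: "nat \<Rightarrow> complex^'n"
  assumes "n \<notin> A" "z \<longlonglongrightarrow> 0" "\<And>k. z k $ n \<noteq> 0" "(\<lambda>k. vmonom A b (z k) / z k $ n) \<longlonglongrightarrow> 0"
  shows "\<exists>p y W. chart (insert n A) p \<and> lifts z p y \<and> (\<forall>i\<in>insert n A. monom_unit (insert n A) (\<lambda>x. p x $ i)) \<and>
    hol_germ W \<and> depends_on (insert n A) W \<and> (\<forall>\<^sub>F x in nhds 0. vmonom A b (p x) = p x $ n * W x)"
  using assms
proof (induction "\<Sum>i\<in>A. b i" arbitrary: b z)
  case 0
  then have m: "vmonom A b x = 1" for x by (simp add: vmonom_def)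
  have "(\<lambda>k. z k $ n) \<longlonglongrightarrow> 0 $ n" by (rule tendsto_vec_nth[OF 0(3)])
  from tendsto_mult[OF 0(5) this] have "(\<lambda>k. vmonom A b (z k) / z k $ n * z k $ n) \<longlonglongrightarrow> 0" by simp
  then have "(\<lambda>k::nat. 1::complex) \<longlonglongrightarrow> 0" using 0(4) by (simp add: m)
  then show ?case by (simp add: tendsto_const_iff)
next
  case (Suc m)
  let ?B = "insert n A"
  obtain k where k: "k \<in> A" "b k > 0"
    using Suc(2) by (metis (no_types, lifting) bot_nat_0.not_eq_extremum nat.simps(3) sum.neutral)
  define b' where "b' = b(k := b k - 1)"
  have bb: "b = b'(k := Suc (b' k))" using k by (auto simp: b'_def)
  have m: "m = (\<Sum>i\<in>A. b' i)"
  proof -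
    have "(\<Sum>i\<in>A. b i) = (\<Sum>i\<in>A. (if i = k then 1 else 0) + b' i)"
      using k by (intro sum.cong) (auto simp: b'_def)
    also have "\<dots> = 1 + (\<Sum>i\<in>A. b' i)" using k by (simp add: sum.distrib sum.delta)
    finally show ?thesis using Suc(2) by simp
  qed
  have mb: "vmonom A b x = x $ k * vmonom A b' x" for x
    using vmonom_Suc[OF k(1), of b' x] unfolding bb[symmetric] .
  have kn: "k \<noteq> n" using k Suc(3) by auto
  have mA: "vmonom A c (vec_upd x n w) = vmonom A c x" for c x w
    unfolding vmonom_def using Suc(3) by (intro prod.cong) auto
  consider "\<exists>\<^sub>F j in sequentially. norm (z j $ k) \<le> norm (z j $ n)"
    | "\<exists>\<^sub>F j in sequentially. norm (z j $ n) \<le> norm (z j $ k)"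
  proof -
    have "\<exists>\<^sub>F j in sequentially. norm (z j $ k) \<le> norm (z j $ n) \<or> norm (z j $ n) \<le> norm (z j $ k)"
      by (rule eventually_frequently) (auto intro: always_eventually)
    then show thesis using that by (auto simp: frequently_disj_iff)
  qed
  then show ?case
  proof cases
    case 1
    have bnd: "bounded ((\<lambda>j. z j $ k / z j $ n) ` {j. norm (z j $ k) \<le> norm (z j $ n)})"
      unfolding bounded_iff using Suc.prems(3) by (auto simp: norm_divide divide_simps intro!: exI[of _ 1])
    obtain \<sigma> l where s: "filterlim \<sigma> at_top sequentially"
      "(\<lambda>j. z (\<sigma> j) $ k / z (\<sigma> j) $ n) \<longlonglongrightarrow> l"
      by (rule bounded_subseq[OF 1 bnd]) blast
    define p where "p = (\<lambda>x::complex^'n. vec_upd x k (x $ n * (x $ k + l)))"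
    have hp: "hol_germ (\<lambda>x::complex^'n. x $ n * (x $ k + l))" by auto
    have dp: "depends_on ?B (\<lambda>x::complex^'n. x $ n * (x $ k + l))"
      using k by (intro depends_on_mult depends_on_add depends_on_coord depends_on_const) auto
    have cp: "chart ?B p" unfolding p_def using k by (intro chart_vec_upd hp dp) auto
    have "lifts z p (\<lambda>j. vec_upd (z (\<sigma> j)) k (z (\<sigma> j) $ k / z (\<sigma> j) $ n - l))"
      using lifts_vec_upd[OF Suc.prems(2) s(1), of "\<lambda>j. z j $ k / z j $ n" l p k] s(2) Suc.prems(3) kn
      by (simp add: p_def vec_eq_iff)
    moreover have "monom_unit ?B (\<lambda>x. p x $ i)" if "i \<in> ?B" for i
    proof (cases "i = k")
      case True
      have "monom_unit ?B (\<lambda>x::complex^'n. x $ k + l)"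
        using k by (cases "l = 0") (auto intro!: monom_unit_coord monom_unit_unit depends_on_add depends_on_coord)
      then show ?thesis using True by (simp add: p_def monom_unit_mult monom_unit_coord)
    qed (use that in \<open>simp add: p_def monom_unit_coord\<close>)
    moreover have "hol_germ (\<lambda>x. (x $ k + l) * vmonom A b' (p x))"
      using chart_hol[OF cp hol_germ_vmonom] by auto
    moreover have "depends_on ?B (\<lambda>x. (x $ k + l) * vmonom A b' (p x))"
      using k by (intro depends_on_mult depends_on_add depends_on_coord depends_on_const chart_dep[OF cp] depends_on_superset[OF depends_on_vmonom]) auto
    moreover have "vmonom A b (p x) = p x $ n * ((x $ k + l) * vmonom A b' (p x))" for x
      using kn by (simp add: mb p_def)
    ultimately show ?thesis using cp by (intro exI conjI) (auto intro: always_eventually)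
  next
    case 2
    have znk: "z j $ k \<noteq> 0" if "norm (z j $ n) \<le> norm (z j $ k)" for j
      using Suc.prems(3)[of j] that by auto
    have bnd: "bounded ((\<lambda>j. z j $ n / z j $ k) ` {j. norm (z j $ n) \<le> norm (z j $ k)})"
      unfolding bounded_iff using znk by (auto simp: norm_divide divide_simps intro!: exI[of _ 1])
    obtain \<sigma> l where s: "filterlim \<sigma> at_top sequentially"
      "(\<lambda>j. z (\<sigma> j) $ n / z (\<sigma> j) $ k) \<longlonglongrightarrow> l" "\<And>j. norm (z (\<sigma> j) $ n) \<le> norm (z (\<sigma> j) $ k)"
      by (rule bounded_subseq[OF 2 bnd]) blast
    note zk = znk[OF s(3)]
    define p where "p = (\<lambda>x::complex^'n. vec_upd x n (x $ k * (x $ n + l)))"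
    have hp: "hol_germ (\<lambda>x::complex^'n. x $ k * (x $ n + l))" by auto
    have dp: "depends_on ?B (\<lambda>x::complex^'n. x $ k * (x $ n + l))"
      using k by (intro depends_on_mult depends_on_add depends_on_coord depends_on_const) auto
    have cp: "chart ?B p" unfolding p_def using k by (intro chart_vec_upd hp dp) auto
    define y where "y = (\<lambda>j. vec_upd (z (\<sigma> j)) n (z (\<sigma> j) $ n / z (\<sigma> j) $ k - l))"
    have ly: "lifts z p y"
      using lifts_vec_upd[OF Suc.prems(2) s(1), of "\<lambda>j. z j $ n / z j $ k" l p n] s(2) zk kn
      by (simp add: p_def vec_eq_iff y_def)
    have mup: "monom_unit ?B (\<lambda>x. p x $ i)" if "i \<in> ?B" for i
    proof (cases "i = n")
      case True
      have "monom_unit ?B (\<lambda>x::complex^'n. x $ n + l)"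
        by (cases "l = 0") (auto intro!: monom_unit_coord monom_unit_unit depends_on_add depends_on_coord)
      then show ?thesis using True k by (simp add: p_def monom_unit_mult monom_unit_coord)
    qed (use that in \<open>simp add: p_def monom_unit_coord\<close>)
    show ?thesis
    proof (cases "l = 0")
      case False
      have ev: "\<forall>\<^sub>F x in nhds (0::complex^'n). x $ n + l \<noteq> 0"
        using hol_germ_ev_nz[of "\<lambda>x::complex^'n. x $ n + l"] False by auto
      have "\<forall>\<^sub>F x in nhds 0. vmonom A b (p x) = p x $ n * (vmonom A b' x * inverse (x $ n + l))"
        using ev by eventually_elim (simp add: p_def mA mb field_simps)
      moreover have "hol_germ (\<lambda>x. vmonom A b' x * inverse (x $ n + l))"
        using False by (intro hol_germ_mult hol_germ_inverse) auto
      moreover have "depends_on ?B (\<lambda>x. vmonom A b' x * inverse (x $ n + l))"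
        by (intro depends_on_mult depends_on_add depends_on_coord depends_on_const depends_on_inverse depends_on_superset[OF depends_on_vmonom]) auto
      ultimately show ?thesis using cp ly mup by (intro exI conjI) auto
    next
      case True
      have y0: "y \<longlonglongrightarrow> 0" using ly by (simp add: lifts_def)
      have yn: "y j $ n \<noteq> 0" for j using Suc.prems(3) zk True by (simp add: y_def)
      have "vmonom A b' (y j) / y j $ n = vmonom A b (z (\<sigma> j)) / z (\<sigma> j) $ n" for j
        using True by (simp add: y_def mA mb)
      then have lim: "(\<lambda>j. vmonom A b' (y j) / y j $ n) \<longlonglongrightarrow> 0"
        using filterlim_compose[OF Suc.prems(4) s(1)] by simp
      from Suc.hyps(1)[OF m Suc.prems(1) y0 yn lim] obtain p' y' W where
        p': "chart ?B p'" "lifts y p' y'" "\<forall>i\<in>?B. monom_unit ?B (\<lambda>x. p' x $ i)" and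
        W: "hol_germ W" "depends_on ?B W" "\<forall>\<^sub>F x in nhds 0. vmonom A b' (p' x) = p' x $ n * W x" by blast
      have "\<forall>\<^sub>F x in nhds 0. vmonom A b (p (p' x)) = p (p' x) $ n * W x"
        using W(3) by eventually_elim (simp add: p_def mA mb True)
      moreover have "monom_unit ?B (\<lambda>x. p (p' x) $ i)" if "i \<in> ?B" for i
        using monom_unit_comp[OF mup[OF that] p'(1)] p'(3) by blast
      ultimately show ?thesis
        using chart_comp[OF cp p'(1)] lifts_comp[OF ly p'(2)] W
        by (intro exI[of _ "\<lambda>x. p (p' x)"] exI[of _ y'] exI[of _ W]) auto
    qed
  qed
qed

text \<open>A polynomial of degree \<open>d\<close> without a term of degree \<open>d - 1\<close>, but with some other lower term, is
  not a multiple of \<open>(s - t) ^ d\<close>. Hence its order at every point \<open>t\<close> is less than \<open>d\<close>: in the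
  variable \<open>w = s - t\<close> it is not of the form \<open>w ^ d * T w\<close>. This makes the order drop in the
  induction below.\<close>

lemma poly_not_pure:
  fixes r t :: complex
  assumes J: "J \<subseteq> {..<d - 1}" "j0 \<in> J" "\<beta> j0 \<noteq> 0" and r: "r \<noteq> 0"
    and T: "(T \<longlongrightarrow> L) (at 0)"
    and eq: "\<forall>\<^sub>F w in nhds 0. (\<Sum>j\<in>J. \<beta> j * (w + t) ^ j) + r * (w + t) ^ d = w ^ d * T w"
  shows False
proof -
  define p where "p = (\<Sum>j\<in>J. monom (\<beta> j) j) + monom r d"
  have fJ: "finite J" using J(1) finite_subset by blast
  have cp: "coeff p i = (if i \<in> J then \<beta> i else 0) + (if i = d then r else 0)" for i
  proof -
    have "coeff p i = (\<Sum>j\<in>J. if j = i then \<beta> j else 0) + (if d = i then r else 0)"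
      by (simp add: p_def coeff_sum)
    then show ?thesis using fJ by (simp add: sum.delta eq_commute)
  qed
  have pp: "poly p s = (\<Sum>j\<in>J. \<beta> j * s ^ j) + r * s ^ d" for s
    by (simp add: p_def poly_sum poly_monom)
  have dJ: "d \<notin> J" "d \<ge> 2" using J by auto
  have p0: "p \<noteq> 0" using cp[of d] r dJ by auto
  have "degree p \<le> d"
    by (rule degree_le) (use cp J(1) in auto)
  define k where "k = order t p"
  obtain q where q: "p = [:- t, 1:] ^ k * q" "\<not> [:- t, 1:] dvd q"
    using order_decomp[OF p0, of t] unfolding k_def by blast
  have qt: "poly q t \<noteq> 0" using q(2) by (simp add: poly_eq_0_iff_dvd)
  have "k \<ge> d"
  proof (rule ccontr)
    assume "\<not> k \<ge> d"
    then have kd: "k < d" by simp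
    have "\<forall>\<^sub>F w in at 0. (\<Sum>j\<in>J. \<beta> j * (w + t) ^ j) + r * (w + t) ^ d = w ^ d * T w"
      using eq by (simp add: eventually_at_filter eventually_mono)
    moreover have "\<forall>\<^sub>F w in at (0::complex). w \<noteq> 0" by (simp add: eventually_at_filter)
    ultimately have ev: "\<forall>\<^sub>F w in at 0. w ^ (d - k) * T w = poly q (w + t)"
    proof eventually_elim
      case (elim w)
      have "w ^ k * poly q (w + t) = w ^ d * T w"
        using elim(1) pp[of "w + t"] by (simp add: q(1) poly_power)
      also have "w ^ d = w ^ k * w ^ (d - k)" using kd by (simp add: power_add[symmetric])
      finally show ?case using elim(2) by (simp add: mult.assoc)
    qed
    have "((\<lambda>w. w ^ (d - k) * T w) \<longlongrightarrow> 0 ^ (d - k) * L) (at 0)"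
      by (intro tendsto_intros T)
    then have "((\<lambda>w. w ^ (d - k) * T w) \<longlongrightarrow> 0) (at 0)"
      using kd by (simp add: power_0_left)
    then have "((\<lambda>w. poly q (w + t)) \<longlongrightarrow> 0) (at 0)"
      using ev by (rule Lim_transform_eventually)
    moreover have "((\<lambda>w. poly q (w + t)) \<longlongrightarrow> poly q (0 + t)) (at 0)"
      by (intro tendsto_intros)
    ultimately show False using qt LIM_unique by force
  qed
  then have "[:- t, 1:] ^ d dvd p" unfolding q(1) by (simp add: le_imp_power_dvd)
  then obtain c where c: "p = [:- t, 1:] ^ d * c" by blast
  have "c \<noteq> 0" using c p0 by auto
  then have "degree p = d + degree c"
    using c by (simp add: degree_mult_eq degree_linear_power)
  then have "degree c = 0" using \<open>degree p \<le> d\<close> by simp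
  then obtain e where e: "c = [:e:]" using degree_eq_zeroE by blast
  have co: "coeff p i = e * (of_nat (d choose i) * (- t) ^ (d - i))" if "i \<le> d" for i
    using coeff_linear_poly_power[OF that, of "-t" 1] by (simp add: c e mult.commute)
  have "e = r" using co[of d] cp[of d] dJ by simp
  have "coeff p (d - 1) = 0" using cp[of "d - 1"] J(1) dJ by auto
  then have "t = 0" using co[of "d - 1"] dJ r \<open>e = r\<close> by (auto simp: binomial_symmetric[symmetric])
  have "j0 < d" using J by auto
  then have "coeff p j0 = 0" using co[of j0] \<open>t = 0\<close> by simp
  then show False using cp[of j0] J \<open>j0 < d\<close> by auto
qed

section \<open>Monomialization\<close>

text \<open>Monomialization for germs that, up to a monomial in \<open>A\<close>, are regular of order \<open>d\<close> in the
  coordinate \<open>x $ n\<close>, i.e. whose restriction to the \<open>n\<close>-th axis has a zero of order exactly \<open>d\<close>.\<close>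

definition regular_case :: "'n::finite set \<Rightarrow> 'n \<Rightarrow> nat \<Rightarrow> bool" where
  "regular_case A n d \<longleftrightarrow> (\<forall>a g z f. hol_germ (g :: complex^'n \<Rightarrow> complex) \<longrightarrow> depends_on (insert n A) g \<longrightarrow> (\<forall>j<d. taylor_coeff n j g 0 = 0) \<longrightarrow>
     taylor_coeff n d g 0 \<noteq> 0 \<longrightarrow> z \<longlonglongrightarrow> 0 \<longrightarrow> (\<forall>\<^sub>F x in nhds 0. f x = vmonom A a x * g x) \<longrightarrow>
     monomializable (insert n A) f z)"

lemma regular_caseD:
  assumes "regular_case A n d" "hol_germ g" "depends_on (insert n A) g" "\<And>j. j < d \<Longrightarrow> taylor_coeff n j g 0 = 0"
    "taylor_coeff n d g 0 \<noteq> 0" "z \<longlonglongrightarrow> 0" "\<forall>\<^sub>F x in nhds 0. f x = vmonom A a x * g x"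
  shows "monomializable (insert n A) f z"
  using assms unfolding regular_case_def by blast

lemma vec_upd_0_lim: "((\<lambda>w. vec_upd (0::complex^'n) n w) \<longlongrightarrow> 0) (nhds 0)"
proof (rule vec_tendstoI)
  fix i show "((\<lambda>w. vec_upd (0::complex^'n) n w $ i) \<longlongrightarrow> 0 $ i) (nhds 0)"
    by (cases "i = n") (auto simp: filterlim_ident)
qed

text \<open>The main step. The germ has the form of a polynomial in \<open>x $ n\<close> of degree \<open>d\<close> (with a unit as
  leading coefficient) whose coefficient at degree \<open>j\<close> is divisible by the \<open>(d - j)\<close>-th power of one
  monomial \<open>b\<close>, exactly so for \<open>j = j0\<close>, and which has no term of degree \<open>d - 1\<close>.
  Where \<open>x $ n\<close> is at most of the size of \<open>b\<close>, the substitution of \<open>b * (x $ n + l)\<close> for \<open>x $ n\<close>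
  extracts \<open>b ^ d\<close> and leaves a germ of smaller order. Where \<open>b\<close> is negligible compared
  with \<open>x $ n\<close>, the leading term dominates once \<open>b\<close> has become a multiple of \<open>x $ n\<close>.\<close>

lemma monomialize_by_ratio:
  fixes z :: "nat \<Rightarrow> complex^'n"
  assumes n: "n \<notin> A" and K: "\<And>d'. d' < d \<Longrightarrow> regular_case A n d'"
    and J: "J \<subseteq> {..<d - 1}" "j0 \<in> J"
    and v: "\<And>j. j \<in> J \<Longrightarrow> hol_germ (v j)" "\<And>j. j \<in> J \<Longrightarrow> depends_on A (v j)" "v j0 0 \<noteq> 0"
    and e0: "\<And>i. i \<in> A \<Longrightarrow> e j0 i = 0"
    and R: "hol_germ R" "depends_on (insert n A) R" "R 0 \<noteq> 0"
    and s: "hol_germ s" "depends_on A s" "s 0 \<noteq> 0"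
    and b0: "vmonom A b 0 = 0"
    and z: "z \<longlonglongrightarrow> 0"
    and f: "\<forall>\<^sub>F x in nhds 0. f x = vmonom A a x * s x *
      ((\<Sum>j\<in>J. (vmonom A b x * vmonom A (e j) x) ^ (d - j) * v j x * x $ n ^ j) + x $ n ^ d * R x)"
  shows "monomializable (insert n A) f z"
proof -
  let ?B = "insert n A"
  have fJ: "finite J" using J(1) finite_subset by blast
  have jd: "j < d" if "j \<in> J" for j using J(1) that by auto
  have mA: "vmonom A c (vec_upd x n w) = vmonom A c x" for c x w
    by (rule depends_on_vec_upd[OF depends_on_vmonom n])
  show ?thesis
  proof (cases "\<exists>M. \<exists>\<^sub>F k in sequentially. norm (z k $ n) \<le> M * norm (vmonom A b (z k))")
    case True
    then obtain M where M: "\<exists>\<^sub>F k in sequentially. norm (z k $ n) \<le> M * norm (vmonom A b (z k))" by blast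
    define t where "t = (\<lambda>k. z k $ n / vmonom A b (z k))"
    have "norm (t k) \<le> \<bar>M\<bar>" if "norm (z k $ n) \<le> M * norm (vmonom A b (z k))" for k
    proof (cases "vmonom A b (z k) = 0")
      case False
      then have "norm (t k) \<le> M" using that by (simp add: t_def norm_divide divide_simps)
      then show ?thesis by simp
    qed (simp add: t_def)
    then have bnd: "bounded (t ` {k. norm (z k $ n) \<le> M * norm (vmonom A b (z k))})"
      unfolding bounded_iff by blast
    obtain \<sigma> l where sg: "filterlim \<sigma> at_top sequentially" "(\<lambda>j. t (\<sigma> j)) \<longlonglongrightarrow> l"
      "\<And>j. norm (z (\<sigma> j) $ n) \<le> M * norm (vmonom A b (z (\<sigma> j)))"
      by (rule bounded_subseq[OF M bnd]) blast
    define p where "p = (\<lambda>x::complex^'n. vec_upd x n (vmonom A b x * (x $ n + l)))"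
    have cp: "chart ?B p" unfolding p_def
      by (intro chart_vec_upd hol_germ_mult hol_germ_add depends_on_mult depends_on_add depends_on_coord depends_on_const depends_on_superset[OF depends_on_vmonom])
        (use b0 in auto)
    define y where "y = (\<lambda>j. vec_upd (z (\<sigma> j)) n (t (\<sigma> j) - l))"
    have ly: "lifts z p y"
      unfolding y_def
    proof (rule lifts_vec_upd[OF z sg(1,2)])
      fix j
      have "vmonom A b (z (\<sigma> j)) * t (\<sigma> j) = z (\<sigma> j) $ n"
        using sg(3)[of j] by (cases "vmonom A b (z (\<sigma> j)) = 0") (auto simp: t_def)
      then show "p (vec_upd (z (\<sigma> j)) n (t (\<sigma> j) - l)) = z (\<sigma> j)"
        by (simp add: p_def mA vec_eq_iff)
    qed
    have y0: "y \<longlonglongrightarrow> 0" using ly by (simp add: lifts_def)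
    define h where "h = (\<lambda>x. s x * ((\<Sum>j\<in>J. vmonom A (e j) x ^ (d - j) * v j x * (x $ n + l) ^ j) + (x $ n + l) ^ d * R (p x)))"
    have hh: "hol_germ h" unfolding h_def
      using s(1) v(1) chart_hol[OF cp R(1)]
      by (intro hol_germ_mult hol_germ_add hol_germ_sum hol_germ_power) auto
    have AB: "A \<subseteq> ?B" by auto
    have dh: "depends_on ?B h" unfolding h_def
      using depends_on_superset[OF s(2) AB] depends_on_superset[OF v(2) AB] chart_dep[OF cp R(2)]
      by (intro depends_on_mult depends_on_add depends_on_sum depends_on_power depends_on_coord depends_on_const depends_on_superset[OF depends_on_vmonom AB]) auto
    have fp: "\<forall>\<^sub>F x in nhds 0. f (p x) = vmonom A (\<lambda>i. a i + d * b i) x * h x"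
      using chart_ev[OF cp f]
    proof eventually_elim
      case (elim x)
      have dA: "g (p x) = g x" if "depends_on A g" for g unfolding p_def by (rule depends_on_vec_upd[OF that n])
      have pn: "p x $ n = vmonom A b x * (x $ n + l)" by (simp add: p_def)
      have "(vmonom A b x * vmonom A (e j) x) ^ (d - j) * v j x * (vmonom A b x * (x $ n + l)) ^ j =
          vmonom A b x ^ d * (vmonom A (e j) x ^ (d - j) * v j x * (x $ n + l) ^ j)" if "j \<in> J" for j
      proof -
        have "vmonom A b x ^ d = vmonom A b x ^ (d - j) * vmonom A b x ^ j"
          using jd[OF that] by (simp add: power_add[symmetric])
        then show ?thesis by (simp add: power_mult_distrib mult_ac)
      qed
      then have "(\<Sum>j\<in>J. (vmonom A b x * vmonom A (e j) x) ^ (d - j) * v j x * (vmonom A b x * (x $ n + l)) ^ j) =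
          vmonom A b x ^ d * (\<Sum>j\<in>J. vmonom A (e j) x ^ (d - j) * v j x * (x $ n + l) ^ j)"
        unfolding sum_distrib_left by (rule sum.cong[OF refl])
      moreover have "(\<Sum>j\<in>J. (vmonom A b (p x) * vmonom A (e j) (p x)) ^ (d - j) * v j (p x) * p x $ n ^ j) =
         (\<Sum>j\<in>J. (vmonom A b x * vmonom A (e j) x) ^ (d - j) * v j x * (vmonom A b x * (x $ n + l)) ^ j)"
        by (intro sum.cong refl) (simp add: dA[OF depends_on_vmonom] dA[OF v(2)] pn)
      ultimately have eq: "(\<Sum>j\<in>J. (vmonom A b (p x) * vmonom A (e j) (p x)) ^ (d - j) * v j (p x) * p x $ n ^ j) =
          vmonom A b x ^ d * (\<Sum>j\<in>J. vmonom A (e j) x ^ (d - j) * v j x * (x $ n + l) ^ j)" by simp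
      show ?case
        using elim unfolding eq unfolding dA[OF depends_on_vmonom] dA[OF s(2)] pn h_def vmonom_add vmonom_scale power_mult_distrib
        by (simp add: distrib_left mult_ac)
    qed
    \<comment> \<open>On the \<open>n\<close>-th axis \<open>h\<close> is a polynomial of degree \<open>d\<close> in \<open>w + l\<close>, which is not a pure power of \<open>w\<close>.\<close>
    have "\<exists>d'<d. taylor_coeff n d' h 0 \<noteq> 0"
    proof (rule ccontr)
      assume "\<not> ?thesis"
      then have zero: "taylor_coeff n j h 0 = 0" if "j < d" for j using that by blast
      obtain T where T: "hol_germ T" "\<forall>\<^sub>F x in nhds 0. h x = (\<Sum>j<d. taylor_coeff n j h x * x $ n ^ j) + x $ n ^ d * T x"
        by (rule taylor_remainder[OF hh, of n d]) blast
      have ev: "\<forall>\<^sub>F w in nhds 0. h (vec_upd 0 n w) = w ^ d * T (vec_upd 0 n w)"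
        using eventually_compose_filterlim[OF T(2) vec_upd_0_lim[of n]]
      proof eventually_elim
        case (elim w)
        have "taylor_coeff n j h (vec_upd 0 n w) = taylor_coeff n j h 0" for j by (simp add: taylor_coeff_def)
        then show ?case using elim zero by simp
      qed
      define \<beta> where "\<beta> = (\<lambda>j. s 0 * (vmonom A (e j) 0 ^ (d - j) * v j 0))"
      have "\<forall>\<^sub>F w in nhds 0. (\<Sum>j\<in>J. \<beta> j * (w + l) ^ j) + (s 0 * R 0) * (w + l) ^ d = w ^ d * T (vec_upd 0 n w)"
        using ev
      proof eventually_elim
        case (elim w)
        have "p (vec_upd 0 n w) = 0" by (simp add: p_def mA b0)
        moreover have "(\<Sum>j\<in>J. vmonom A (e j) (vec_upd 0 n w) ^ (d - j) * v j (vec_upd 0 n w) * (w + l) ^ j) =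
            (\<Sum>j\<in>J. vmonom A (e j) 0 ^ (d - j) * v j 0 * (w + l) ^ j)"
          by (intro sum.cong refl) (simp add: mA depends_on_vec_upd[OF v(2) n])
        ultimately have "h (vec_upd 0 n w) = s 0 * ((\<Sum>j\<in>J. vmonom A (e j) 0 ^ (d - j) * v j 0 * (w + l) ^ j) + (w + l) ^ d * R 0)"
          by (simp add: h_def depends_on_vec_upd[OF s(2) n])
        then show ?case using elim by (simp add: \<beta>_def sum_distrib_left algebra_simps)
      qed
      moreover have "((\<lambda>w. T (vec_upd 0 n w)) \<longlongrightarrow> T 0) (at 0)"
        using filterlim_compose[OF hol_germ_tendsto0[OF T(1)] vec_upd_0_lim[of n]]
        by (rule filterlim_mono) (auto simp: at_within_le_nhds)
      moreover have "\<beta> j0 \<noteq> 0"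
      proof -
        have "vmonom A (e j0) 0 = 1" using e0 by (simp add: vmonom_def)
        then show ?thesis using s(3) v(3) by (simp add: \<beta>_def)
      qed
      ultimately show False using poly_not_pure[OF J, of \<beta> "s 0 * R 0"] s(3) R(3) by force
    qed
    then obtain d' where d': "d' < d" "taylor_coeff n d' h 0 \<noteq> 0" "\<And>j. j < d' \<Longrightarrow> taylor_coeff n j h 0 = 0"
      using exists_least_iff[of "\<lambda>j. taylor_coeff n j h 0 \<noteq> 0"] by (metis (no_types, lifting) dual_order.strict_trans not_less_iff_gr_or_eq)
    have "monomializable ?B (\<lambda>x. f (p x)) y"
      by (rule regular_caseD[OF K[OF d'(1)] hh dh d'(3,2) y0 fp])
    then show ?thesis by (rule monomializable_comp[OF cp ly])
  next
    case False
    then have big: "\<forall>\<^sub>F k in sequentially. M * norm (vmonom A b (z k)) < norm (z k $ n)" for M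
      by (auto simp: frequently_def not_le)
    from big[of 0] obtain N where N: "\<And>k. k \<ge> N \<Longrightarrow> z k $ n \<noteq> 0"
      unfolding eventually_sequentially by auto
    define y where "y = (\<lambda>k. z (k + N))"
    have y0: "y \<longlonglongrightarrow> 0" unfolding y_def using z by (rule LIMSEQ_ignore_initial_segment)
    have ly: "lifts z (\<lambda>x. x) y"
      unfolding lifts_def using y0 by (auto simp: y_def intro!: exI[of _ "\<lambda>k. k + N"] filterlim_add_const_nat_at_top)
    have yn: "y k $ n \<noteq> 0" for k using N by (simp add: y_def)
    have "(\<lambda>k. vmonom A b (z k) / z k $ n) \<longlonglongrightarrow> 0"
    proof (rule tendstoI)
      fix \<epsilon> :: real assume "\<epsilon> > 0"
      show "\<forall>\<^sub>F k in sequentially. dist (vmonom A b (z k) / z k $ n) 0 < \<epsilon>"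
        using big[of "1 / \<epsilon>"] big[of 0]
        by eventually_elim (use \<open>\<epsilon> > 0\<close> in \<open>auto simp: norm_divide divide_simps mult.commute\<close>)
    qed
    then have lim: "(\<lambda>k. vmonom A b (y k) / y k $ n) \<longlonglongrightarrow> 0"
      unfolding y_def by (rule LIMSEQ_ignore_initial_segment)
    obtain p w W where p: "chart ?B p" "lifts y p w" "\<And>i. i \<in> ?B \<Longrightarrow> monom_unit ?B (\<lambda>x. p x $ i)"
      and W: "hol_germ W" "depends_on ?B W" "\<forall>\<^sub>F x in nhds 0. vmonom A b (p x) = p x $ n * W x"
      using blowup_chain[OF n y0 yn lim] by blast
    have w: "filterlim w (nhds 0) sequentially" using p(2) by (simp add: lifts_def)
    obtain \<tau> where ta: "filterlim \<tau> at_top sequentially" "\<And>k. p (w k) = y (\<tau> k)"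
      using p(2) by (auto simp: lifts_def)
    have W0: "W 0 = 0"
    proof (rule LIMSEQ_unique)
      show "(\<lambda>k. W (w k)) \<longlonglongrightarrow> W 0" using filterlim_compose[OF hol_germ_tendsto0[OF W(1)] w] .
      have "\<forall>\<^sub>F k in sequentially. vmonom A b (y (\<tau> k)) / y (\<tau> k) $ n = W (w k)"
        using eventually_compose_filterlim[OF W(3) w] by eventually_elim (use yn in \<open>simp add: ta\<close>)
      with filterlim_compose[OF lim ta(1)] show "(\<lambda>k. W (w k)) \<longlonglongrightarrow> 0"
        by (rule Lim_transform_eventually)
    qed
    have AB: "A \<subseteq> ?B" by auto
    \<comment> \<open>What remains after extracting \<open>p x $ n ^ d\<close>; all terms but the last vanish at the origin.\<close>
    define U where "U = (\<lambda>x. (\<Sum>j\<in>J. (W x * vmonom A (e j) (p x)) ^ (d - j) * v j (p x)) + R (p x))"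
    have "hol_germ U" unfolding U_def
      using chart_hol[OF p(1)] v(1) R(1) W(1)
      by (intro hol_germ_add hol_germ_sum hol_germ_mult hol_germ_power) auto
    moreover have "depends_on ?B U" unfolding U_def
      using chart_dep[OF p(1)] depends_on_superset[OF v(2) AB] R(2) W(2) depends_on_superset[OF depends_on_vmonom AB]
      by (intro depends_on_add depends_on_sum depends_on_mult depends_on_power) auto
    moreover have "U 0 \<noteq> 0"
    proof -
      have "(\<Sum>j\<in>J. (W 0 * vmonom A (e j) (p 0)) ^ (d - j) * v j (p 0)) = 0"
      proof (rule sum.neutral, rule ballI)
        fix j assume "j \<in> J"
        with jd[of j] show "(W 0 * vmonom A (e j) (p 0)) ^ (d - j) * v j (p 0) = 0"
          by (simp add: W0)
      qed
      then show ?thesis using p(1) R(3) by (simp add: U_def chart_def)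
    qed
    ultimately have muU: "monom_unit ?B U" by (rule monom_unit_unit)
    have mus: "monom_unit ?B (\<lambda>x. s (p x))"
      by (rule monom_unit_unit[OF chart_hol[OF p(1) s(1)] chart_dep[OF p(1) depends_on_superset[OF s(2) AB]]])
        (use p(1) s(3) in \<open>simp add: chart_def\<close>)
    have "monom_unit ?B (\<lambda>x. vmonom A a (p x) * s (p x) * (p x $ n ^ d * U x))"
      by (intro monom_unit_mult monom_unit_vmonom_comp mus monom_unit_power p(3) muU) auto
    moreover have "\<forall>\<^sub>F x in nhds 0. vmonom A a (p x) * s (p x) * (p x $ n ^ d * U x) = f (p x)"
      using chart_ev[OF p(1) f] W(3)
    proof eventually_elim
      case (elim x)
      have "(\<Sum>j\<in>J. (vmonom A b (p x) * vmonom A (e j) (p x)) ^ (d - j) * v j (p x) * p x $ n ^ j) =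
          (\<Sum>j\<in>J. p x $ n ^ d * ((W x * vmonom A (e j) (p x)) ^ (d - j) * v j (p x)))"
      proof (intro sum.cong refl)
        fix j assume "j \<in> J"
        then have "p x $ n ^ d = p x $ n ^ (d - j) * p x $ n ^ j"
          using jd[of j] by (simp add: power_add[symmetric])
        then show "(vmonom A b (p x) * vmonom A (e j) (p x)) ^ (d - j) * v j (p x) * p x $ n ^ j =
          p x $ n ^ d * ((W x * vmonom A (e j) (p x)) ^ (d - j) * v j (p x))"
          using elim(2) by (simp add: power_mult_distrib mult_ac)
      qed
      then show ?case using elim(1) by (simp add: U_def sum_distrib_left algebra_simps)
    qed
    ultimately have "monom_unit ?B (\<lambda>x. f (p x))" by (rule monom_unit_cong[rotated])
    with p lifts_comp[OF ly p(2)] show ?thesis unfolding monomializable_def by blast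
  qed
qed

lemma prod_not_ev_0:
  fixes f :: "'i \<Rightarrow> complex^'n \<Rightarrow> complex"
  assumes "finite I" "\<And>i. i \<in> I \<Longrightarrow> hol_germ (f i)" "\<And>i. i \<in> I \<Longrightarrow> \<not> (\<forall>\<^sub>F x in nhds 0. f i x = 0)"
  shows "\<not> (\<forall>\<^sub>F x in nhds 0. (\<Prod>i\<in>I. f i x) = 0)"
  using assms
proof (induction I)
  case empty
  then show ?case using eventually_nhds_x_imp_x by fastforce
next
  case (insert i I)
  have "hol_germ (\<lambda>x. \<Prod>i\<in>I. f i x)" using insert by (intro hol_germ_prod) auto
  then show ?case using insert hol_germ_mult_eq_0[of "f i" "\<lambda>x. \<Prod>i\<in>I. f i x"] by auto
qed

lemma monom_unit_prod_factors:
  fixes f :: "'i \<Rightarrow> complex^'n \<Rightarrow> complex"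
  assumes "finite I" "\<And>i. i \<in> I \<Longrightarrow> hol_germ (f i)" "\<And>i. i \<in> I \<Longrightarrow> depends_on A (f i)"
    "monom_unit A (\<lambda>x. \<Prod>i\<in>I. f i x)" "i \<in> I"
  shows "monom_unit A (f i)"
proof -
  have e: "(\<Prod>i\<in>I. f i x) = f i x * (\<Prod>i\<in>I - {i}. f i x)" for x
    using assms by (simp add: prod.remove)
  show ?thesis
  proof (rule monom_unit_factors(1))
    show "monom_unit A (\<lambda>x. f i x * (\<Prod>i\<in>I - {i}. f i x))" using assms(4) by (simp add: e)
  qed (use assms in \<open>auto intro!: hol_germ_prod depends_on_prod\<close>)
qed

lemma depends_on_if: "(P \<Longrightarrow> depends_on A f) \<Longrightarrow> (\<not> P \<Longrightarrow> depends_on A g) \<Longrightarrow> depends_on A (\<lambda>x. if P then f x else g x)"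
  by (cases P) auto

text \<open>Reduction to \<open>monomialize_by_ratio\<close>: the nonzero Taylor coefficients, the coordinates
  and the differences of suitable powers of the coefficients are monomialized simultaneously by
  applying the induction hypothesis to their product. The coefficients then are monomials whose
  weighted exponents are totally ordered by divisibility, and a power substitution makes these
  exponents integral.\<close>

lemma monomialize_depressed:
  fixes z :: "nat \<Rightarrow> complex^'n"
  assumes n: "n \<notin> A" and K: "\<And>d'. d' < d \<Longrightarrow> regular_case A n d'"
    and M: "\<And>f z. hol_germ f \<Longrightarrow> depends_on A f \<Longrightarrow> \<not> (\<forall>\<^sub>F x in nhds 0. f x = 0) \<Longrightarrow> z \<longlonglongrightarrow> 0 \<Longrightarrow> monomializable A f z"
    and d: "d > 0"
    and g: "hol_germ g" "depends_on (insert n A) g" "\<And>j. j < d \<Longrightarrow> taylor_coeff n j g 0 = 0" "taylor_coeff n d g 0 \<noteq> 0"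
    and red: "\<forall>\<^sub>F x in nhds 0. taylor_coeff n (d - 1) g x = 0"
    and z: "z \<longlonglongrightarrow> 0" and f: "\<forall>\<^sub>F x in nhds 0. f x = vmonom A a x * g x"
  shows "monomializable (insert n A) f z"
proof -
  let ?B = "insert n A"
  have AB: "A \<subseteq> ?B" by auto
  define c where "c = (\<lambda>j. taylor_coeff n j g)"
  have hc: "hol_germ (c j)" and dc: "depends_on A (c j)" for j
    unfolding c_def using g by (auto intro: hol_germ_higher_deriv depends_on_taylor_coeff)
  obtain R where R: "hol_germ R" "R 0 = taylor_coeff n d g 0"
    "\<forall>\<^sub>F x in nhds 0. g x = (\<Sum>j<d. c j x * x $ n ^ j) + x $ n ^ d * R x" "depends_on ?B R"
    unfolding c_def by (rule taylor_remainder[OF g(1), of n d]) (use g(2) in blast)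
  define J where "J = {j. j < d \<and> \<not> (\<forall>\<^sub>F x in nhds 0. c j x = 0)}"
  have fJ: "finite J" unfolding J_def by (rule finite_subset[of _ "{..<d}"]) auto
  have Jd: "J \<subseteq> {..<d - 1}"
  proof
    fix j assume "j \<in> J"
    then have "j < d" "j \<noteq> d - 1" using red by (auto simp: J_def c_def)
    then show "j \<in> {..<d - 1}" by auto
  qed
  have gJ: "\<forall>\<^sub>F x in nhds 0. g x = (\<Sum>j\<in>J. c j x * x $ n ^ j) + x $ n ^ d * R x"
  proof -
    have "\<forall>\<^sub>F x in nhds 0. \<forall>j\<in>{..<d} - J. c j x = 0"
      by (intro eventually_ball_finite) (auto simp: J_def)
    then show ?thesis using R(3)
    proof eventually_elim
      case (elim x)
      have "(\<Sum>j<d. c j x * x $ n ^ j) = (\<Sum>j\<in>J. c j x * x $ n ^ j)"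
        by (rule sum.mono_neutral_right) (use Jd elim in auto)
      then show ?case using elim by simp
    qed
  qed
  show ?thesis
  proof (cases "J = {}")
    case True
    have "monom_unit ?B (\<lambda>x. vmonom A a x * (x $ n ^ d * R x))"
      using g(4) R by (intro monom_unit_mult monom_unit_vmonom monom_unit_power monom_unit_coord monom_unit_unit) auto
    moreover have "\<forall>\<^sub>F x in nhds 0. vmonom A a x * (x $ n ^ d * R x) = f x"
      using f gJ by eventually_elim (simp add: True)
    ultimately have "monom_unit ?B f" by (rule monom_unit_cong[rotated])
    then show ?thesis using z monomializable_monom_unit by blast
  next
    case False
    \<comment> \<open>All \<open>c j ^ e j\<close> have the same weight: \<open>c j\<close> counts as homogeneous of degree \<open>d - j\<close>.\<close>
    define D :: nat where "D = fact d"
    define e where "e = (\<lambda>j. D div (d - j))"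
    have eD: "e j * (d - j) = D" if "j \<in> J" for j
    proof -
      have "d - j dvd D" unfolding D_def by (rule dvd_fact) (use Jd that in auto)
      then show ?thesis by (simp add: e_def)
    qed
    have D0: "D > 0" by (simp add: D_def)
    \<comment> \<open>Differences that vanish identically are replaced by \<open>1\<close>, so that the product below is a nonzero germ.\<close>
    define df where "df = (\<lambda>(i, j). \<lambda>x. if \<forall>\<^sub>F x in nhds 0. c i x ^ e i - c j x ^ e j = 0 then 1 else c i x ^ e i - c j x ^ e j)"
    have hdf: "hol_germ (df q)" and ddf: "depends_on A (df q)" and ndf: "\<not> (\<forall>\<^sub>F x in nhds 0. df q x = 0)" for q
    proof -
      obtain i j where q: "q = (i, j)" by (cases q)
      show "hol_germ (df q)" unfolding df_def q prod.case by (intro hol_germ_if hol_germ_const hc hol_germ_diff hol_germ_power)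
      show "depends_on A (df q)" unfolding df_def q prod.case by (intro depends_on_if depends_on_const depends_on_diff depends_on_power dc)
      show "\<not> (\<forall>\<^sub>F x in nhds 0. df q x = 0)"
      proof (cases "\<forall>\<^sub>F x in nhds 0. c i x ^ e i - c j x ^ e j = 0")
        case True
        then have "df q = (\<lambda>x. 1)" by (simp add: df_def q)
        then show ?thesis using eventually_nhds_x_imp_x[of "\<lambda>x::complex^'n. df q x = 0" 0] by auto
      next
        case False
        then have "df q = (\<lambda>x. c i x ^ e i - c j x ^ e j)" by (simp add: df_def q)
        with False show ?thesis by simp
      qed
    qed
    define P1 where "P1 = (\<lambda>x. \<Prod>j\<in>J. c j x)"
    define P2 where "P2 = (\<lambda>x. \<Prod>q\<in>J \<times> J. df q x)"
    define P0 where "P0 = (vmonom A (\<lambda>_. 1) :: complex^'n \<Rightarrow> complex)"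
    have hP: "hol_germ P0" "hol_germ P1" "hol_germ P2" and dP: "depends_on A P0" "depends_on A P1" "depends_on A P2"
      unfolding P0_def P1_def P2_def
      by (auto intro!: hol_germ_prod hc hdf depends_on_prod dc ddf depends_on_vmonom)
    have "\<not> (\<forall>\<^sub>F x in nhds 0. P1 x = 0)"
      unfolding P1_def by (rule prod_not_ev_0[OF fJ hc]) (simp add: J_def)
    moreover have "\<not> (\<forall>\<^sub>F x in nhds 0. P2 x = 0)"
      unfolding P2_def by (rule prod_not_ev_0[OF _ hdf ndf]) (use fJ in simp)
    moreover have "\<not> (\<forall>\<^sub>F x in nhds 0. P0 x = 0)"
      unfolding P0_def by (rule vmonom_not_eventually_0)
    ultimately have "\<not> (\<forall>\<^sub>F x in nhds 0. P0 x * (P1 x * P2 x) = 0)"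
      using hol_germ_mult_eq_0[of P0 "\<lambda>x. P1 x * P2 x"] hol_germ_mult_eq_0[of P1 P2] hP by blast
    from M[OF _ _ this z] obtain p y where p: "chart A p" "lifts z p y" and
      mP: "monom_unit A (\<lambda>x. P0 (p x) * (P1 (p x) * P2 (p x)))"
      using hP dP by (auto simp: monomializable_def depends_on_mult)
    have hPp: "hol_germ (\<lambda>x. h (p x))" if "hol_germ h" for h :: "complex^'n \<Rightarrow> complex"
      using chart_hol[OF p(1) that] .
    have dPp: "depends_on A (\<lambda>x. h (p x))" if "depends_on A h" for h
      using chart_dep[OF p(1) that] .
    have m0: "monom_unit A (\<lambda>x. P0 (p x))" and m12: "monom_unit A (\<lambda>x. P1 (p x) * P2 (p x))"
      using monom_unit_factors[OF hPp[OF hP(1)] dPp[OF dP(1)] _ _ mP] hP dP hPp dPp by (auto intro!: depends_on_mult)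
    have m1: "monom_unit A (\<lambda>x. P1 (p x))" and m2: "monom_unit A (\<lambda>x. P2 (p x))"
      using monom_unit_factors[OF hPp[OF hP(2)] dPp[OF dP(2)] hPp[OF hP(3)] dPp[OF dP(3)] m12] by auto
    have mx: "monom_unit A (\<lambda>x. p x $ i)" if "i \<in> A" for i
      using monom_unit_prod_factors[of A "\<lambda>i x. p x $ i" A i] m0 p(1) that by (simp add: P0_def vmonom_def chart_def)
    have mc: "monom_unit A (\<lambda>x. c j (p x))" if "j \<in> J" for j
      using monom_unit_prod_factors[OF fJ hPp[OF hc] dPp[OF dc] m1[unfolded P1_def] that] .
    have md: "monom_unit A (\<lambda>x. df q (p x))" if "q \<in> J \<times> J" for q
      using monom_unit_prod_factors[OF finite_cartesian_product[OF fJ fJ] hPp[OF hdf] dPp[OF ddf] m2[unfolded P2_def] that] .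
    have "\<forall>j\<in>J. \<exists>b u. hol_germ u \<and> depends_on A u \<and> u 0 \<noteq> 0 \<and> (\<forall>\<^sub>F x in nhds 0. c j (p x) = vmonom A b x * u x)"
      using mc by (simp add: monom_unit_def)
    then obtain \<gamma> u where u: "\<And>j. j \<in> J \<Longrightarrow> hol_germ (u j)" "\<And>j. j \<in> J \<Longrightarrow> depends_on A (u j)"
      "\<And>j. j \<in> J \<Longrightarrow> u j 0 \<noteq> 0" "\<And>j. j \<in> J \<Longrightarrow> \<forall>\<^sub>F x in nhds 0. c j (p x) = vmonom A (\<gamma> j) x * u j x"
      unfolding bchoice_iff by blast
    define \<delta> where "\<delta> = (\<lambda>j i. e j * \<gamma> j i)"
    have cmp: "(\<forall>k\<in>A. \<delta> i k \<le> \<delta> j k) \<or> (\<forall>k\<in>A. \<delta> j k \<le> \<delta> i k)" if ij: "i \<in> J" "j \<in> J" for i j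
    proof (rule vmonom_comparable)
      show "hol_germ (\<lambda>x. u i x ^ e i)" "hol_germ (\<lambda>x. u j x ^ e j)" using u(1) ij by auto
      show "depends_on A (\<lambda>x. u i x ^ e i)" "depends_on A (\<lambda>x. u j x ^ e j)" using u(2) ij by (auto intro: depends_on_power)
      show "u i 0 ^ e i \<noteq> 0" "u j 0 ^ e j \<noteq> 0" using u(3) ij by auto
      have ev: "\<forall>\<^sub>F x in nhds 0. c i (p x) ^ e i - c j (p x) ^ e j =
          vmonom A (\<delta> i) x * u i x ^ e i - vmonom A (\<delta> j) x * u j x ^ e j"
        using u(4)[OF ij(1)] u(4)[OF ij(2)]
        by eventually_elim (simp add: \<delta>_def vmonom_scale power_mult_distrib)
      show "(\<forall>\<^sub>F x in nhds 0. vmonom A (\<delta> i) x * u i x ^ e i - vmonom A (\<delta> j) x * u j x ^ e j = 0) \<or>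
         monom_unit A (\<lambda>x. vmonom A (\<delta> i) x * u i x ^ e i - vmonom A (\<delta> j) x * u j x ^ e j)"
      proof (cases "\<forall>\<^sub>F x in nhds 0. c i x ^ e i - c j x ^ e j = 0")
        case True
        have "\<forall>\<^sub>F x in nhds 0. vmonom A (\<delta> i) x * u i x ^ e i - vmonom A (\<delta> j) x * u j x ^ e j = 0"
          using chart_ev[OF p(1) True] ev by eventually_elim simp
        then show ?thesis ..
      next
        case False
        then have "df (i, j) = (\<lambda>x. c i x ^ e i - c j x ^ e j)" by (simp add: df_def)
        then have "monom_unit A (\<lambda>x. c i (p x) ^ e i - c j (p x) ^ e j)" using md[of "(i, j)"] ij by simp
        then show ?thesis using monom_unit_cong[OF ev] by blast
      qed
    qed
    obtain j0 where j0: "j0 \<in> J" "\<And>j. j \<in> J \<Longrightarrow> (\<Sum>k\<in>A. \<delta> j0 k) \<le> (\<Sum>k\<in>A. \<delta> j k)"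
      using ex_min_if_finite[OF finite_imageI[OF fJ], of "\<lambda>j. \<Sum>k\<in>A. \<delta> j k"] False
      by (metis (mono_tags, lifting) arg_min_if_finite(1) arg_min_least fJ)
    have min: "\<delta> j0 k \<le> \<delta> j k" if j: "j \<in> J" and k: "k \<in> A" for j k
    proof (rule ccontr)
      assume "\<not> ?thesis"
      then have lt: "\<delta> j k < \<delta> j0 k" by simp
      then have "\<forall>k\<in>A. \<delta> j k \<le> \<delta> j0 k" using cmp[OF j j0(1)] k by force
      then have "(\<Sum>k\<in>A. \<delta> j k) < (\<Sum>k\<in>A. \<delta> j0 k)"
        by (intro sum_strict_mono_ex1) (use lt k in auto)
      then show False using j0(2)[OF j] by simp
    qed
    \<comment> \<open>The power substitution turns the exponents \<open>\<gamma> j\<close> into \<open>D * \<gamma> j = (d - j) * \<delta> j\<close>.\<close>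
    define T where "T = (\<lambda>x::complex^'n. \<chi> i. if i \<in> A then x $ i ^ D else x $ i)"
    have cT: "chart A T"
      unfolding chart_def T_def using D0 by (auto simp: hol_germ_if depends_on_power depends_on_coord vec_eq_iff)
    have mT: "vmonom A b (T x) = vmonom A b x ^ D" for b x
      unfolding T_def vmonom_def by (simp add: prod_power_distrib power_mult[symmetric] mult.commute)
    define rt where "rt = (\<lambda>w::complex. SOME v. v ^ D = w)"
    have rt: "rt w ^ D = w" for w
      unfolding rt_def by (rule someI_ex) (metis D0 exists_complex_root neq0_conv)
    define y' where "y' = (\<lambda>k. \<chi> i. if i \<in> A then rt (y k $ i) else y k $ i)"
    have y0: "y \<longlonglongrightarrow> 0" using p(2) by (simp add: lifts_def)
    have y'0: "y' \<longlonglongrightarrow> 0"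
    proof (rule vec_tendstoI)
      fix i
      have yi: "(\<lambda>k. y k $ i) \<longlonglongrightarrow> 0" using tendsto_vec_nth[OF y0, of i] by simp
      show "(\<lambda>k. y' k $ i) \<longlonglongrightarrow> 0 $ i"
      proof (cases "i \<in> A")
        case True
        have nr: "norm (rt w) = root D (norm w)" for w
          using rt[of w] D0 by (metis norm_ge_zero norm_power real_root_power_cancel)
        have "(\<lambda>k. root D (norm (y k $ i))) \<longlonglongrightarrow> root D (norm (0::complex))"
          by (intro tendsto_intros yi)
        then have "(\<lambda>k. norm (y' k $ i)) \<longlonglongrightarrow> 0" using True by (simp add: y'_def nr)
        then show ?thesis by (simp add: tendsto_norm_zero_iff)
      qed (use yi in \<open>simp add: y'_def\<close>)
    qed
    have lT: "lifts y T y'"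
      unfolding lifts_def using y'0
      by (auto intro!: exI[of _ "\<lambda>k. k"] filterlim_ident simp: T_def y'_def vec_eq_iff rt)
    define \<rho> where "\<rho> = (\<lambda>x. p (T x))"
    have c\<rho>: "chart A \<rho>" unfolding \<rho>_def by (rule chart_comp[OF p(1) cT])
    have c\<rho>B: "chart ?B \<rho>" by (rule chart_mono[OF c\<rho> AB])
    have l\<rho>: "lifts z \<rho> y'" unfolding \<rho>_def by (rule lifts_comp[OF p(2) lT])
    have \<rho>n: "\<rho> x $ n = x $ n" for x using c\<rho> n by (simp add: chart_def)
    have mT': "monom_unit A (\<lambda>x. T x $ i)" if "i \<in> A" for i
      using that by (auto simp: T_def intro!: monom_unit_power monom_unit_coord)
    have "monom_unit A (\<lambda>x. vmonom A a (\<rho> x))"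
      unfolding \<rho>_def by (rule monom_unit_vmonom_comp, rule monom_unit_comp[OF mx cT mT'])
    then obtain a' s where s: "hol_germ s" "depends_on A s" "s 0 \<noteq> 0" "\<forall>\<^sub>F x in nhds 0. vmonom A a (\<rho> x) = vmonom A a' x * s x"
      by (auto simp: monom_unit_def)
    define v where "v = (\<lambda>j x. u j (T x))"
    define \<epsilon> where "\<epsilon> = (\<lambda>j k. \<delta> j k - \<delta> j0 k)"
    have m\<delta>: "vmonom A (\<delta> j) x = vmonom A (\<delta> j0) x * vmonom A (\<epsilon> j) x" if "j \<in> J" for j x
      unfolding \<epsilon>_def by (rule vmonom_split) (use min that in auto)
    have cv: "\<forall>\<^sub>F x in nhds 0. c j (\<rho> x) = (vmonom A (\<delta> j0) x * vmonom A (\<epsilon> j) x) ^ (d - j) * v j x" if j: "j \<in> J" for j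
      using chart_ev[OF cT u(4)[OF j]]
    proof eventually_elim
      case (elim x)
      have "vmonom A (\<gamma> j) x ^ D = vmonom A (\<delta> j) x ^ (d - j)"
        unfolding eD[OF j, symmetric] \<delta>_def vmonom_scale by (simp add: power_mult)
      then show ?case using elim m\<delta>[OF j] by (simp add: \<rho>_def mT v_def)
    qed
    have T0: "T 0 = 0" using cT by (simp add: chart_def)
    have v0: "v j 0 \<noteq> 0" if "j \<in> J" for j using u(3)[OF that] by (simp add: v_def T0)
    have b0: "vmonom A (\<delta> j0) 0 = 0"
    proof -
      have "c j0 (\<rho> 0) = 0" using g(3)[of j0] j0(1) c\<rho> Jd by (auto simp: chart_def c_def)
      with eventually_nhds_x_imp_x[OF cv[OF j0(1)]] v0[OF j0(1)]
      have "(vmonom A (\<delta> j0) 0 * vmonom A (\<epsilon> j0) 0) ^ (d - j0) = 0" by simp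
      moreover have "vmonom A (\<epsilon> j0) 0 = 1" by (simp add: \<epsilon>_def vmonom_def)
      ultimately show ?thesis by simp
    qed
    have "monomializable ?B (\<lambda>x. f (\<rho> x)) y'"
    proof (rule monomialize_by_ratio[OF n K Jd j0(1), where v = v and e = \<epsilon> and b = "\<delta> j0" and s = s and a = a' and R = "\<lambda>x. R (\<rho> x)"])
      show "hol_germ (v j)" "depends_on A (v j)" if "j \<in> J" for j
        unfolding v_def using chart_hol[OF cT u(1)[OF that]] chart_dep[OF cT u(2)[OF that]] by auto
      show "v j0 0 \<noteq> 0" by (rule v0[OF j0(1)])
      show "\<epsilon> j0 i = 0" for i by (simp add: \<epsilon>_def)
      show "hol_germ (\<lambda>x. R (\<rho> x))" "depends_on ?B (\<lambda>x. R (\<rho> x))"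
        using chart_hol[OF c\<rho>B R(1)] chart_dep[OF c\<rho>B R(4)] by auto
      show "R (\<rho> 0) \<noteq> 0" using R(2) g(4) c\<rho> by (simp add: chart_def)
      have "\<forall>\<^sub>F x in nhds 0. \<forall>j\<in>J. c j (\<rho> x) = (vmonom A (\<delta> j0) x * vmonom A (\<epsilon> j) x) ^ (d - j) * v j x"
        using cv by (intro eventually_ball_finite fJ) auto
      then show "\<forall>\<^sub>F x in nhds 0. f (\<rho> x) = vmonom A a' x * s x *
        ((\<Sum>j\<in>J. (vmonom A (\<delta> j0) x * vmonom A (\<epsilon> j) x) ^ (d - j) * v j x * x $ n ^ j) + x $ n ^ d * R (\<rho> x))"
        using chart_ev[OF c\<rho>B f] chart_ev[OF c\<rho>B gJ] s(4)
        by eventually_elim (simp add: \<rho>n)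
    qed (use s b0 y'0 in auto)
    then show ?thesis by (rule monomializable_comp[OF c\<rho>B l\<rho>])
  qed
qed

text \<open>Induction on the order \<open>d\<close>. A shift of \<open>x $ n\<close> by an implicitly defined function (Tschirnhausen
  transformation) first makes the Taylor coefficient of degree \<open>d - 1\<close> vanish.\<close>

lemma regular_case_all:
  assumes n: "(n::'n::finite) \<notin> A"
    and M: "\<And>f (z :: nat \<Rightarrow> complex^'n). hol_germ f \<Longrightarrow> depends_on A f \<Longrightarrow> \<not> (\<forall>\<^sub>F x in nhds 0. f x = 0) \<Longrightarrow> z \<longlonglongrightarrow> 0 \<Longrightarrow> monomializable A f z"
  shows "regular_case A n d"
proof (induction d rule: less_induct)
  case (less d)
  let ?B = "insert n A"
  have AB: "A \<subseteq> ?B" by auto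
  show ?case unfolding regular_case_def
  proof (intro allI impI)
    fix a and g f :: "complex^'n \<Rightarrow> complex" and z :: "nat \<Rightarrow> complex^'n"
    assume g: "hol_germ g" "depends_on ?B g" "\<forall>j<d. taylor_coeff n j g 0 = 0" "taylor_coeff n d g 0 \<noteq> 0"
      and z: "z \<longlonglongrightarrow> 0" and f: "\<forall>\<^sub>F x in nhds 0. f x = vmonom A a x * g x"
    show "monomializable ?B f z"
    proof (cases "d = 0")
      case True
      then have "g 0 \<noteq> 0" using g(4) by (simp add: taylor_coeff_def)
      then have "monom_unit ?B (\<lambda>x. vmonom A a x * g x)" using g by (intro monom_unit_mult monom_unit_vmonom monom_unit_unit) auto
      then have "monom_unit ?B f" by (rule monom_unit_cong[rotated]) (use f in \<open>auto elim: eventually_mono\<close>)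
      then show ?thesis using z monomializable_monom_unit by blast
    next
      case False
      \<comment> \<open>Its zero set is a graph over the hyperplane \<open>x $ n = 0\<close>, because \<open>g\<close> is regular of order \<open>d\<close>.\<close>
      define q where "q = (\<lambda>x. (deriv ^^ (d - 1)) (\<lambda>w. g (vec_upd x n w)) (x $ n))"
      have q: "hol_germ q" unfolding q_def by (rule hol_germ_higher_deriv(1)[OF g(1)])
      have dq: "depends_on ?B q" unfolding depends_on_def
      proof (intro allI impI)
        fix x y :: "complex^'n" assume *: "\<forall>i\<in>?B. x $ i = y $ i"
        then have "(\<lambda>w. g (vec_upd x n w)) = (\<lambda>w. g (vec_upd y n w))"
          by (intro ext depends_onD[OF g(2)]) auto
        then show "q x = q y" using * by (simp add: q_def)
      qed
      have q0: "q 0 = 0" using g(3) False by (simp add: q_def taylor_coeff_def)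
      have "(\<lambda>w. q (vec_upd 0 n w)) = (deriv ^^ (d - 1)) (\<lambda>w. g (vec_upd 0 n w))"
        by (simp add: q_def)
      then have "deriv (\<lambda>w. q (vec_upd 0 n w)) 0 = (deriv ^^ Suc (d - 1)) (\<lambda>w. g (vec_upd 0 n w)) 0"
        by simp
      then have dq0: "deriv (\<lambda>w. q (vec_upd 0 n w)) 0 \<noteq> 0"
        using g(4) False by (simp add: taylor_coeff_def)
      obtain h where h: "hol_germ h" "depends_on A h" "h 0 = 0" "\<forall>\<^sub>F x in nhds 0. q (vec_upd x n (h x)) = 0"
        by (rule implicit_function[OF q dq n q0 dq0])
      define p where "p = (\<lambda>x::complex^'n. vec_upd x n (x $ n + h x))"
      have cp: "chart ?B p" unfolding p_def
        by (intro chart_vec_upd hol_germ_add depends_on_add depends_on_coord depends_on_superset[OF h(2) AB]) (use h in auto)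
      define y where "y = (\<lambda>k. vec_upd (z k) n (z k $ n - h (z k)))"
      have y0: "y \<longlonglongrightarrow> 0" unfolding y_def
      proof (rule tendsto_vec_upd[OF z])
        have "(\<lambda>k. h (z k)) \<longlonglongrightarrow> 0"
          using filterlim_compose[OF hol_germ_tendsto0[OF h(1)] z] h(3) by simp
        from tendsto_diff[OF tendsto_vec_nth[OF z, of n] this]
        show "(\<lambda>k. z k $ n - h (z k)) \<longlonglongrightarrow> 0" by simp
      qed
      have ly: "lifts z p y"
        unfolding lifts_def using y0
        by (auto intro!: exI[of _ "\<lambda>k. k"] filterlim_ident simp: p_def y_def vec_eq_iff depends_on_vec_upd[OF h(2) n])
      define g1 where "g1 = (\<lambda>x. g (p x))"
      have g1u: "g1 (vec_upd x n w) = g (vec_upd x n (w + h x))" for x w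
        by (simp add: g1_def p_def depends_on_vec_upd[OF h(2) n])
      have g10: "taylor_coeff n j g1 0 = taylor_coeff n j g 0" for j
        by (simp add: taylor_coeff_def g1u h(3))
      obtain r G where r: "r > 0" "\<And>x. norm x < 2 * r \<Longrightarrow> (g has_derivative cdot (G x)) (at x)"
        using hol_germ_radius[OF g(1)] by metis
      have ev1: "\<forall>\<^sub>F x in nhds 0. norm (h x) < r"
        using hol_germ_tendsto0[OF h(1)] h(3) r(1) by (auto dest!: tendstoD[where e=r] simp: dist_norm)
      have red: "\<forall>\<^sub>F x in nhds 0. taylor_coeff n (d - 1) g1 x = 0"
        using ev1 eventually_norm_less[OF r(1)] h(4)
      proof eventually_elim
        case (elim x)
        let ?T = "ball 0 (2 * r - norm x)"
        have "(deriv ^^ (d - 1)) (\<lambda>w. g (vec_upd x n (1 * w + h x))) 0 =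
            1 ^ (d - 1) * (deriv ^^ (d - 1)) (\<lambda>w. g (vec_upd x n w)) (1 * 0 + h x)"
        proof (rule higher_deriv_compose_linear'[where T = ?T and S = "(\<lambda>w. 1 * w + h x) -` ?T"])
          show "(\<lambda>w. g (vec_upd x n w)) holomorphic_on ?T" by (rule holomorphic_vec_upd[OF r(2)])
          show "open ((\<lambda>w. 1 * w + h x) -` ?T)" by (intro open_vimage continuous_intros) auto
        qed (use elim in auto)
        then show ?case using elim(3) by (simp add: taylor_coeff_def g1u q_def)
      qed
      have fp: "\<forall>\<^sub>F x in nhds 0. f (p x) = vmonom A a x * g1 x"
        using chart_ev[OF cp f]
        by eventually_elim (simp add: g1_def p_def depends_on_vec_upd[OF depends_on_vmonom n])
      have hg1: "hol_germ g1" and dg1: "depends_on ?B g1"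
        unfolding g1_def using chart_hol[OF cp g(1)] chart_dep[OF cp g(2)] by auto
      have "monomializable ?B (\<lambda>x. f (p x)) y"
        by (rule monomialize_depressed[OF n less.IH M _ hg1 dg1 _ _ red y0 fp])
          (use g False in \<open>simp_all add: g10\<close>)
      then show ?thesis by (rule monomializable_comp[OF cp ly])
    qed
  qed
qed

text \<open>Every nonzero germ can be monomialized along every sequence tending to the origin. The induction is on
  the number of variables; a linear change of coordinates makes the germ regular in the
  last one.\<close>

lemma monomialization:
  fixes f :: "complex^'n \<Rightarrow> complex"
  assumes "hol_germ f" "depends_on A f" "\<not> (\<forall>\<^sub>F x in nhds 0. f x = 0)" "z \<longlonglongrightarrow> 0"
  shows "monomializable A f z"
  using finite[of A] assms
proof (induction A arbitrary: f z rule: finite_induct)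
  case empty
  have c: "f x = f 0" for x by (rule depends_onD[OF empty(2)]) simp
  then have "f 0 \<noteq> 0" using empty(3) by (metis (mono_tags, lifting) always_eventually)
  then show ?case using empty monom_unit_unit monomializable_monom_unit by blast
next
  case (insert n A)
  let ?B = "insert n A"
  have regular_case: "regular_case A n d" for d using insert regular_case_all by blast
  obtain r G where r: "r > 0" "\<And>x. norm x < 2 * r \<Longrightarrow> (f has_derivative cdot (G x)) (at x)"
    using hol_germ_radius[OF insert.prems(1)] by metis
  \<comment> \<open>The extra factor \<open>x $ n\<close> provides a point \<open>P\<close> off the hyperplane \<open>x $ n = 0\<close>, so that \<open>P\<close> can serve as the image of the \<open>n\<close>-th unit vector.\<close>
  have "\<not> (\<forall>\<^sub>F x in nhds 0. x $ n * f x = 0)"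
    using hol_germ_mult_eq_0[OF hol_germ_coord insert.prems(1), of n] insert.prems(3) vmonom_not_eventually_0[of "{n}" "\<lambda>_. 1"]
    by (auto simp: vmonom_def)
  then obtain p0 where p0: "norm p0 < 2 * r" "p0 $ n * f p0 \<noteq> 0"
    using eventually_mono[OF eventually_norm_less[of "2 * r"], of "\<lambda>x. x $ n * f x = 0"] r(1) by auto
  define P where "P = vec_restr ?B p0"
  have fP: "f P \<noteq> 0" and Pn: "P $ n \<noteq> 0"
    using p0(2) depends_onD[OF insert.prems(2), of P p0] by (auto simp: P_def)
  have "norm P \<le> norm p0" unfolding P_def by (rule norm_le_componentwise_cart) simp
  then have nP: "norm P < 2 * r" using p0 by simp
  define p where "p = (\<lambda>x::complex^'n. \<chi> i. if i = n then P $ n * x $ n else x $ i + P $ i * x $ n)"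
  have cp: "chart ?B p"
  proof -
    have "hol_germ (\<lambda>x. p x $ i)" for i by (cases "i = n") (auto simp: p_def)
    moreover have "depends_on ?B (\<lambda>x. p x $ i)" if "i \<in> ?B" for i
      using that by (cases "i = n") (auto simp: p_def intro!: depends_on_mult depends_on_add depends_on_coord)
    ultimately show ?thesis by (auto simp: chart_def p_def vec_eq_iff P_def)
  qed
  define y where "y = (\<lambda>k. (\<chi> i. if i = n then z k $ n / P $ n else z k $ i - P $ i * (z k $ n / P $ n)))"
  have y0: "y \<longlonglongrightarrow> 0"
  proof (rule vec_tendstoI)
    fix i
    have zi: "(\<lambda>k. z k $ i) \<longlonglongrightarrow> 0" for i using tendsto_vec_nth[OF insert.prems(4), of i] by simp
    have zn: "(\<lambda>k. z k $ n / P $ n) \<longlonglongrightarrow> 0" using tendsto_divide[OF zi tendsto_const Pn] by simp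
    show "(\<lambda>k. y k $ i) \<longlonglongrightarrow> 0 $ i"
      using zn tendsto_diff[OF zi tendsto_mult[OF tendsto_const zn], of i "P $ i"]
      by (cases "i = n") (simp_all add: y_def)
  qed
  have ly: "lifts z p y"
    unfolding lifts_def using y0 Pn
    by (auto intro!: exI[of _ "\<lambda>k. k"] filterlim_ident simp: p_def y_def vec_eq_iff)
  define g where "g = (\<lambda>x. f (p x))"
  have hg: "hol_germ g" and dg: "depends_on ?B g"
    unfolding g_def using chart_hol[OF cp] chart_dep[OF cp] insert.prems by auto
  have gu: "g (vec_upd 0 n w) = f (\<chi> i. 0 $ i + w * P $ i)" for w
  proof -
    have "p (vec_upd 0 n w) = (\<chi> i. 0 $ i + w * P $ i)" by (simp add: p_def vec_eq_iff)
    then show ?thesis by (simp add: g_def)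
  qed
  have "\<exists>d. taylor_coeff n d g 0 \<noteq> 0"
  proof (rule ccontr)
    assume "\<not> ?thesis"
    then have der: "(deriv ^^ d) (\<lambda>w. f (\<chi> i. 0 $ i + w * P $ i)) 0 = 0" for d
      by (simp add: taylor_coeff_def gu)
    define L where "L = (\<lambda>w. (\<chi> i. 0 $ i + w * P $ i))"
    have L: "L 1 = P" "L 0 = 0" by (simp_all add: vec_eq_iff L_def)
    have S: "(\<lambda>w. f (L w)) holomorphic_on {w. norm (L w) < 2 * r}" "open {w. norm (L w) < 2 * r}"
      "connected {w. norm (L w) < 2 * r}"
      unfolding L_def using holomorphic_line[OF r(2), where p = 0 and q = P] by (auto intro: convex_connected)
    have der': "(deriv ^^ d) (\<lambda>w. f (L w)) 0 = 0" for d unfolding L_def by (rule der)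
    have "f (L 1) = 0"
      by (rule holomorphic_fun_eq_0_on_connected[OF S der'])
        (use nP r(1) L in auto)
    then show False using fP unfolding L by simp
  qed
  then obtain d where d: "taylor_coeff n d g 0 \<noteq> 0" "\<And>j. j < d \<Longrightarrow> taylor_coeff n j g 0 = 0"
    using exists_least_iff[of "\<lambda>j. taylor_coeff n j g 0 \<noteq> 0"] by blast
  have "monomializable ?B g y"
    by (rule regular_caseD[OF regular_case hg dg d(2,1) y0, where a = "\<lambda>_. 0"]) (auto simp: vmonom_def)
  then show ?case unfolding g_def by (rule monomializable_comp[OF cp ly])
qed

section \<open>The Lojasiewicz gradient inequality\<close>

text \<open>The gradient inequality along a subsequence. For a monomial of degree \<open>N\<close> times a unit, the
  logarithmic derivative in the smallest of the occurring coordinates yields the exponent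
  \<open>1 - 1 / N\<close>; the chain rule transports the inequality through the chart because the chart has
  bounded derivative near the origin. If \<open>f\<close> vanishes identically, then the left-hand side is
  \<open>0 powr 0 = 0\<close>.\<close>

lemma lojasiewicz_complex:
  fixes f :: "complex^'n \<Rightarrow> complex" and z :: "nat \<Rightarrow> complex^'n"
  assumes f: "hol_grad f G" and f0: "f 0 = 0" and z: "z \<longlonglongrightarrow> 0"
  obtains c \<theta> \<sigma> where "c > 0" "0 \<le> \<theta>" "\<theta> < 1" "filterlim \<sigma> at_top sequentially"
    "\<And>k K. (\<And>i. norm (G (z (\<sigma> k)) $ i) \<le> K) \<Longrightarrow> c * norm (f (z (\<sigma> k))) powr \<theta> \<le> K"
proof (cases "\<forall>\<^sub>F x in nhds 0. f x = 0")
  case True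
  then have "\<forall>\<^sub>F k in sequentially. f (z k) = 0" using z by (rule eventually_compose_filterlim)
  then obtain N where N: "\<And>k. k \<ge> N \<Longrightarrow> f (z k) = 0" by (auto simp: eventually_sequentially)
  show thesis
  proof (rule that[of 1 0 "\<lambda>k. k + N"])
    show "filterlim (\<lambda>k. k + N) at_top sequentially" by (rule filterlim_add_const_nat_at_top)
    fix k K assume K: "\<And>i. norm (G (z (k + N)) $ i) \<le> K"
    show "1 * norm (f (z (k + N))) powr 0 \<le> K"
      using N[of "k + N"] order_trans[OF norm_ge_zero K[of undefined]] by simp
  qed auto
next
  case False
  have "monomializable UNIV f z"
    by (rule monomialization[OF hol_germI[OF f] _ False z]) (simp add: depends_on_def vec_eq_iff[symmetric])
  then obtain p y where p: "chart UNIV p" "lifts z p y" "monom_unit UNIV (\<lambda>x. f (p x))" by (auto simp: monomializable_def)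
  then obtain b u where u: "hol_germ u" "u 0 \<noteq> 0" and ev: "\<forall>\<^sub>F x in nhds 0. f (p x) = vmonom UNIV b x * u x"
    by (auto simp: monom_unit_def)
  obtain H where H: "\<And>i. hol_grad (\<lambda>x. p x $ i) (H i)"
  proof -
    have "\<forall>i. \<exists>h. hol_grad (\<lambda>x. p x $ i) h" using p(1) by (auto simp: chart_def hol_germ_def)
    then show thesis using that unfolding choice_iff by blast
  qed
  obtain U where U: "hol_grad u U" using u by (auto simp: hol_germ_def)
  have p0: "p 0 = 0" using p(1) by (simp add: chart_def)
  define \<Gamma> where "\<Gamma> = (\<lambda>x. \<chi> k. \<Sum>i\<in>UNIV. G (p x) $ i * H i x $ k)"
  have "hol_grad (\<lambda>x. f (p x)) \<Gamma>" unfolding \<Gamma>_def by (rule hol_grad_comp[OF f H p0])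
  then have gF: "hol_grad (\<lambda>x. vmonom UNIV b x * u x) \<Gamma>" by (rule hol_grad_cong[OF ev])
  define N where "N = (\<Sum>i\<in>UNIV. b i)"
  have mb0: "vmonom UNIV b 0 = 0" using eventually_nhds_x_imp_x[OF ev] p0 f0 u(2) by simp
  then obtain i0 where i0: "b i0 > 0" by (auto simp: vmonom_eq_0)
  have Npos: "N > 0" unfolding N_def using i0 by (metis UNIV_I finite_class.finite_UNIV sum_pos2 zero_le)
  define \<theta> where "\<theta> = 1 - 1 / real N"
  have th: "0 \<le> \<theta>" "\<theta> < 1" using Npos by (auto simp: \<theta>_def)
  \<comment> \<open>Euler field \<open>x $ k * \<partial>\<^sub>k\<close> applied to a monomial times a unit.\<close>
  have logder: "x $ k * \<Gamma> x $ k = vmonom UNIV b x * (of_nat (b k) * u x + x $ k * U x $ k)"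
    if "((\<lambda>x. vmonom UNIV b x * u x) has_derivative cdot (\<Gamma> x)) (at x)" "(u has_derivative cdot (U x)) (at x)" for x k
  proof -
    define m where "m = (\<Prod>i\<in>UNIV - {k}. x $ i ^ b i)"
    have vmonom: "vmonom UNIV b (vec_upd x k w) = w ^ b k * m" for w
    proof -
      have "vmonom UNIV b (vec_upd x k w) = vec_upd x k w $ k ^ b k * (\<Prod>i\<in>UNIV - {k}. vec_upd x k w $ i ^ b i)"
        unfolding vmonom_def by (rule prod.remove) auto
      also have "(\<Prod>i\<in>UNIV - {k}. vec_upd x k w $ i ^ b i) = m" unfolding m_def by (intro prod.cong) auto
      finally show ?thesis by simp
    qed
    have d1: "((\<lambda>w. vmonom UNIV b (vec_upd x k w) * u (vec_upd x k w)) has_field_derivative \<Gamma> x $ k) (at (x $ k))"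
      by (rule has_field_derivative_vec_upd) (use that in simp)
    have "((\<lambda>w. u (vec_upd x k w)) has_field_derivative U x $ k) (at (x $ k))"
      by (rule has_field_derivative_vec_upd) (use that in simp)
    from DERIV_mult[OF DERIV_cmult_right[OF DERIV_power[OF DERIV_ident, of "b k"]] this]
    have d2: "((\<lambda>w. w ^ b k * m * u (vec_upd x k w)) has_field_derivative
       of_nat (b k) * (1 * (x $ k) ^ (b k - Suc 0)) * m * u x + U x $ k * ((x $ k) ^ b k * m)) (at (x $ k))"
      by simp
    have "\<Gamma> x $ k = of_nat (b k) * (1 * (x $ k) ^ (b k - Suc 0)) * m * u x + U x $ k * ((x $ k) ^ b k * m)"
      by (rule DERIV_unique[OF d1]) (use d2 in \<open>simp add: vmonom\<close>)
    moreover have "vmonom UNIV b x = (x $ k) ^ b k * m" using vmonom[of "x $ k"] by simp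
    ultimately show ?thesis
      by (cases "b k") (simp_all add: algebra_simps)
  qed
  define C1 where "C1 = norm (u 0) + 1"
  define c1 where "c1 = norm (u 0) / 2"
  define C2 where "C2 = Max (range (\<lambda>(i, k). norm (H i 0 $ k))) + 1"
  have C2: "norm (H i 0 $ k) < C2" for i k
  proof -
    have "norm (H i 0 $ k) \<le> Max (range (\<lambda>(i, k). norm (H i 0 $ k)))"
      by (rule Max_ge) auto
    then show ?thesis by (simp add: C2_def)
  qed
  have c1: "c1 > 0" "C1 > 0" using u(2) by (auto simp: c1_def C1_def add_nonneg_pos)
  have C2pos: "C2 > 0" using C2[of undefined undefined] norm_ge_zero order_le_less_trans by blast
  have limH: "((\<lambda>x. H i x $ k) \<longlongrightarrow> H i 0 $ k) (nhds 0)" for i k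
    using isCont_vec_nth[OF hol_gradD0(1)[OF H[of i]], of k] by (metis isCont_def tendsto_at_iff_tendsto_nhds)
  have limU: "((\<lambda>x. x $ k * U x $ k) \<longlongrightarrow> 0) (nhds 0)" for k
  proof -
    have "((\<lambda>x. U x $ k) \<longlongrightarrow> U 0 $ k) (nhds 0)"
      using isCont_vec_nth[OF hol_gradD0(1)[OF U], of k] by (metis isCont_def tendsto_at_iff_tendsto_nhds)
    from tendsto_mult[OF tendsto_vec_nth[OF filterlim_ident, where i = k] this]
    show ?thesis by simp
  qed
  have limu: "((\<lambda>x. norm (u x)) \<longlongrightarrow> norm (u 0)) (nhds 0)"
    by (intro tendsto_norm hol_germ_tendsto0 u)
  have e1: "\<forall>\<^sub>F x in nhds 0. norm (u x) < C1" using limu by (rule order_tendstoD) (simp add: C1_def)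
  have e2: "\<forall>\<^sub>F x in nhds 0. c1 < norm (u x)" using limu by (rule order_tendstoD) (use u in \<open>simp add: c1_def\<close>)
  have e3: "\<forall>\<^sub>F x in nhds 0. \<forall>k. norm (x $ k * U x $ k) < c1 / 2"
  proof (intro eventually_all_finite)
    fix k show "\<forall>\<^sub>F x in nhds 0. norm (x $ k * U x $ k) < c1 / 2"
      using tendsto_norm[OF limU[of k]] by (rule order_tendstoD) (use c1 in simp)
  qed
  have e4: "\<forall>\<^sub>F x in nhds 0. \<forall>i k. norm (H i x $ k) < C2"
  proof (intro eventually_all_finite)
    fix i k show "\<forall>\<^sub>F x in nhds 0. norm (H i x $ k) < C2"
      using tendsto_norm[OF limH[of i k]] by (rule order_tendstoD) (rule C2)
  qed
  have e5: "\<forall>\<^sub>F x in nhds (0::complex^'n). norm x < 1" by (rule eventually_norm_less) simp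
  define c where "c = c1 / 2 / (C1 powr \<theta> * (real CARD('n) * C2))"
  have cpos: "c > 0" using c1 C2pos by (simp add: c_def)
  have key: "\<forall>\<^sub>F x in nhds 0. \<forall>K. (\<forall>i. norm (G (p x) $ i) \<le> K) \<longrightarrow> c * norm (f (p x)) powr \<theta> \<le> K"
    using ev gF[unfolded hol_grad_def] U[unfolded hol_grad_def] e1 e2 e3 e4 e5
  proof eventually_elim
    case (elim x)
    show ?case
    proof (intro allI impI)
      fix K assume K: "\<forall>i. norm (G (p x) $ i) \<le> K"
      have K0: "K \<ge> 0" using K norm_ge_zero order_trans by blast
      show "c * norm (f (p x)) powr \<theta> \<le> K"
      proof (cases "vmonom UNIV b x = 0")
        case True
        then show ?thesis using elim(1) K0 by simp
      next
        case False
        define S where "S = {i. b i > 0}"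
        \<comment> \<open>The smallest coordinate occurring in the monomial satisfies \<open>norm (x $ k) ^ N \<le> norm (vmonom UNIV b x)\<close>.\<close>
        obtain k where k: "k \<in> S" "\<And>i. i \<in> S \<Longrightarrow> norm (x $ k) \<le> norm (x $ i)"
          using ex_min_if_finite[of "(\<lambda>i. norm (x $ i)) ` S"] i0
          by (metis (no_types, lifting) S_def arg_min_if_finite(1) arg_min_least empty_iff finite mem_Collect_eq)
        have xk: "x $ k \<noteq> 0" using False k(1) unfolding vmonom_eq_0 S_def by blast
        have "norm (x $ k) ^ N = (\<Prod>i\<in>UNIV. norm (x $ k) ^ b i)" by (simp add: N_def power_sum)
        also have "\<dots> \<le> (\<Prod>i\<in>UNIV. norm (x $ i) ^ b i)"
        proof (rule prod_mono)
          fix i show "0 \<le> norm (x $ k) ^ b i \<and> norm (x $ k) ^ b i \<le> norm (x $ i) ^ b i"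
            using k(2)[of i] by (cases "b i = 0") (auto simp: S_def power_mono)
        qed
        also have "\<dots> = norm (vmonom UNIV b x)" by (simp add: vmonom_def prod_norm[symmetric] norm_power)
        finally have le: "norm (x $ k) ^ N \<le> norm (vmonom UNIV b x)" .
        define \<mu> where "\<mu> = norm (vmonom UNIV b x)"
        have mupos: "\<mu> > 0" using False by (simp add: \<mu>_def)
        have "norm (x $ k) = (norm (x $ k) ^ N) powr (1 / real N)"
          using xk Npos by (simp add: powr_realpow[symmetric] powr_powr)
        also have "\<dots> \<le> \<mu> powr (1 / real N)"
          using le by (intro powr_mono2) (auto simp: \<mu>_def)
        finally have xle: "norm (x $ k) \<le> \<mu> powr (1 / real N)" .
        have "norm (of_nat (b k) * u x + x $ k * U x $ k) \<ge> norm (of_nat (b k) * u x) - norm (x $ k * U x $ k)"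
          using norm_triangle_ineq4 norm_diff_ineq by (metis add.commute)
        moreover have "norm (of_nat (b k) * u x) \<ge> c1"
        proof -
          have "1 * norm (u x) \<le> real (b k) * norm (u x)"
            using k(1) by (intro mult_right_mono) (auto simp: S_def)
          then show ?thesis using elim(5) by (simp add: norm_mult)
        qed
        ultimately have low: "norm (of_nat (b k) * u x + x $ k * U x $ k) \<ge> c1 / 2"
          using elim(6) by (smt (verit) field_sum_of_halves)
        have "norm (x $ k) * norm (\<Gamma> x $ k) = \<mu> * norm (of_nat (b k) * u x + x $ k * U x $ k)"
          using logder[of x k] elim(2,3) by (metis \<mu>_def norm_mult)
        also have "\<dots> \<ge> \<mu> * (c1 / 2)" using low mupos by (intro mult_left_mono) auto
        finally have "\<mu> * (c1 / 2) \<le> norm (x $ k) * norm (\<Gamma> x $ k)" .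
        also have "\<dots> \<le> \<mu> powr (1 / real N) * norm (\<Gamma> x $ k)"
          using xle by (intro mult_right_mono) auto
        finally have 1: "\<mu> * (c1 / 2) \<le> \<mu> powr (1 / real N) * norm (\<Gamma> x $ k)" .
        have split: "\<mu> = \<mu> powr (1 / real N) * \<mu> powr \<theta>"
          using mupos by (simp add: powr_add[symmetric] \<theta>_def)
        have "\<mu> powr (1 / real N) * (\<mu> powr \<theta> * (c1 / 2)) \<le> \<mu> powr (1 / real N) * norm (\<Gamma> x $ k)"
          using 1 split by (metis mult.assoc)
        then have 2: "\<mu> powr \<theta> * (c1 / 2) \<le> norm (\<Gamma> x $ k)"
          using mupos by simp
        have "norm (\<Gamma> x $ k) \<le> (\<Sum>i\<in>UNIV. norm (G (p x) $ i * H i x $ k))"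
          unfolding \<Gamma>_def by (simp add: norm_sum)
        also have "\<dots> \<le> (\<Sum>i\<in>(UNIV::'n set). K * C2)"
          unfolding norm_mult using K elim(7) K0
          by (intro sum_mono mult_mono) (auto intro: less_imp_le)
        also have "\<dots> = real CARD('n) * C2 * K" by simp
        finally have 3: "norm (\<Gamma> x $ k) \<le> real CARD('n) * C2 * K" .
        have "norm (f (p x)) \<le> \<mu> * C1"
          using elim(1,4) by (simp add: norm_mult \<mu>_def mult_left_mono)
        then have "norm (f (p x)) powr \<theta> \<le> (\<mu> * C1) powr \<theta>"
          using th by (intro powr_mono2) auto
        also have "\<dots> = \<mu> powr \<theta> * C1 powr \<theta>" using mupos c1 by (simp add: powr_mult)
        finally have 4: "norm (f (p x)) powr \<theta> \<le> \<mu> powr \<theta> * C1 powr \<theta>" .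
        have "c * norm (f (p x)) powr \<theta> \<le> c * (\<mu> powr \<theta> * C1 powr \<theta>)"
          using 4 cpos by (intro mult_left_mono) auto
        also have "\<dots> = \<mu> powr \<theta> * (c1 / 2) / (real CARD('n) * C2)"
          using c1 by (simp add: c_def)
        also have "\<dots> \<le> K"
          using order_trans[OF 2 3] C2pos by (simp add: divide_simps mult_ac)
        finally show ?thesis .
      qed
    qed
  qed
  obtain \<sigma> where s: "filterlim \<sigma> at_top sequentially" "\<And>k. p (y k) = z (\<sigma> k)" and y: "y \<longlonglongrightarrow> 0"
    using p(2) by (auto simp: lifts_def)
  obtain M where M: "\<And>k. k \<ge> M \<Longrightarrow> \<forall>K. (\<forall>i. norm (G (p (y k)) $ i) \<le> K) \<longrightarrow> c * norm (f (p (y k))) powr \<theta> \<le> K"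
    using eventually_compose_filterlim[OF key y] by (auto simp: eventually_sequentially)
  show thesis
  proof (rule that[OF cpos th])
    show "filterlim (\<lambda>k. \<sigma> (k + M)) at_top sequentially"
      using filterlim_compose[OF s(1) filterlim_add_const_nat_at_top] .
    show "c * norm (f (z (\<sigma> (k + M)))) powr \<theta> \<le> K" if "\<And>i. norm (G (z (\<sigma> (k + M))) $ i) \<le> K" for k K
      using M[of "k + M"] that by (simp add: s(2))
  qed
qed

section \<open>Real analytic functions\<close>

definition cvec :: "real^'n \<Rightarrow> complex^'n" where
  "cvec x = (\<chi> i. complex_of_real (x $ i))"

lemma cvec_nth [simp]: "cvec x $ i = of_real (x $ i)" by (simp add: cvec_def)
lemma cvec_0 [simp]: "cvec 0 = 0" by (simp add: vec_eq_iff)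

lemma cvec_tendsto: "(x \<longlongrightarrow> l) F \<Longrightarrow> ((\<lambda>k. cvec (x k)) \<longlongrightarrow> cvec l) F"
  by (rule vec_tendstoI) (simp add: tendsto_of_real tendsto_vec_nth)

lemma cvec_lim0: "filterlim cvec (nhds (0::complex^'n)) (nhds 0)"
  using cvec_tendsto[OF filterlim_ident, of 0] by simp

text \<open>Real analyticity at the origin, expressed by a holomorphic extension.\<close>

definition real_analytic0 :: "(real^'n \<Rightarrow> real) \<Rightarrow> bool" where
  "real_analytic0 f \<longleftrightarrow> (\<exists>F. hol_germ F \<and> (\<forall>\<^sub>F x in nhds 0. F (cvec x) = of_real (f x)))"

lemma real_analytic0_const: "real_analytic0 (\<lambda>x. c)"
  unfolding real_analytic0_def by (intro exI[of _ "\<lambda>_. of_real c"]) simp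

lemma real_analytic0_coord: "real_analytic0 (\<lambda>x. x $ i)"
  unfolding real_analytic0_def by (intro exI[of _ "\<lambda>x. x $ i"]) simp

lemma real_analytic0_add:
  assumes "real_analytic0 f" "real_analytic0 g" shows "real_analytic0 (\<lambda>x. f x + g x)"
proof -
  obtain F G where F: "hol_germ F" "\<forall>\<^sub>F x in nhds 0. F (cvec x) = of_real (f x)"
    and G: "hol_germ G" "\<forall>\<^sub>F x in nhds 0. G (cvec x) = of_real (g x)"
    using assms by (auto simp: real_analytic0_def)
  have "\<forall>\<^sub>F x in nhds 0. F (cvec x) + G (cvec x) = of_real (f x + g x)"
    using F(2) G(2) by eventually_elim simp
  then show ?thesis unfolding real_analytic0_def using hol_germ_add[OF F(1) G(1)] by blast
qed

lemma real_analytic0_mult: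
  assumes "real_analytic0 f" "real_analytic0 g" shows "real_analytic0 (\<lambda>x. f x * g x)"
proof -
  obtain F G where F: "hol_germ F" "\<forall>\<^sub>F x in nhds 0. F (cvec x) = of_real (f x)"
    and G: "hol_germ G" "\<forall>\<^sub>F x in nhds 0. G (cvec x) = of_real (g x)"
    using assms by (auto simp: real_analytic0_def)
  have "\<forall>\<^sub>F x in nhds 0. F (cvec x) * G (cvec x) = of_real (f x * g x)"
    using F(2) G(2) by eventually_elim simp
  then show ?thesis unfolding real_analytic0_def using hol_germ_mult[OF F(1) G(1)] by blast
qed

lemma real_analytic0_sum: "(\<And>i. i \<in> I \<Longrightarrow> real_analytic0 (f i)) \<Longrightarrow> real_analytic0 (\<lambda>x. \<Sum>i\<in>I. f i x)"
  by (induction I rule: infinite_finite_induct) (auto intro: real_analytic0_const real_analytic0_add)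

lemma real_analytic0_tendsto0:
  assumes "real_analytic0 f" shows "(f \<longlongrightarrow> f 0) (nhds 0)"
proof -
  obtain F where F: "hol_germ F" "\<forall>\<^sub>F x in nhds 0. F (cvec x) = of_real (f x)"
    using assms by (auto simp: real_analytic0_def)
  have "((\<lambda>x. F (cvec x)) \<longlongrightarrow> F 0) (nhds 0)"
    by (rule filterlim_compose[OF hol_germ_tendsto0[OF F(1)] cvec_lim0])
  moreover have "F 0 = of_real (f 0)" using eventually_nhds_x_imp_x[OF F(2)] by simp
  ultimately have "((\<lambda>x. complex_of_real (f x)) \<longlongrightarrow> of_real (f 0)) (nhds 0)"
    using F(2) by (simp add: tendsto_cong)
  then show ?thesis by (simp add: tendsto_of_real_iff)
qed

lemma real_analytic0_compose:
  assumes f: "real_analytic0 f" and S: "open S" "of_real (f 0) \<in> S" and h: "h holomorphic_on S"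
    and hr: "\<And>t. of_real t \<in> S \<Longrightarrow> h (of_real t) = of_real (k t)"
  shows "real_analytic0 (\<lambda>x. k (f x))"
proof -
  obtain F where F: "hol_germ F" "\<forall>\<^sub>F x in nhds 0. F (cvec x) = of_real (f x)"
    using f by (auto simp: real_analytic0_def)
  have F0: "F 0 = of_real (f 0)" using eventually_nhds_x_imp_x[OF F(2)] by simp
  have "((\<lambda>x. complex_of_real (f x)) \<longlongrightarrow> of_real (f 0)) (nhds 0)"
    by (intro tendsto_of_real real_analytic0_tendsto0 f)
  then have "\<forall>\<^sub>F x in nhds 0. complex_of_real (f x) \<in> S" using S by (simp add: tendsto_def)
  then have "\<forall>\<^sub>F x in nhds 0. h (F (cvec x)) = of_real (k (f x))"
    using F(2) by eventually_elim (simp add: hr)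
  moreover have "hol_germ (\<lambda>x. h (F x))" by (rule hol_germ_comp1[OF F(1) S(1) _ h]) (simp add: F0 S)
  ultimately show ?thesis unfolding real_analytic0_def by blast
qed

lemma real_analytic0_linear:
  fixes l :: "real^'n \<Rightarrow> real"
  assumes "linear l" shows "real_analytic0 l"
proof -
  have "l x = (\<Sum>i\<in>UNIV. x $ i * l (axis i 1))" for x
  proof -
    have "l (\<Sum>i\<in>UNIV. x $ i *\<^sub>R axis i 1) = (\<Sum>i\<in>UNIV. x $ i * l (axis i 1))"
      by (simp add: linear_sum[OF assms] linear_cmul[OF assms])
    moreover have "(\<Sum>i\<in>UNIV. x $ i *\<^sub>R axis i 1) = x"
      by (simp add: vec_eq_iff axis_def if_distrib sum.delta cong: if_cong)
    ultimately show ?thesis by simp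
  qed
  then have "l = (\<lambda>x. \<Sum>i\<in>UNIV. x $ i * l (axis i 1))" by (rule ext)
  moreover have "real_analytic0 (\<lambda>x. \<Sum>i\<in>UNIV. x $ i * l (axis i 1))"
    by (intro real_analytic0_sum real_analytic0_mult real_analytic0_coord real_analytic0_const)
  ultimately show ?thesis by simp
qed

text \<open>The bound \<open>K\<close> may be any number dominating those partial derivatives that exist; near the origin all
  of them exist.\<close>

lemma lojasiewicz_real:
  fixes f :: "real^'n \<Rightarrow> real" and x :: "nat \<Rightarrow> real^'n"
  assumes f: "real_analytic0 f" and x: "x \<longlonglongrightarrow> 0"
  obtains c \<theta> \<sigma> where "c > 0" "0 \<le> \<theta>" "\<theta> < 1" "filterlim \<sigma> at_top sequentially"
    "\<And>k K. (\<And>i d. ((\<lambda>t. f (x (\<sigma> k) + t *\<^sub>R axis i 1)) has_real_derivative d) (at 0) \<Longrightarrow> \<bar>d\<bar> \<le> K) \<Longrightarrow>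
       c * \<bar>f (x (\<sigma> k)) - f 0\<bar> powr \<theta> \<le> K"
proof -
  obtain F where F: "hol_germ F" "\<forall>\<^sub>F x in nhds 0. F (cvec x) = of_real (f x)"
    using f by (auto simp: real_analytic0_def)
  have F0: "F 0 = of_real (f 0)" using eventually_nhds_x_imp_x[OF F(2)] by simp
  obtain G where G: "hol_grad F G" using F(1) by (auto simp: hol_germ_def)
  have G': "hol_grad (\<lambda>x. F x - F 0) G"
    using G unfolding hol_grad_def
    by eventually_elim (auto intro!: derivative_eq_intros)
  have F2: "\<forall>\<^sub>F x in nhds 0. \<forall>\<^sub>F y in nhds x. F (cvec y) = of_real (f y)"
    using F(2) by (simp add: eventually_eventually)
  have evd: "\<forall>\<^sub>F x in nhds 0. \<forall>i. ((\<lambda>t. f (x + t *\<^sub>R axis i 1)) has_real_derivative Re (G (cvec x) $ i)) (at 0) \<and>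
      Im (G (cvec x) $ i) = 0"
    using eventually_compose_filterlim[OF G[unfolded hol_grad_def] cvec_lim0] F2
  proof eventually_elim
    case (elim x)
    show ?case
    proof
      fix i
      have u: "vec_upd (cvec x) i (of_real (x $ i)) = cvec x" by (simp add: vec_eq_iff)
      have "(F has_derivative cdot (G (cvec x))) (at (vec_upd (cvec x) i (of_real (x $ i))))" using elim by (simp add: u)
      from has_field_derivative_vec_upd[OF this]
      have 1: "((\<lambda>w. F (vec_upd (cvec x) i w)) has_field_derivative G (cvec x) $ i) (at (of_real (x $ i)))" by simp
      have 2: "((\<lambda>t. complex_of_real (x $ i + t)) has_vector_derivative 1) (at 0)"
        by (auto intro!: derivative_eq_intros simp: has_vector_derivative_def scaleR_conv_of_real)
      have 3: "((\<lambda>t. F (vec_upd (cvec x) i (of_real (x $ i + t)))) has_vector_derivative G (cvec x) $ i) (at 0)"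
        using field_vector_diff_chain_at[OF 2, of "\<lambda>w. F (vec_upd (cvec x) i w)" "G (cvec x) $ i"] 1 by (simp add: o_def)
      have "((\<lambda>t. x + t *\<^sub>R axis i 1) \<longlongrightarrow> x + 0 *\<^sub>R axis i 1) (nhds 0)"
        by (intro tendsto_intros filterlim_ident)
      then have "filterlim (\<lambda>t. x + t *\<^sub>R axis i 1) (nhds x) (nhds 0)" by simp
      from eventually_compose_filterlim[OF elim(2) this]
      have ev: "\<forall>\<^sub>F t in nhds 0. F (vec_upd (cvec x) i (of_real (x $ i + t))) = of_real (f (x + t *\<^sub>R axis i 1))"
      proof eventually_elim
        case (elim t)
        have "cvec (x + t *\<^sub>R axis i 1) = vec_upd (cvec x) i (of_real (x $ i + t))"
          by (simp add: vec_eq_iff axis_def)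
        then show ?case using elim by simp
      qed
      have 4: "((\<lambda>t. complex_of_real (f (x + t *\<^sub>R axis i 1))) has_vector_derivative G (cvec x) $ i) (at 0)"
        by (rule iffD1[OF has_vector_derivative_cong_ev 3])
          (use ev eventually_nhds_x_imp_x[OF ev] in \<open>auto elim: eventually_mono\<close>)
      from bounded_linear.has_vector_derivative[OF bounded_linear_Re 4] bounded_linear.has_vector_derivative[OF bounded_linear_Im 4]
      have 5: "((\<lambda>t. f (x + t *\<^sub>R axis i 1)) has_vector_derivative Re (G (cvec x) $ i)) (at 0)"
        "((\<lambda>t. 0::real) has_vector_derivative Im (G (cvec x) $ i)) (at 0)" by simp_all
      have "Im (G (cvec x) $ i) = 0"
        using vector_derivative_unique_at[OF 5(2) has_vector_derivative_const] .
      then show "((\<lambda>t. f (x + t *\<^sub>R axis i 1)) has_real_derivative Re (G (cvec x) $ i)) (at 0) \<and> Im (G (cvec x) $ i) = 0"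
        using 5(1) by (simp add: has_real_derivative_iff_has_vector_derivative)
    qed
  qed
  have lz: "(\<lambda>k. cvec (x k)) \<longlonglongrightarrow> 0" using cvec_tendsto[OF x] by simp
  obtain c \<theta> \<sigma> where c: "c > 0" "0 \<le> \<theta>" "\<theta> < 1" "filterlim \<sigma> at_top sequentially"
    "\<And>k K. (\<And>i. norm (G (cvec (x (\<sigma> k))) $ i) \<le> K) \<Longrightarrow> c * norm (F (cvec (x (\<sigma> k))) - F 0) powr \<theta> \<le> K"
    by (rule lojasiewicz_complex[OF G' _ lz]) auto
  have "\<forall>\<^sub>F k in sequentially. F (cvec (x (\<sigma> k))) = of_real (f (x (\<sigma> k))) \<and>
    (\<forall>i. ((\<lambda>t. f (x (\<sigma> k) + t *\<^sub>R axis i 1)) has_real_derivative Re (G (cvec (x (\<sigma> k))) $ i)) (at 0) \<and> Im (G (cvec (x (\<sigma> k))) $ i) = 0)"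
    using eventually_compose_filterlim[OF eventually_conj[OF F(2) evd] filterlim_compose[OF x c(4)]] .
  then obtain N where N: "\<And>k. k \<ge> N \<Longrightarrow> F (cvec (x (\<sigma> k))) = of_real (f (x (\<sigma> k))) \<and>
    (\<forall>i. ((\<lambda>t. f (x (\<sigma> k) + t *\<^sub>R axis i 1)) has_real_derivative Re (G (cvec (x (\<sigma> k))) $ i)) (at 0) \<and> Im (G (cvec (x (\<sigma> k))) $ i) = 0)"
    unfolding eventually_sequentially by blast
  show thesis
  proof (rule that[OF c(1-3)])
    show "filterlim (\<lambda>k. \<sigma> (k + N)) at_top sequentially"
      using filterlim_compose[OF c(4) filterlim_add_const_nat_at_top] .
    fix k K assume K: "\<And>i d. ((\<lambda>t. f (x (\<sigma> (k + N)) + t *\<^sub>R axis i 1)) has_real_derivative d) (at 0) \<Longrightarrow> \<bar>d\<bar> \<le> K"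
    note Nk = N[of "k + N", simplified]
    have "norm (G (cvec (x (\<sigma> (k + N)))) $ i) \<le> K" for i
      using K[of i "Re (G (cvec (x (\<sigma> (k + N)))) $ i)"] Nk by (simp add: cmod_def)
    from c(5)[OF this] show "c * \<bar>f (x (\<sigma> (k + N))) - f 0\<bar> powr \<theta> \<le> K"
      using Nk by (simp add: F0 flip: of_real_diff)
  qed
qed

section \<open>Failure of the Kurdyka--Lojasiewicz property along a sequence\<close>

lemma powr_tangent:
  fixes x s a :: real
  assumes "0 \<le> x" "0 < s" "0 < a" "a \<le> 1"
  shows "x powr a \<le> s powr a + a * s powr (a - 1) * (x - s)"
proof -
  have sa: "s powr (a - 1) * s = s powr a" using assms(2) by (simp add: powr_mult_base[symmetric] powr_diff)
  show ?thesis
  proof (cases "x = 0")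
    case True
    have "a * s powr a \<le> s powr a" using assms by (simp add: mult_left_le_one_le)
    then show ?thesis using True sa assms by (simp add: mult.assoc)
  next
    case False
    define t where "t = ln (x / s)"
    have x: "x = s * exp t" using False assms by (simp add: t_def)
    have "exp ((1 - a) *\<^sub>R 0 + a *\<^sub>R t) \<le> (1 - a) * exp 0 + a * exp t"
      using convex_onD[OF exp_convex, of a 0 t] assms by simp
    then have e: "exp (a * t) \<le> 1 - a + a * exp t" by simp
    have "x powr a = s powr a * exp (a * t)"
      unfolding x using assms by (simp add: powr_mult) (simp add: powr_def)
    also have "\<dots> \<le> s powr a * (1 - a + a * exp t)" using e by (intro mult_left_mono) auto
    also have "\<dots> = s powr a + a * (s powr (a - 1) * s) * (exp t - 1)" unfolding sa by (simp add: algebra_simps)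
    also have "\<dots> = s powr a + a * s powr (a - 1) * (x - s)" by (simp add: x algebra_simps)
    finally show ?thesis .
  qed
qed

lemma concave_on_powr:
  fixes a :: real
  assumes "0 < a" "a \<le> 1" "convex S" "S \<subseteq> {0..}"
  shows "concave_on S (\<lambda>x. x powr a)"
  unfolding concave_on_iff
proof (intro conjI ballI allI impI assms(3))
  fix x y u v :: real assume *: "x \<in> S" "y \<in> S" "0 \<le> u" "0 \<le> v" "u + v = 1"
  have xy: "0 \<le> x" "0 \<le> y" using * assms(4) by auto
  define s where "s = u * x + v * y"
  have s0: "0 \<le> s" using xy * by (simp add: s_def)
  show "u * x powr a + v * y powr a \<le> (u *\<^sub>R x + v *\<^sub>R y) powr a"
  proof (cases "s = 0")
    case True
    then have "u * x = 0" "v * y = 0" using xy * by (auto simp: s_def add_nonneg_eq_0_iff)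
    then show ?thesis by auto
  next
    case False
    then have s: "0 < s" using s0 by simp
    have "u * x powr a + v * y powr a \<le> u * (s powr a + a * s powr (a - 1) * (x - s)) + v * (s powr a + a * s powr (a - 1) * (y - s))"
      using powr_tangent[OF xy(1) s assms(1,2)] powr_tangent[OF xy(2) s assms(1,2)] *
      by (intro add_mono mult_left_mono) auto
    also have "\<dots> = (u + v) * s powr a + a * s powr (a - 1) * (u * x + v * y - (u + v) * s)"
      by (simp add: algebra_simps)
    also have "\<dots> = s powr a" using * by (simp add: s_def)
    finally show ?thesis by (simp add: s_def)
  qed
qed

lemma desingularizing_powr:
  assumes m: "(m::nat) > 0"
  shows "desingularizing (ereal (1 / m)) (\<lambda>t. (real m)\<^sup>2 * t powr (1 / m)) (\<lambda>t. real m * t powr (1 / m - 1))"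
proof -
  let ?D = "{t. 0 \<le> t \<and> ereal t < ereal (1 / m)}"
  have D: "?D = {0..<1 / real m}" by auto
  show ?thesis
    unfolding desingularizing_def Let_def
  proof (intro conjI ballI)
    show "continuous_on ?D (\<lambda>t. (real m)\<^sup>2 * t powr (1 / m))"
      using m by (intro continuous_intros continuous_on_powr') auto
    have "concave_on ?D (\<lambda>t. t powr (1 / m))"
      unfolding D using m by (intro concave_on_powr) auto
    then show "concave_on ?D (\<lambda>t. (real m)\<^sup>2 * t powr (1 / m))"
      by (intro concave_on_cmul) auto
    show "((\<lambda>t. (real m)\<^sup>2 * t powr (1 / m)) has_real_derivative real m * t powr (1 / m - 1)) (at t)"
      if "t \<in> {t. 0 < t \<and> ereal t < ereal (1 / m)}" for t
      using that m by (auto intro!: derivative_eq_intros simp: power2_eq_square)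
    show "continuous_on {t. 0 < t \<and> ereal t < ereal (1 / m)} (\<lambda>t. real m * t powr (1 / m - 1))"
      by (intro continuous_intros) auto
  qed (use m in auto)
qed

text \<open>If the property fails, it fails in particular for the desingularizing functions
  \<open>t \<mapsto> m\<^sup>2 * t powr (1 / m)\<close>. The strict inequalities then persist from limiting to
  nearby Frechet subgradients.\<close>

lemma KL_failure:
  fixes f :: "'a::euclidean_space \<Rightarrow> ereal"
  assumes fz: "f zb = ereal b" and nKL: "\<not> KL_property_at f zb" and m: "(m::nat) > 0"
  obtains X V where "dist X zb < 1 / m" "f zb < f X" "f X < f zb + ereal (1 / m)" "V \<in> frechet_subdiff f X"
    "norm V < 1 / m * (real_of_ereal (f X) - b) powr (1 - 1 / m)"
proof -
  let ?\<phi>' = "\<lambda>t. real m * t powr (1 / m - 1)"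
  have "\<exists>z\<in>ball zb (1 / m). f zb < f z \<and> f z < f zb + ereal (1 / m) \<and>
     \<not> 1 \<le> ereal (?\<phi>' (real_of_ereal (f z - f zb))) * edist0 (limiting_subdiff f z)"
  proof (rule ccontr)
    assume "\<not> ?thesis"
    then have "KL_property_at f zb"
      unfolding KL_property_at_def using desingularizing_powr[OF m] m
      by (intro exI[of _ "ereal (1 / m)"] exI[of _ "ball zb (1 / m)"]
          exI[of _ "\<lambda>t. (real m)\<^sup>2 * t powr (1 / m)"] exI[of _ ?\<phi>'])
        (auto simp: interior_open)
    with nKL show False ..
  qed
  then obtain z where z: "dist z zb < 1 / m" "f zb < f z" "f z < f zb + ereal (1 / m)"
    "\<not> 1 \<le> ereal (?\<phi>' (real_of_ereal (f z - f zb))) * edist0 (limiting_subdiff f z)"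
    by (auto simp: dist_commute)
  obtain c where c: "f z = ereal c" using z(2,3) fz by (cases "f z") auto
  have t: "c - b > 0" using z(2) by (simp add: c fz)
  define p where "p = ?\<phi>' (c - b)"
  have p: "p > 0" using t m by (simp add: p_def)
  have z4: "\<not> 1 \<le> ereal p * edist0 (limiting_subdiff f z)" using z(4) by (simp add: c fz p_def)
  have "edist0 (limiting_subdiff f z) < ereal (1 / p)"
  proof (rule ccontr)
    assume "\<not> ?thesis"
    then have "ereal p * ereal (1 / p) \<le> ereal p * edist0 (limiting_subdiff f z)"
      using p by (intro ereal_mult_left_mono) auto
    then show False using z4 p by (simp add: one_ereal_def)
  qed
  then obtain v where v: "v \<in> limiting_subdiff f z" "norm v < 1 / p"
    unfolding edist0_def INF_less_iff by auto
  have "p * (c - b) powr (1 - 1 / m) = real m * ((c - b) powr (1 / m - 1) * (c - b) powr (1 - 1 / m))"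
    by (simp add: p_def)
  also have "\<dots> = real m" using t by (simp add: powr_add[symmetric])
  finally have pm: "1 / p = 1 / m * (c - b) powr (1 - 1 / m)" using p m by (simp add: field_simps)
  obtain X V where X: "X \<longlonglongrightarrow> z" "(\<lambda>k. f (X k)) \<longlonglongrightarrow> f z" "\<And>k. V k \<in> frechet_subdiff f (X k)" "V \<longlonglongrightarrow> v"
    using v(1) by (auto simp: limiting_subdiff_def)
  have "(\<lambda>k. dist (X k) zb) \<longlonglongrightarrow> dist z zb" by (intro tendsto_intros X)
  then have e1: "\<forall>\<^sub>F k in sequentially. dist (X k) zb < 1 / m" using z(1) by (rule order_tendstoD)
  have e2: "\<forall>\<^sub>F k in sequentially. f zb < f (X k)" using X(2) z(2) by (rule order_tendstoD)
  have e3: "\<forall>\<^sub>F k in sequentially. f (X k) < f zb + ereal (1 / m)" using X(2) z(3) by (rule order_tendstoD)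
  have rl: "(\<lambda>k. real_of_ereal (f (X k))) \<longlonglongrightarrow> c" using X(2) unfolding c by (rule lim_real_of_ereal)
  have "(\<lambda>k. 1 / m * (real_of_ereal (f (X k)) - b) powr (1 - 1 / m) - norm (V k)) \<longlonglongrightarrow>
      1 / m * (c - b) powr (1 - 1 / m) - norm v"
    by (intro tendsto_intros rl X) (use t in auto)
  then have e4: "\<forall>\<^sub>F k in sequentially. 0 < 1 / m * (real_of_ereal (f (X k)) - b) powr (1 - 1 / m) - norm (V k)"
    by (rule order_tendstoD) (use v(2) pm in auto)
  from eventually_happens'[OF sequentially_bot eventually_conj[OF e1 eventually_conj[OF e2 eventually_conj[OF e3 e4]]]]
  show thesis using that X(3) by auto
qed

text \<open>A Frechet subgradient determines the derivative along every line on which the function is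
  differentiable.\<close>

lemma frechet_line:
  fixes f :: "'a::euclidean_space \<Rightarrow> ereal"
  assumes V: "V \<in> frechet_subdiff f X"
    and h: "\<forall>\<^sub>F t in nhds 0. f (X + t *\<^sub>R d) = ereal (h t)" and D: "(h has_real_derivative D) (at 0)"
  shows "V \<bullet> d = D"
proof (cases "d = 0")
  case True
  have ev: "\<forall>\<^sub>F t in nhds 0. h t = h 0"
    using h by eventually_elim (use eventually_nhds_x_imp_x[OF h] True in auto)
  have "((\<lambda>t. h 0) has_real_derivative D) (at 0)"
    using iffD1[OF DERIV_cong_ev[OF refl ev refl] D] .
  then have "D = 0" using DERIV_unique DERIV_const by blast
  then show ?thesis using True by simp
next
  case False
  have f0: "f X = ereal (h 0)" using eventually_nhds_x_imp_x[OF h] by simp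
  have lim: "filterlim (\<lambda>t. X + t *\<^sub>R d) (at X) (at 0)"
    unfolding filterlim_at
  proof
    have "((\<lambda>t. X + t *\<^sub>R d) \<longlongrightarrow> X + 0 *\<^sub>R d) (at 0)" by (intro tendsto_intros)
    then show "((\<lambda>t. X + t *\<^sub>R d) \<longlongrightarrow> X) (at 0)" by simp
    show "\<forall>\<^sub>F t in at 0. X + t *\<^sub>R d \<in> UNIV \<and> X + t *\<^sub>R d \<noteq> X"
      using False by (auto simp: eventually_at_filter)
  qed
  have quot: "\<forall>\<^sub>F t in at 0. - e * \<bar>t\<bar> * norm d < h t - h 0 - t * (V \<bullet> d)" if e: "e > 0" for e
  proof -
    have "ereal (- e) < 0" using e by simp
    then have "\<forall>\<^sub>F y in at X. ereal (- e) < (f y - f X - ereal (V \<bullet> (y - X))) / ereal (norm (y - X))"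
      using V unfolding frechet_subdiff_def mem_Collect_eq le_Liminf_iff by blast
    then have "\<forall>\<^sub>F t in at 0. ereal (- e) < (f (X + t *\<^sub>R d) - f X - ereal (V \<bullet> ((X + t *\<^sub>R d) - X))) / ereal (norm ((X + t *\<^sub>R d) - X))"
      using lim by (rule eventually_compose_filterlim)
    moreover have "\<forall>\<^sub>F t in at 0. f (X + t *\<^sub>R d) = ereal (h t)" using h by (simp add: eventually_at_filter eventually_mono)
    moreover have "\<forall>\<^sub>F t in at (0::real). t \<noteq> 0" by (simp add: eventually_at_filter)
    ultimately show ?thesis
    proof eventually_elim
      case (elim t)
      have pos: "0 < \<bar>t\<bar> * norm d" using elim(3) False by simp
      have "- e < (h t - h 0 - t * (V \<bullet> d)) / (\<bar>t\<bar> * norm d)"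
        using elim pos False by (simp add: f0)
      then show ?case using pos by (simp add: pos_less_divide_eq mult.assoc)
    qed
  qed
  have q: "((\<lambda>t. (h t - h 0) / t) \<longlongrightarrow> D) (at 0)"
    using D by (simp add: DERIV_def)
  have "V \<bullet> d - e * norm d \<le> D" if e: "e > 0" for e
  proof (rule tendsto_lowerbound)
    show "((\<lambda>t. (h t - h 0) / t) \<longlongrightarrow> D) (at_right 0)" using q by (rule tendsto_mono[rotated]) (simp add: at_le)
    have "\<forall>\<^sub>F t in at_right 0. - e * \<bar>t\<bar> * norm d < h t - h 0 - t * (V \<bullet> d)"
      using quot[OF e] by (rule filter_leD[rotated]) (simp add: at_le)
    moreover have "\<forall>\<^sub>F t in at_right (0::real). t > 0" by (simp add: eventually_at_filter)
    ultimately show "\<forall>\<^sub>F t in at_right 0. V \<bullet> d - e * norm d \<le> (h t - h 0) / t"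
      by eventually_elim (simp add: field_simps)
  qed simp
  moreover have "D \<le> V \<bullet> d + e * norm d" if e: "e > 0" for e
  proof (rule tendsto_upperbound)
    show "((\<lambda>t. (h t - h 0) / t) \<longlongrightarrow> D) (at_left 0)" using q by (rule tendsto_mono[rotated]) (simp add: at_le)
    have "\<forall>\<^sub>F t in at_left 0. - e * \<bar>t\<bar> * norm d < h t - h 0 - t * (V \<bullet> d)"
      using quot[OF e] by (rule filter_leD[rotated]) (simp add: at_le)
    moreover have "\<forall>\<^sub>F t in at_left (0::real). t < 0" by (simp add: eventually_at_filter)
    ultimately show "\<forall>\<^sub>F t in at_left 0. (h t - h 0) / t \<le> V \<bullet> d + e * norm d"
      by eventually_elim (simp add: field_simps)
  qed simp
  ultimately have "\<bar>V \<bullet> d - D\<bar> \<le> e * norm d" if "e > 0" for e using that by (simp add: abs_le_iff algebra_simps)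
  then have "\<bar>V \<bullet> d - D\<bar> \<le> e" if "e > 0" for e
    using that False by (metis divide_pos_pos nonzero_eq_divide_eq norm_eq_zero zero_less_norm_iff)
  then have "\<bar>V \<bullet> d - D\<bar> \<le> 0" by (rule field_le_epsilon) simp
  then show ?thesis by simp
qed

text \<open>The orthogonal projection; only linearity, range and fixed points are needed.\<close>

lemma subspace_projection:
  fixes S :: "'a::euclidean_space set"
  assumes "subspace S"
  obtains P where "linear P" "\<And>x. P x \<in> S" "\<And>x. x \<in> S \<Longrightarrow> P x = x"
proof -
  obtain B where B: "B \<subseteq> S" "pairwise orthogonal B" "\<And>x. x \<in> B \<Longrightarrow> norm x = 1" "independent B" "span B = S"
    using orthonormal_basis_subspace[OF assms] by metis
  have fB: "finite B" using B(4) independent_imp_finite by blast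
  define P where "P = (\<lambda>x. \<Sum>b\<in>B. (x \<bullet> b) *\<^sub>R b)"
  have lin: "linear P"
    unfolding P_def by (intro linear_compose_sum ballI linearI) (auto simp: inner_add_left scaleR_add_left)
  have "P x = x" if "x \<in> B" for x
  proof -
    have "P x = (\<Sum>b\<in>B. if b = x then x else 0)"
      unfolding P_def
    proof (rule sum.cong[OF refl])
      fix b assume b: "b \<in> B"
      show "(x \<bullet> b) *\<^sub>R b = (if b = x then x else 0)"
      proof (cases "b = x")
        case True
        then show ?thesis using B(3)[OF b] by (simp add: norm_eq_1)
      next
        case False
        then have "orthogonal x b" using B(2) b that by (auto simp: pairwise_def)
        then show ?thesis using False by (simp add: orthogonal_def)
      qed
    qed
    then show ?thesis using fB that by simp
  qed
  then have "P x = x" if "x \<in> S" for x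
    using linear_eq_on_span[OF lin linear_ident, of B x] that B(5) by auto
  moreover have "P x \<in> S" for x
    unfolding P_def using assms B(1) by (intro subspace_sum subspace_mul) auto
  ultimately show thesis using that lin by blast
qed

section \<open>Sums of Euclidean norms plus an analytic function\<close>

text \<open>The norm of a plane vector is the maximum over \<open>\<theta>\<close> of its pairing with the unit vector of
  angle \<open>\<theta>\<close>. The difference between norm and pairing therefore is critical at the angle of the
  vector, even if the angle is moved along with it; at the zero vector the direction of motion has
  to be zero.\<close>

lemma envelope_deriv:
  fixes \<alpha> \<beta> \<alpha>' \<beta>' \<theta> s :: real
  assumes a: "\<alpha> = sqrt (\<alpha>\<^sup>2 + \<beta>\<^sup>2) * cos \<theta>" and b: "\<beta> = sqrt (\<alpha>\<^sup>2 + \<beta>\<^sup>2) * sin \<theta>"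
    and z: "\<alpha> = 0 \<Longrightarrow> \<beta> = 0 \<Longrightarrow> \<alpha>' = 0 \<and> \<beta>' = 0"
  shows "((\<lambda>t. sqrt ((\<alpha> + t * \<alpha>')\<^sup>2 + (\<beta> + t * \<beta>')\<^sup>2) - ((\<alpha> + t * \<alpha>') * cos (\<theta> + t * s) + (\<beta> + t * \<beta>') * sin (\<theta> + t * s)))
    has_real_derivative 0) (at 0)"
proof (cases "\<alpha> = 0 \<and> \<beta> = 0")
  case True
  then show ?thesis using z by simp
next
  case False
  then have pos: "0 < \<alpha>\<^sup>2 + \<beta>\<^sup>2" by (simp add: sum_power2_gt_zero_iff)
  define \<rho> where "\<rho> = sqrt (\<alpha>\<^sup>2 + \<beta>\<^sup>2)"
  have \<rho>: "\<rho> > 0" using pos by (simp add: \<rho>_def)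
  have ab: "\<alpha> = \<rho> * cos \<theta>" "\<beta> = \<rho> * sin \<theta>" using a b by (simp_all add: \<rho>_def)
  have d: "((\<lambda>t. sqrt ((\<alpha> + t * \<alpha>')\<^sup>2 + (\<beta> + t * \<beta>')\<^sup>2)) has_real_derivative (\<alpha> * \<alpha>' + \<beta> * \<beta>') / \<rho>) (at 0)"
  proof -
    have 1: "((\<lambda>t. (\<alpha> + t * \<alpha>')\<^sup>2 + (\<beta> + t * \<beta>')\<^sup>2) has_real_derivative 2 * (\<alpha> * \<alpha>' + \<beta> * \<beta>')) (at 0)"
      by (auto intro!: derivative_eq_intros)
    have 2: "(sqrt has_real_derivative inverse \<rho> / 2) (at ((\<alpha> + 0 * \<alpha>')\<^sup>2 + (\<beta> + 0 * \<beta>')\<^sup>2))"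
      unfolding \<rho>_def using DERIV_real_sqrt[OF pos] by simp
    from DERIV_chain2[of sqrt "inverse \<rho> / 2" "\<lambda>t. (\<alpha> + t * \<alpha>')\<^sup>2 + (\<beta> + t * \<beta>')\<^sup>2" 0, OF 2 1]
    show ?thesis by (rule DERIV_cong) (use \<rho> in \<open>simp add: field_simps\<close>)
  qed
  have d2: "((\<lambda>t. (\<alpha> + t * \<alpha>') * cos (\<theta> + t * s) + (\<beta> + t * \<beta>') * sin (\<theta> + t * s)) has_real_derivative
      \<alpha>' * cos \<theta> - \<alpha> * s * sin \<theta> + (\<beta>' * sin \<theta> + \<beta> * s * cos \<theta>)) (at 0)"
    by (auto intro!: derivative_eq_intros simp: algebra_simps)
  have "(\<alpha> * \<alpha>' + \<beta> * \<beta>') / \<rho> = \<alpha>' * cos \<theta> + \<beta>' * sin \<theta>"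
    unfolding ab using \<rho> by (simp add: field_simps)
  moreover have "\<alpha> * s * sin \<theta> = \<beta> * s * cos \<theta>" unfolding ab by simp
  ultimately have "(\<alpha> * \<alpha>' + \<beta> * \<beta>') / \<rho> -
      (\<alpha>' * cos \<theta> - \<alpha> * s * sin \<theta> + (\<beta>' * sin \<theta> + \<beta> * s * cos \<theta>)) = 0" by linarith
  with DERIV_diff[OF d d2] show ?thesis by (rule DERIV_cong)
qed

lemma polar_angle:
  fixes \<alpha> \<beta> :: real
  obtains \<theta> where "0 \<le> \<theta>" "\<theta> \<le> 2 * pi" "\<alpha> = sqrt (\<alpha>\<^sup>2 + \<beta>\<^sup>2) * cos \<theta>" "\<beta> = sqrt (\<alpha>\<^sup>2 + \<beta>\<^sup>2) * sin \<theta>"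
proof (cases "\<alpha>\<^sup>2 + \<beta>\<^sup>2 = 0")
  case True
  then show thesis using that[of 0] by (simp add: sum_power2_eq_zero_iff)
next
  case False
  then have pos: "0 < \<alpha>\<^sup>2 + \<beta>\<^sup>2" by (metis less_eq_real_def sum_power2_ge_zero)
  define \<rho> where "\<rho> = sqrt (\<alpha>\<^sup>2 + \<beta>\<^sup>2)"
  have \<rho>: "\<rho> > 0" "\<rho>\<^sup>2 = \<alpha>\<^sup>2 + \<beta>\<^sup>2" using pos by (simp_all add: \<rho>_def)
  have "(\<alpha> / \<rho>)\<^sup>2 + (\<beta> / \<rho>)\<^sup>2 = 1"
  proof -
    have "(\<alpha> / \<rho>)\<^sup>2 + (\<beta> / \<rho>)\<^sup>2 = \<rho>\<^sup>2 / \<rho>\<^sup>2"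
      using \<rho>(2) by (simp only: power_divide add_divide_distrib[symmetric])
    then show ?thesis using \<rho>(1) by simp
  qed
  then obtain t where "0 \<le> t" "t < 2 * pi" "\<alpha> / \<rho> = cos t" "\<beta> / \<rho> = sin t" by (rule sincos_total_2pi)
  then show thesis using that[of t] \<rho>(1) unfolding \<rho>_def[symmetric] by (simp add: field_simps)
qed

text \<open>The property for an analytic function plus a multiple of a sum of norms of plane vectors, restricted
  to an open set and to the nonnegative orthant. Along a sequence violating it, the set of active
  constraints and vanishing norms may be taken constant. On the corresponding subspace each
  norm is replaced by \<open>\<alpha> * cos \<theta> + \<beta> * sin \<theta>\<close> with the angle \<open>\<theta>\<close> as an additional
  variable. The resulting function \<open>F\<close> is analytic, also at the limit point, where some of the norms
  may vanish. At the actual angles its value is that of the objective, its derivatives with respect to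
  the angles vanish, and its derivatives along the subspace are given by the Frechet subgradients. The
  gradient inequality for \<open>F\<close> contradicts the violation.\<close>

lemma KL_core:
  fixes A B :: "'k::finite \<Rightarrow> real^'p" and D :: "((real^'p) \<times> (real^'j)) set"
  assumes D: "open D"
    and f: "\<And>z. f z = (if z \<in> D \<and> (\<forall>i. 0 \<le> fst z $ i) \<and> (\<forall>j. 0 \<le> snd z $ j)
       then ereal (g z + u * (\<Sum>k\<in>UNIV. sqrt ((A k \<bullet> fst z)\<^sup>2 + (B k \<bullet> fst z)\<^sup>2))) else \<infinity>)"
    and zb: "f zb < \<infinity>"
    and g: "\<And>L :: real^('p + 'j + 'k) \<Rightarrow> (real^'p) \<times> (real^'j). linear L \<Longrightarrow> real_analytic0 (\<lambda>x. g (zb + L x))"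
  shows "KL_property_at f zb"
proof (rule ccontr)
  assume nKL: "\<not> KL_property_at f zb"
  define h where "h = (\<lambda>z. g z + u * (\<Sum>k\<in>UNIV. sqrt ((A k \<bullet> fst z)\<^sup>2 + (B k \<bullet> fst z)\<^sup>2)))"
  define b where "b = h zb"
  have fb: "f zb = ereal b" using zb by (auto simp: f h_def b_def split: if_splits)
  have "\<forall>m. \<exists>X V. dist X zb < 1 / Suc m \<and> f zb < f X \<and> f X < f zb + ereal (1 / Suc m) \<and> V \<in> frechet_subdiff f X \<and>
      norm V < 1 / Suc m * (real_of_ereal (f X) - b) powr (1 - 1 / Suc m)"
  proof
    fix m
    obtain X V where "dist X zb < 1 / Suc m" "f zb < f X" "f X < f zb + ereal (1 / Suc m)" "V \<in> frechet_subdiff f X"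
      "norm V < 1 / Suc m * (real_of_ereal (f X) - b) powr (1 - 1 / Suc m)"
      by (rule KL_failure[OF fb nKL, of "Suc m"]) auto
    then show "\<exists>X V. dist X zb < 1 / Suc m \<and> f zb < f X \<and> f X < f zb + ereal (1 / Suc m) \<and> V \<in> frechet_subdiff f X \<and>
      norm V < 1 / Suc m * (real_of_ereal (f X) - b) powr (1 - 1 / Suc m)" by blast
  qed
  then obtain X V where XV: "\<And>m. dist (X m) zb < 1 / Suc m" "\<And>m. f zb < f (X m)" "\<And>m. f (X m) < f zb + ereal (1 / Suc m)"
    "\<And>m. V m \<in> frechet_subdiff f (X m)" "\<And>m. norm (V m) < 1 / Suc m * (real_of_ereal (f (X m)) - b) powr (1 - 1 / Suc m)"
    unfolding choice_iff by blast
  have fin: "f (X m) < \<infinity>" for m using XV(3)[of m] fb by (auto simp: less_le_trans)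
  have dom: "X m \<in> D" "0 \<le> fst (X m) $ i" "0 \<le> snd (X m) $ j" for m i j
    using fin[of m] by (auto simp: f split: if_splits)
  have fX: "f (X m) = ereal (h (X m))" for m using dom by (simp add: f h_def)
  have bh: "b < h (X m)" "h (X m) < b + 1 / Suc m" for m using XV(2,3)[of m] by (simp_all add: fX fb)
  have Vn: "norm (V m) < 1 / Suc m * (h (X m) - b) powr (1 - 1 / Suc m)" for m using XV(5)[of m] by (simp add: fX)
  have Xlim: "X \<longlonglongrightarrow> zb"
  proof (rule tendsto_dist_iff[THEN iffD2], rule tendsto_sandwich)
    show "\<forall>\<^sub>F m in sequentially. 0 \<le> dist (X m) zb" by simp
    show "\<forall>\<^sub>F m in sequentially. dist (X m) zb \<le> 1 / Suc m" 
      by (intro always_eventually allI less_imp_le XV(1))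
    show "(\<lambda>m. 1 / real (Suc m)) \<longlonglongrightarrow> 0" using LIMSEQ_inverse_real_of_nat by (simp add: inverse_eq_divide)
  qed simp
  have hlim: "(\<lambda>m. h (X m)) \<longlonglongrightarrow> b"
  proof (rule tendsto_sandwich)
    show "\<forall>\<^sub>F m in sequentially. b \<le> h (X m)" 
      by (intro always_eventually allI less_imp_le bh(1))
    show "\<forall>\<^sub>F m in sequentially. h (X m) \<le> b + 1 / Suc m" 
      by (intro always_eventually allI less_imp_le bh(2))
    show "(\<lambda>m. b + 1 / real (Suc m)) \<longlonglongrightarrow> b"
      using tendsto_add[OF tendsto_const LIMSEQ_inverse_real_of_nat, of b] by (simp add: inverse_eq_divide)
  qed simp
  \<comment> \<open>Polar angles of all plane vectors at every point; any angle serves for a zero vector.\<close>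
  have "\<forall>z k. \<exists>\<theta>. 0 \<le> \<theta> \<and> \<theta> \<le> 2 * pi \<and>
     A k \<bullet> fst z = sqrt ((A k \<bullet> fst z)\<^sup>2 + (B k \<bullet> fst z)\<^sup>2) * cos \<theta> \<and>
     B k \<bullet> fst z = sqrt ((A k \<bullet> fst z)\<^sup>2 + (B k \<bullet> fst z)\<^sup>2) * sin \<theta>" for z :: "(real^'p) \<times> (real^'j)"
    by (metis polar_angle)
  then have "\<forall>z::(real^'p) \<times> (real^'j). \<forall>k. \<exists>\<theta>. 0 \<le> \<theta> \<and> \<theta> \<le> 2 * pi \<and>
     A k \<bullet> fst z = sqrt ((A k \<bullet> fst z)\<^sup>2 + (B k \<bullet> fst z)\<^sup>2) * cos \<theta> \<and>
     B k \<bullet> fst z = sqrt ((A k \<bullet> fst z)\<^sup>2 + (B k \<bullet> fst z)\<^sup>2) * sin \<theta>" by blast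
  then obtain an :: "(real^'p) \<times> (real^'j) \<Rightarrow> 'k \<Rightarrow> real" where an0: "\<And>z k. 0 \<le> an z k" "\<And>z k. an z k \<le> 2 * pi"
    and an: "\<And>z k. A k \<bullet> fst z = sqrt ((A k \<bullet> fst z)\<^sup>2 + (B k \<bullet> fst z)\<^sup>2) * cos (an z k)"
     "\<And>z k. B k \<bullet> fst z = sqrt ((A k \<bullet> fst z)\<^sup>2 + (B k \<bullet> fst z)\<^sup>2) * sin (an z k)"
    unfolding choice_iff by blast
  define ang where "ang = (\<lambda>m. \<chi> k. an (X m) k)"
  define act where "act = (\<lambda>z::(real^'p) \<times> (real^'j). ({i. fst z $ i = 0}, {j. snd z $ j = 0}, {k. A k \<bullet> fst z = 0 \<and> B k \<bullet> fst z = 0}))"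
  have "\<exists>Z. \<exists>\<^sub>F m in sequentially. act (X m) = Z"
  proof (rule ccontr)
    assume "\<not> ?thesis"
    then have "\<forall>\<^sub>F m in sequentially. \<forall>Z. act (X m) \<noteq> Z"
      by (intro eventually_all_finite) (auto simp: frequently_def)
    then show False by (auto simp: eventually_sequentially)
  qed
  then obtain Z where Z: "\<exists>\<^sub>F m in sequentially. act (X m) = Z" by blast
  have bnd: "bounded (ang ` {m. act (X m) = Z})"
    unfolding bounded_iff
  proof (intro exI ballI)
    fix v assume "v \<in> ang ` {m. act (X m) = Z}"
    then obtain m where v: "v = ang m" by blast
    have "norm v \<le> (\<Sum>k\<in>UNIV. \<bar>v $ k\<bar>)" by (rule norm_le_l1_cart)
    also have "\<dots> \<le> (\<Sum>k\<in>(UNIV::'k set). 2 * pi)"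
      by (rule sum_mono) (use an0 in \<open>simp add: v ang_def\<close>)
    finally show "norm v \<le> (\<Sum>k\<in>(UNIV::'k set). 2 * pi)" .
  qed
  obtain \<sigma> \<theta>0 where sg: "filterlim \<sigma> at_top sequentially" "(\<lambda>m. ang (\<sigma> m)) \<longlonglongrightarrow> \<theta>0" "\<And>m. act (X (\<sigma> m)) = Z"
    by (rule bounded_subseq[OF Z bnd]) blast
  obtain Z1 Z2 Z3 where Z123: "Z = (Z1, Z2, Z3)" by (cases Z)
  \<comment> \<open>The subspace cut out by the active constraints and the vanishing norms; it also contains the limit point.\<close>
  define S where "S = {z::(real^'p) \<times> (real^'j). (\<forall>i\<in>Z1. fst z $ i = 0) \<and> (\<forall>j\<in>Z2. snd z $ j = 0) \<and>
     (\<forall>k\<in>Z3. A k \<bullet> fst z = 0 \<and> B k \<bullet> fst z = 0)}"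
  have S: "subspace S" unfolding subspace_def S_def by (auto simp: inner_add_right)
  have XS: "X (\<sigma> m) \<in> S" for m using sg(3)[of m] by (auto simp: S_def act_def Z123)
  have Xl: "(\<lambda>m. X (\<sigma> m)) \<longlonglongrightarrow> zb" using filterlim_compose[OF Xlim sg(1)] .
  have "zb \<in> S" using closed_sequentially[OF closed_subspace[OF S] _ Xl] XS by blast
  then have XzS: "X (\<sigma> m) - zb \<in> S" for m using subspace_diff[OF S XS] by blast
  obtain P where P: "linear P" "\<And>x. P x \<in> S" "\<And>x. x \<in> S \<Longrightarrow> P x = x"
    using subspace_projection[OF S] by metis
  define zz :: "real^('p + 'j + 'k) \<Rightarrow> (real^'p) \<times> (real^'j)" where
    "zz = (\<lambda>x. (\<chi> i. x $ Inl i, \<chi> j. x $ Inr (Inl j)))"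
  have lzz: "linear zz" by (rule linearI) (auto simp: zz_def vec_eq_iff)
  define x :: "nat \<Rightarrow> real^('p + 'j + 'k)" where
    "x = (\<lambda>m. \<chi> c. case c of Inl i \<Rightarrow> fst (X (\<sigma> m) - zb) $ i | Inr (Inl j) \<Rightarrow> snd (X (\<sigma> m) - zb) $ j
        | Inr (Inr k) \<Rightarrow> ang (\<sigma> m) $ k - \<theta>0 $ k)"
  have xlim: "x \<longlonglongrightarrow> 0"
  proof (rule vec_tendstoI)
    have l: "(\<lambda>m. X (\<sigma> m) - zb) \<longlonglongrightarrow> 0" using Xl by (simp add: LIM_zero_iff)
    fix c :: "'p + 'j + 'k"
    show "(\<lambda>m. x m $ c) \<longlonglongrightarrow> 0 $ c"
    proof (cases c)
      case (Inl i)
      then show ?thesis using tendsto_vec_nth[OF tendsto_fst[OF l], of i] by (simp add: x_def)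
    next
      case (Inr c')
      show ?thesis
      proof (cases c')
        case (Inl j)
        then show ?thesis using tendsto_vec_nth[OF tendsto_snd[OF l], of j] Inr by (simp add: x_def)
      next
        case (Inr k)
        have "(\<lambda>m. ang (\<sigma> m) $ k - \<theta>0 $ k) \<longlonglongrightarrow> 0"
          using tendsto_vec_nth[OF sg(2), of k] by (simp add: LIM_zero_iff)
        then show ?thesis using Inr \<open>c = Inr c'\<close> by (simp add: x_def)
      qed
    qed
  qed
  have zzx: "zz (x m) = X (\<sigma> m) - zb" for m by (simp add: zz_def x_def prod_eq_iff vec_eq_iff)
  have xth: "\<theta>0 $ k + x m $ Inr (Inr k) = an (X (\<sigma> m)) k" for m k by (simp add: x_def ang_def)
  define F where "F = (\<lambda>y. g (zb + P (zz y)) + u * (\<Sum>k\<in>UNIV.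
      (A k \<bullet> fst (zb + P (zz y))) * cos (\<theta>0 $ k + y $ Inr (Inr k)) +
      (B k \<bullet> fst (zb + P (zz y))) * sin (\<theta>0 $ k + y $ Inr (Inr k))))"
  have lPz: "linear (\<lambda>y. P (zz y))" using linear_compose[OF lzz P(1)] by (simp add: o_def)
  have lin: "real_analytic0 (\<lambda>y. a \<bullet> fst (zb + P (zz y)))" for a
  proof -
    have "linear (\<lambda>y. a \<bullet> fst (P (zz y)))"
      by (rule linearI) (simp_all add: linear_add[OF lPz] linear_cmul[OF lPz] inner_add_right)
    from real_analytic0_add[OF real_analytic0_const real_analytic0_linear[OF this], of "a \<bullet> fst zb"] show ?thesis by (simp add: inner_add_right)
  qed
  have trig: "real_analytic0 (\<lambda>y. cos (\<theta>0 $ k + y $ Inr (Inr k)))" "real_analytic0 (\<lambda>y. sin (\<theta>0 $ k + y $ Inr (Inr k)))" for k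
    by (rule real_analytic0_compose[of _ UNIV cos] real_analytic0_compose[of _ UNIV sin];
        auto intro!: real_analytic0_add real_analytic0_const real_analytic0_coord holomorphic_intros simp: cos_of_real sin_of_real)+
  have raF: "real_analytic0 F"
    unfolding F_def by (intro real_analytic0_add g lPz real_analytic0_mult real_analytic0_const real_analytic0_sum lin trig)
  have Fx: "F (x m) = h (X (\<sigma> m))" for m
  proof -
    have "(A k \<bullet> fst (X (\<sigma> m))) * cos (an (X (\<sigma> m)) k) + (B k \<bullet> fst (X (\<sigma> m))) * sin (an (X (\<sigma> m)) k) =
       sqrt ((A k \<bullet> fst (X (\<sigma> m)))\<^sup>2 + (B k \<bullet> fst (X (\<sigma> m)))\<^sup>2)" for k
    proof -
      define r where "r = sqrt ((A k \<bullet> fst (X (\<sigma> m)))\<^sup>2 + (B k \<bullet> fst (X (\<sigma> m)))\<^sup>2)"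
      let ?c = "cos (an (X (\<sigma> m)) k)" and ?s = "sin (an (X (\<sigma> m)) k)"
      have a1: "A k \<bullet> fst (X (\<sigma> m)) = r * ?c" and b1: "B k \<bullet> fst (X (\<sigma> m)) = r * ?s"
        unfolding r_def by (rule an)+
      have "(A k \<bullet> fst (X (\<sigma> m))) * ?c + (B k \<bullet> fst (X (\<sigma> m))) * ?s = r * (?c * ?c + ?s * ?s)"
        by (simp only: a1 b1 distrib_left mult.assoc)
      also have "?c * ?c + ?s * ?s = 1" by (rule sin_cos_squared_add3)
      finally show ?thesis by (simp add: r_def)
    qed
    then show ?thesis by (simp add: F_def zzx P(3)[OF XzS] xth h_def)
  qed
  have F0: "F 0 = b"
  proof (rule LIMSEQ_unique)
    show "(\<lambda>m. F (x m)) \<longlonglongrightarrow> F 0" using filterlim_compose[OF real_analytic0_tendsto0[OF raF] xlim] .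
    show "(\<lambda>m. F (x m)) \<longlonglongrightarrow> b" unfolding Fx using filterlim_compose[OF hlim sg(1)] .
  qed
  obtain c \<theta> \<tau> where c: "c > 0" "0 \<le> \<theta>" "\<theta> < 1" "filterlim \<tau> at_top sequentially"
    and loj: "\<And>m K. (\<And>i d. ((\<lambda>t. F (x (\<tau> m) + t *\<^sub>R axis i 1)) has_real_derivative d) (at 0) \<Longrightarrow> \<bar>d\<bar> \<le> K) \<Longrightarrow>
       c * \<bar>F (x (\<tau> m)) - F 0\<bar> powr \<theta> \<le> K"
    by (rule lojasiewicz_real[OF raF xlim]) blast
  define dir where "dir = (\<lambda>i. P (zz (axis i 1)))"
  define C where "C = (\<Sum>i\<in>UNIV. norm (dir i)) + 1"
  have C: "norm (dir i) \<le> C" for i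
    using member_le_sum[of i UNIV "\<lambda>i. norm (dir i)"] by (simp add: C_def)
  have C0: "C > 0" by (simp add: C_def add_nonneg_pos sum_nonneg)
  have bound: "c * (h (X (\<sigma> (\<tau> m))) - b) powr \<theta> \<le> norm (V (\<sigma> (\<tau> m))) * C" for m
  proof -
    let ?X = "X (\<sigma> (\<tau> m))" and ?V = "V (\<sigma> (\<tau> m))"
    have dbound: "\<bar>d\<bar> \<le> norm ?V * C" if der: "((\<lambda>t. F (x (\<tau> m) + t *\<^sub>R axis i 1)) has_real_derivative d) (at 0)" for i d
    proof -
      let ?d = "dir i" and ?s = "\<lambda>k. axis i (1::real) $ Inr (Inr k)"
      have dS: "?d \<in> S" using P(2) by (simp add: dir_def)
      have pt: "zb + P (zz (x (\<tau> m) + t *\<^sub>R axis i 1)) = ?X + t *\<^sub>R ?d" for t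
        by (simp add: linear_add[OF lPz] linear_cmul[OF lPz] zzx P(3)[OF XzS] dir_def)
      define e where "e = (\<lambda>k t. sqrt ((A k \<bullet> fst ?X + t * (A k \<bullet> fst ?d))\<^sup>2 + (B k \<bullet> fst ?X + t * (B k \<bullet> fst ?d))\<^sup>2) -
        ((A k \<bullet> fst ?X + t * (A k \<bullet> fst ?d)) * cos (an ?X k + t * ?s k) + (B k \<bullet> fst ?X + t * (B k \<bullet> fst ?d)) * sin (an ?X k + t * ?s k)))"
      have de: "(e k has_real_derivative 0) (at 0)" for k
        unfolding e_def
      proof (rule envelope_deriv[OF an])
        assume "A k \<bullet> fst ?X = 0" "B k \<bullet> fst ?X = 0"
        then have "k \<in> Z3" using sg(3)[of "\<tau> m"] by (auto simp: act_def Z123)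
        then show "A k \<bullet> fst ?d = 0 \<and> B k \<bullet> fst ?d = 0" using dS by (auto simp: S_def)
      qed
      have hF: "h (?X + t *\<^sub>R ?d) = F (x (\<tau> m) + t *\<^sub>R axis i 1) + u * (\<Sum>k\<in>UNIV. e k t)" for t
        unfolding F_def pt h_def e_def
        by (simp add: inner_add_right add.assoc[symmetric] xth sum_subtractf right_diff_distrib)
      have dE: "((\<lambda>t. F (x (\<tau> m) + t *\<^sub>R axis i 1) + u * (\<Sum>k\<in>UNIV. e k t)) has_real_derivative d + u * (\<Sum>k\<in>(UNIV::'k set). 0)) (at 0)"
        by (intro DERIV_add der DERIV_cmult DERIV_sum de)
      have lim: "((\<lambda>t. ?X + t *\<^sub>R ?d) \<longlongrightarrow> ?X) (nhds 0)"
      proof -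
        have "((\<lambda>t. ?X + t *\<^sub>R ?d) \<longlongrightarrow> ?X + 0 *\<^sub>R ?d) (nhds 0)" by (intro tendsto_intros filterlim_ident)
        then show ?thesis by simp
      qed
      have e1: "\<forall>\<^sub>F t in nhds 0. ?X + t *\<^sub>R ?d \<in> D"
        using lim D dom(1) by (simp add: tendsto_def)
      have e2: "\<forall>\<^sub>F t in nhds 0. \<forall>l. 0 \<le> fst (?X + t *\<^sub>R ?d) $ l"
      proof (rule eventually_all_finite)
        fix l show "\<forall>\<^sub>F t in nhds 0. 0 \<le> fst (?X + t *\<^sub>R ?d) $ l"
        proof (cases "fst ?X $ l = 0")
          case True
          then have "l \<in> Z1" using sg(3)[of "\<tau> m"] by (auto simp: act_def Z123)
          then have "fst ?d $ l = 0" using dS by (auto simp: S_def)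
          then show ?thesis using True by simp
        next
          case False
          then have "0 < fst ?X $ l" using dom(2)[of "\<sigma> (\<tau> m)" l] by simp
          with tendsto_vec_nth[OF tendsto_fst[OF lim], of l]
          have "\<forall>\<^sub>F t in nhds 0. 0 < fst (?X + t *\<^sub>R ?d) $ l" by (rule order_tendstoD)
          then show ?thesis by (rule eventually_mono) simp
        qed
      qed
      have e3: "\<forall>\<^sub>F t in nhds 0. \<forall>l. 0 \<le> snd (?X + t *\<^sub>R ?d) $ l"
      proof (rule eventually_all_finite)
        fix l show "\<forall>\<^sub>F t in nhds 0. 0 \<le> snd (?X + t *\<^sub>R ?d) $ l"
        proof (cases "snd ?X $ l = 0")
          case True
          then have "l \<in> Z2" using sg(3)[of "\<tau> m"] by (auto simp: act_def Z123)
          then have "snd ?d $ l = 0" using dS by (auto simp: S_def)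
          then show ?thesis using True by simp
        next
          case False
          then have "0 < snd ?X $ l" using dom(3)[of "\<sigma> (\<tau> m)" l] by simp
          with tendsto_vec_nth[OF tendsto_snd[OF lim], of l]
          have "\<forall>\<^sub>F t in nhds 0. 0 < snd (?X + t *\<^sub>R ?d) $ l" by (rule order_tendstoD)
          then show ?thesis by (rule eventually_mono) simp
        qed
      qed
      have "\<forall>\<^sub>F t in nhds 0. f (?X + t *\<^sub>R ?d) = ereal (F (x (\<tau> m) + t *\<^sub>R axis i 1) + u * (\<Sum>k\<in>UNIV. e k t))"
        using e1 e2 e3 by eventually_elim (simp only: f hF[symmetric] h_def if_True simp_thms)
      from frechet_line[OF XV(4) this dE] have "?V \<bullet> ?d = d" by simp
      then have "\<bar>d\<bar> \<le> norm ?V * norm ?d" using Cauchy_Schwarz_ineq2 by metis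
      also have "\<dots> \<le> norm ?V * C" using C by (intro mult_left_mono) auto
      finally show ?thesis .
    qed
    have "c * \<bar>F (x (\<tau> m)) - F 0\<bar> powr \<theta> \<le> norm ?V * C"
      by (rule loj) (rule dbound)
    then show ?thesis using bh(1)[of "\<sigma> (\<tau> m)"] by (simp add: Fx F0)
  qed
  \<comment> \<open>The exponents \<open>1 - 1 / m\<close> and the factors \<open>1 / m\<close> of the violation eventually beat \<open>\<theta>\<close> and \<open>c / C\<close>.\<close>
  define M where "M = max (1 / (1 - \<theta>)) (C / c)"
  have "filterlim (\<lambda>m. real (Suc (\<sigma> (\<tau> m)))) at_top sequentially"
    using filterlim_compose[OF filterlim_real_sequentially filterlim_compose[OF filterlim_Suc filterlim_compose[OF sg(1) c(4)]]] .
  then have "\<forall>\<^sub>F m in sequentially. M \<le> real (Suc (\<sigma> (\<tau> m)))" by (simp add: filterlim_at_top)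
  then obtain m0 where m0: "M \<le> real (Suc (\<sigma> (\<tau> m0)))" using eventually_happens'[OF sequentially_bot] by blast
  define m where "m = Suc (\<sigma> (\<tau> m0))"
  have mpos: "real m > 0" by (simp add: m_def)
  define T where "T = h (X (\<sigma> (\<tau> m0))) - b"
  have T: "0 < T" "T < 1 / m" using bh[of "\<sigma> (\<tau> m0)"] by (simp_all add: T_def m_def)
  have "1 / real m \<le> 1" by (simp add: m_def)
  then have T1: "T \<le> 1" using T by simp
  have "1 / (1 - \<theta>) \<le> m" using m0 by (simp add: M_def m_def)
  then have "1 \<le> m * (1 - \<theta>)" using c(3) by (simp add: divide_le_eq)
  then have "\<theta> \<le> 1 - 1 / m" using mpos by (simp add: field_simps)
  then have "T powr (1 - 1 / m) \<le> T powr \<theta>" using T(1) T1 by (intro powr_mono') auto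
  then have le: "1 / m * T powr (1 - 1 / m) \<le> 1 / m * T powr \<theta>"
    using mpos by (intro mult_left_mono) auto
  have "norm (V (\<sigma> (\<tau> m0))) < 1 / m * T powr (1 - 1 / m)"
    using Vn[of "\<sigma> (\<tau> m0)"] unfolding T_def[symmetric] m_def[symmetric] .
  also note le
  finally have "norm (V (\<sigma> (\<tau> m0))) * C < (1 / m * T powr \<theta>) * C"
    using C0 by (rule mult_strict_right_mono)
  with bound[of m0] have "c * T powr \<theta> < (1 / m * T powr \<theta>) * C" unfolding T_def[symmetric] by linarith
  then have "c < C / m" using T(1) mpos by (simp add: field_simps)
  then have "m < C / c" using c(1) mpos by (simp add: field_simps)
  then show False using m0 by (simp add: M_def m_def)
qed

section \<open>The Laplace transform of the splines\<close>

lemma knot_less: "1 < q \<Longrightarrow> 0 < \<kappa>0 \<Longrightarrow> i < j \<Longrightarrow> knot q \<kappa>0 i < knot q \<kappa>0 j"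
  by (simp add: knot_def)

text \<open>The half-open pieces of the spline are closed up; this changes the integrand only at the middle
  knot.\<close>

lemma B1_laplace_integral:
  assumes q: "1 < q" "0 < \<kappa>0" and j: "j \<ge> 1"
  defines "a \<equiv> knot q \<kappa>0 (j - 1)" and "b \<equiv> knot q \<kappa>0 j" and "c \<equiv> knot q \<kappa>0 (j + 1)"
  shows "B1_laplace q \<kappa>0 j s =
    integral {a..b} (\<lambda>\<kappa>. (\<kappa> - a) / (b - a) * exp (- s * \<kappa>)) + integral {b..c} (\<lambda>\<kappa>. (c - \<kappa>) / (c - b) * exp (- s * \<kappa>))"
proof -
  have ab: "a < b" and bc: "b < c" unfolding a_def b_def c_def using q j by (auto intro!: knot_less)
  define f1 where "f1 = (\<lambda>\<kappa>. (\<kappa> - a) / (b - a) * exp (- s * \<kappa>))"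
  define f2 where "f2 = (\<lambda>\<kappa>. (c - \<kappa>) / (c - b) * exp (- s * \<kappa>))"
  have c1: "continuous_on {a..b} f1" and c2: "continuous_on {b..c} f2"
    unfolding f1_def f2_def using ab bc by (auto intro!: continuous_intros)
  have i1: "set_integrable lborel {a..b} f1" and i2: "set_integrable lborel {b..c} f2"
    using borel_integrable_atLeastAtMost'[OF c1] borel_integrable_atLeastAtMost'[OF c2] by auto
  have m: "B1_spline q \<kappa>0 j \<in> borel_measurable borel"
    unfolding B1_spline_def[abs_def] by measurable
  have "B1_laplace q \<kappa>0 j s = (LINT \<kappa>|lborel. indicator {a..b} \<kappa> *\<^sub>R f1 \<kappa> + indicator {b..c} \<kappa> *\<^sub>R f2 \<kappa>)"
    unfolding B1_laplace_def
  proof (rule integral_cong_AE)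
    show "(\<lambda>\<kappa>. B1_spline q \<kappa>0 j \<kappa> * exp (- s * \<kappa>)) \<in> borel_measurable lborel"
      using m by simp
    show "(\<lambda>\<kappa>. indicator {a..b} \<kappa> *\<^sub>R f1 \<kappa> + indicator {b..c} \<kappa> *\<^sub>R f2 \<kappa>) \<in> borel_measurable lborel"
      unfolding f1_def f2_def by measurable
    have "AE \<kappa> in lborel. \<kappa> \<noteq> b" by (rule AE_lborel_singleton)
    then show "AE \<kappa> in lborel. B1_spline q \<kappa>0 j \<kappa> * exp (- s * \<kappa>) = indicator {a..b} \<kappa> *\<^sub>R f1 \<kappa> + indicator {b..c} \<kappa> *\<^sub>R f2 \<kappa>"
    proof eventually_elim
      case (elim \<kappa>)
      show ?case
        unfolding B1_spline_def a_def[symmetric] b_def[symmetric] c_def[symmetric] f1_def f2_def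
        using elim ab bc by (cases "\<kappa> = c") (auto simp: indicator_def)
    qed
  qed
  also have "\<dots> = (LINT \<kappa>:{a..b}|lborel. f1 \<kappa>) + (LINT \<kappa>:{b..c}|lborel. f2 \<kappa>)"
    using i1 i2 unfolding set_lebesgue_integral_def set_integrable_def by (rule Bochner_Integration.integral_add)
  also have "\<dots> = integral {a..b} f1 + integral {b..c} f2"
    using set_borel_integral_eq_integral(2)[OF i1] set_borel_integral_eq_integral(2)[OF i2] by simp
  finally show ?thesis by (simp add: f1_def f2_def)
qed

lemma holomorphic_laplace:
  fixes l :: "real \<Rightarrow> real"
  assumes "continuous_on {a..b} l"
  shows "(\<lambda>s. integral {a..b} (\<lambda>t. of_real (l t) * exp (- s * of_real t)) :: complex) holomorphic_on UNIV"
    and "integral {a..b} (\<lambda>t. of_real (l t) * exp (- of_real s * of_real t)) =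
      complex_of_real (integral {a..b} (\<lambda>t. l t * exp (- s * t)))"
proof -
  have cl: "continuous_on (UNIV \<times> cbox a b) (\<lambda>p::complex \<times> real. l (snd p))"
    by (rule continuous_on_compose2[OF assms continuous_on_snd[OF continuous_on_id]]) auto
  have "(\<lambda>s. integral (cbox a b) (\<lambda>t. of_real (l t) * exp (- s * of_real t)) :: complex) holomorphic_on UNIV"
  proof (rule leibniz_rule_holomorphic)
    show "((\<lambda>s. of_real (l t) * exp (- s * of_real t)) has_field_derivative
       of_real (l t) * (exp (- s * of_real t) * (- of_real t))) (at s within UNIV)" for s :: complex and t :: real
      by (auto intro!: derivative_eq_intros)
    show "(\<lambda>t. of_real (l t) * exp (- s * of_real t)) integrable_on cbox a b" for s :: complex
      by (intro integrable_continuous continuous_intros) (use assms in simp)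
    show "continuous_on (UNIV \<times> cbox a b) (\<lambda>(s, t). of_real (l t) * (exp (- s * of_real t) * (- of_real t)) :: complex)"
      unfolding split_beta by (intro continuous_intros cl)
  qed simp
  then show "(\<lambda>s. integral {a..b} (\<lambda>t. of_real (l t) * exp (- s * of_real t)) :: complex) holomorphic_on UNIV" by simp
  have int: "(\<lambda>t. l t * exp (- s * t)) integrable_on {a..b}"
    by (intro integrable_continuous_real continuous_intros assms)
  show "integral {a..b} (\<lambda>t. of_real (l t) * exp (- of_real s * of_real t)) =
      complex_of_real (integral {a..b} (\<lambda>t. l t * exp (- s * t)))"
    using integral_linear[OF int bounded_linear_of_real[where 'a=complex]] by (simp add: o_def exp_of_real[symmetric])
qed

text \<open>The Laplace transform extends to an entire function.\<close>

lemma B1_laplace_holomorphic: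
  assumes q: "1 < q" "0 < \<kappa>0" and j: "j \<ge> 1"
  obtains h where "h holomorphic_on UNIV" "\<And>s. h (of_real s) = of_real (B1_laplace q \<kappa>0 j s)"
proof -
  define a where "a = knot q \<kappa>0 (j - 1)"
  define b where "b = knot q \<kappa>0 j"
  define c where "c = knot q \<kappa>0 (j + 1)"
  have ab: "a < b" and bc: "b < c" unfolding a_def b_def c_def using q j by (auto intro!: knot_less)
  have c1: "continuous_on {a..b} (\<lambda>\<kappa>. (\<kappa> - a) / (b - a))" and c2: "continuous_on {b..c} (\<lambda>\<kappa>. (c - \<kappa>) / (c - b))"
    using ab bc by (auto intro!: continuous_intros)
  show thesis
  proof (rule that)
    show "(\<lambda>s. integral {a..b} (\<lambda>t. of_real ((t - a) / (b - a)) * exp (- s * of_real t)) +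
       integral {b..c} (\<lambda>t. of_real ((c - t) / (c - b)) * exp (- s * of_real t)) :: complex) holomorphic_on UNIV"
      by (intro holomorphic_on_add holomorphic_laplace(1) c1 c2)
    show "integral {a..b} (\<lambda>t. of_real ((t - a) / (b - a)) * exp (- of_real s * of_real t)) +
       integral {b..c} (\<lambda>t. of_real ((c - t) / (c - b)) * exp (- of_real s * of_real t)) =
       complex_of_real (B1_laplace q \<kappa>0 j s)" for s
      unfolding holomorphic_laplace(2)[OF c1] holomorphic_laplace(2)[OF c2] B1_laplace_integral[OF q j]
      by (simp add: a_def b_def c_def)
  qed
qed

lemma B1_laplace_0_pos:
  assumes q: "1 < q" "0 < \<kappa>0" and j: "j \<ge> 1"
  shows "0 < B1_laplace q \<kappa>0 j 0"
proof -
  define a where "a = knot q \<kappa>0 (j - 1)"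
  define b where "b = knot q \<kappa>0 j"
  define c where "c = knot q \<kappa>0 (j + 1)"
  have ab: "a < b" and bc: "b < c" unfolding a_def b_def c_def using q j by (auto intro!: knot_less)
  define k where "k = inverse (2 * (b - a))"
  have k: "k > 0" "2 * k = inverse (b - a)" using ab by (simp_all add: k_def field_simps)
  have "((\<lambda>\<kappa>. (\<kappa> - a) / (b - a)) has_integral ((b - a)\<^sup>2 * k - (a - a)\<^sup>2 * k)) {a..b}"
  proof (rule fundamental_theorem_of_calculus)
    fix x assume "x \<in> {a..b}"
    have "((\<lambda>\<kappa>. (\<kappa> - a)\<^sup>2 * k) has_real_derivative 2 * (x - a) * k) (at x within {a..b})"
      by (auto intro!: derivative_eq_intros)
    also have "2 * (x - a) * k = (x - a) / (b - a)" 
      unfolding divide_inverse k(2)[symmetric] by (simp only: mult_ac)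
    finally show "((\<lambda>\<kappa>. (\<kappa> - a)\<^sup>2 * k) has_vector_derivative (x - a) / (b - a)) (at x within {a..b})"
      by (simp add: has_real_derivative_iff_has_vector_derivative)
  qed (use ab in simp)
  then have "integral {a..b} (\<lambda>\<kappa>. (\<kappa> - a) / (b - a)) = (b - a)\<^sup>2 * k"
    by (subst integral_unique) auto
  also have "\<dots> > 0" using ab k(1) by simp
  finally have "0 < integral {a..b} (\<lambda>\<kappa>. (\<kappa> - a) / (b - a))" .
  moreover have "0 \<le> integral {b..c} (\<lambda>\<kappa>. (c - \<kappa>) / (c - b))"
    using bc by (intro integral_nonneg integrable_continuous_real continuous_intros) auto
  ultimately show ?thesis
    unfolding B1_laplace_integral[OF q j] by (simp add: a_def b_def c_def)
qed

section \<open>The measurement objective\<close>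

text \<open>The property for any negative log-likelihood that is a sum over the measurements of nonnegative
  analytic functions \<open>p e\<close> of the positive model output that blow up at zero, and for any regularizer
  that is a sum of norms of plane vectors. The blow-up at zero makes the objective lower
  semicontinuous where some model output vanishes.\<close>

lemma KL_property_separable:
  fixes p :: "real \<Rightarrow> real \<Rightarrow> real" and A B :: "'k::finite \<Rightarrow> real^'p" and idx :: "'j::finite \<Rightarrow> nat"
    and \<Phi> :: "real^'p^'n" and E :: "real^'n"
  assumes q: "1 < q" "0 < \<kappa>0" and u: "0 < u" and idx: "\<And>j. idx j \<ge> 1"
    and E: "\<And>n. 0 < E $ n"
    and p0: "\<And>e t. 0 < e \<Longrightarrow> 0 < t \<Longrightarrow> 0 \<le> p e t"
    and p1: "\<And>e. 0 < e \<Longrightarrow> filterlim (p e) at_top (at_right 0)"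
    and p2: "\<And>e. 0 < e \<Longrightarrow> \<exists>h. h holomorphic_on {z. 0 < Re z} \<and> (\<forall>t>0. h (of_real t) = of_real (p e t))"
    and nll: "\<And>y. nll y = (if \<forall>n. 0 < y $ n then ereal (\<Sum>n\<in>UNIV. p (E $ n) (y $ n)) else \<infinity>)"
    and r: "\<And>\<alpha>. r \<alpha> = ereal (\<Sum>k\<in>UNIV. sqrt ((A k \<bullet> \<alpha>)\<^sup>2 + (B k \<bullet> \<alpha>)\<^sup>2)) + nonneg_ind \<alpha>"
    and f: "f = objective nll (Iout q \<kappa>0 idx \<Phi>) u r"
    and C: "C \<subseteq> edom f"
  shows "KL_property_in f C"
proof -
  define y where "y = (\<lambda>z. Iout q \<kappa>0 idx \<Phi> (fst z) (snd z))"
  have y: "y z $ n = (\<Sum>j\<in>UNIV. B1_laplace q \<kappa>0 (idx j) (row n \<Phi> \<bullet> fst z) * snd z $ j)" for z n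
    by (simp add: y_def Iout_def)
  define D where "D = {z. \<forall>n. 0 < y z $ n}"
  define g where "g = (\<lambda>z. \<Sum>n\<in>UNIV. p (E $ n) (y z $ n))"
  define R where "R = (\<lambda>z::(real^'p) \<times> (real^'j). \<Sum>k\<in>UNIV. sqrt ((A k \<bullet> fst z)\<^sup>2 + (B k \<bullet> fst z)\<^sup>2))"
  have fz: "f z = (if z \<in> D \<and> (\<forall>i. 0 \<le> fst z $ i) \<and> (\<forall>j. 0 \<le> snd z $ j)
       then ereal (g z + u * R z) else \<infinity>)" for z
  proof -
    obtain \<alpha> I where z: "z = (\<alpha>, I)" by (cases z)
    have "f z = nll (y z) + ereal u * r \<alpha> + nonneg_ind I" by (simp add: f objective_def z y_def)
    then show ?thesis using u
      by (auto simp: nll r D_def g_def R_def nonneg_ind_def z)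
  qed
  have Bc: "continuous_on UNIV (B1_laplace q \<kappa>0 (idx j))" for j
  proof -
    obtain h where h: "h holomorphic_on UNIV" "\<And>s. h (of_real s) = of_real (B1_laplace q \<kappa>0 (idx j) s)"
      using B1_laplace_holomorphic[OF q idx[of j]] by blast
    have "continuous_on UNIV (\<lambda>s. Re (h (of_real s)))"
      by (intro continuous_intros continuous_on_compose2[OF holomorphic_on_imp_continuous_on[OF h(1)]]) auto
    then show ?thesis by (simp add: h)
  qed
  have yc: "continuous_on UNIV (\<lambda>z. y z $ n)" for n
    unfolding y by (intro continuous_intros continuous_on_compose2[OF Bc]) auto
  have D: "open D"
  proof -
    have "D = (\<Inter>n. {z. 0 < y z $ n})" by (auto simp: D_def)
    moreover have "open (\<Inter>n. {z. 0 < y z $ n})"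
      by (intro open_INT ballI open_Collect_less continuous_intros yc) simp
    ultimately show ?thesis by simp
  qed
  have Rc: "continuous_on UNIV R" unfolding R_def by (intro continuous_intros)
  have R0: "0 \<le> R z" for z unfolding R_def by (intro sum_nonneg) simp
  have pc: "isCont (p e) t" if e: "0 < e" and t: "0 < t" for e t
  proof -
    obtain h where h: "h holomorphic_on {z. 0 < Re z}" "\<And>t. 0 < t \<Longrightarrow> h (of_real t) = of_real (p e t)"
      using p2[OF e] by blast
    have "continuous_on {0<..} (\<lambda>t. Re (h (of_real t)))"
      by (intro continuous_intros continuous_on_compose2[OF holomorphic_on_imp_continuous_on[OF h(1)]]) auto
    then have "continuous_on {0<..} (p e)" by (rule continuous_on_eq) (simp add: h)
    then show ?thesis using t by (simp add: continuous_on_eq_continuous_at)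
  qed
  have ylim: "((\<lambda>z. y z $ n) \<longlongrightarrow> y x $ n) (at x)" for x n
    using continuous_on_interior[OF yc[of n], of x] by (simp add: isCont_def)
  have hlim: "((\<lambda>z. g z + u * R z) \<longlongrightarrow> g x + u * R x) (at x)" if x: "x \<in> D" for x
  proof -
    have "((\<lambda>z. p (E $ n) (y z $ n)) \<longlongrightarrow> p (E $ n) (y x $ n)) (at x)" for n
      by (rule isCont_tendsto_compose[OF pc ylim]) (use x E in \<open>auto simp: D_def\<close>)
    moreover have "(R \<longlongrightarrow> R x) (at x)" 
      using continuous_on_interior[OF Rc, of x] by (simp add: isCont_def)
    ultimately show ?thesis unfolding g_def by (intro tendsto_intros)
  qed
  have lsc: "lower_semicont f"
    unfolding lower_semicont_def le_Liminf_iff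
  proof (intro allI impI)
    fix x c assume c: "c < f x"
    have cinf: "c < \<infinity>" using c by (auto simp: less_le_trans)
    consider (neg1) i where "fst x $ i < 0" | (neg2) j where "snd x $ j < 0" | (neg3) n where "y x $ n < 0"
      | (zero) n where "y x $ n = 0" | (dom) "x \<in> D" "\<forall>i. 0 \<le> fst x $ i" "\<forall>j. 0 \<le> snd x $ j"
      unfolding D_def mem_Collect_eq by (meson less_linear not_less)
    then show "\<forall>\<^sub>F z in at x. c < f z"
    proof cases
      case neg1
      have "((\<lambda>z. fst z $ i) \<longlongrightarrow> fst x $ i) (at x)" by (intro tendsto_intros)
      then have "\<forall>\<^sub>F z in at x. fst z $ i < 0" using neg1 by (rule order_tendstoD)
      then show ?thesis
      proof eventually_elim
        case (elim z)
        then have "\<not> (\<forall>i. 0 \<le> fst z $ i)" by (metis not_le)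
        then have "f z = \<infinity>" unfolding fz by (simp only: simp_thms if_False)
        then show ?case using cinf by simp
      qed
    next
      case neg2
      have "((\<lambda>z. snd z $ j) \<longlongrightarrow> snd x $ j) (at x)" by (intro tendsto_intros)
      then have "\<forall>\<^sub>F z in at x. snd z $ j < 0" using neg2 by (rule order_tendstoD)
      then show ?thesis
      proof eventually_elim
        case (elim z)
        then have "\<not> (\<forall>j. 0 \<le> snd z $ j)" by (metis not_le)
        then have "f z = \<infinity>" unfolding fz by (simp only: simp_thms if_False)
        then show ?case using cinf by simp
      qed
    next
      case neg3
      have "\<forall>\<^sub>F z in at x. y z $ n < 0" using ylim neg3 by (rule order_tendstoD)
      then show ?thesis
      proof eventually_elim
        case (elim z)
        then have "z \<notin> D" by (auto simp: D_def intro!: exI[of _ n])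
        then show ?case using cinf by (simp add: fz)
      qed
    next
      case zero
      obtain c' where c': "c \<le> ereal c'" using cinf by (cases c) auto
      have "\<forall>\<^sub>F t in at_right 0. c' < p (E $ n) t"
        using p1[OF E[of n]] by (simp add: filterlim_at_top_dense)
      then obtain b where b: "b > 0" "\<And>t. 0 < t \<Longrightarrow> t < b \<Longrightarrow> c' < p (E $ n) t"
        unfolding eventually_at_right_field by auto
      have "\<forall>\<^sub>F z in at x. y z $ n < b" using ylim by (rule order_tendstoD) (use zero b in simp)
      then show ?thesis
      proof eventually_elim
        case (elim z)
        show ?case
        proof (cases "z \<in> D")
          case False
          then show ?thesis using cinf by (simp add: fz)
        next
          case True
          then have yz: "0 < y z $ m" for m by (simp add: D_def)
          have "c' < p (E $ n) (y z $ n)" using b(2)[OF yz elim] .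
          also have "\<dots> \<le> g z" unfolding g_def
            by (rule member_le_sum) (use p0[OF E yz] in auto)
          also have "\<dots> \<le> g z + u * R z" using u R0[of z] by simp
          finally have "ereal c' < ereal (g z + u * R z)" by simp
          then show ?thesis using c' cinf by (auto simp: fz intro: le_less_trans)
        qed
      qed
    next
      case dom
      then have fx: "f x = ereal (g x + u * R x)" by (simp add: fz)
      have "((\<lambda>z. ereal (g z + u * R z)) \<longlongrightarrow> ereal (g x + u * R x)) (at x)"
        using hlim[OF dom(1)] by simp
      then have "\<forall>\<^sub>F z in at x. c < ereal (g z + u * R z)"
        by (rule order_tendstoD) (use c fx in simp)
      then show ?thesis by eventually_elim (use cinf in \<open>simp add: fz\<close>)
    qed
  qed
  have "(0, 1) \<in> edom f"
  proof -
    have "0 < y (0, 1) $ n" for n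
      unfolding y using B1_laplace_0_pos[OF q idx] by (intro sum_pos) auto
    then show ?thesis by (simp add: edom_def fz D_def)
  qed
  moreover have "f z \<noteq> - \<infinity>" for z by (simp add: fz)
  ultimately have proper: "proper_fun f" by (auto simp: proper_fun_def)
  have "KL_property_at f zb" if zb: "zb \<in> C" for zb
  proof (rule KL_core[OF D fz[unfolded R_def]])
    show zf: "f zb < \<infinity>" using zb C by (auto simp: edom_def)
    then have zbD: "0 < y zb $ n" for n by (auto simp: fz D_def split: if_splits)
    fix L :: "real^('p + 'j + 'k) \<Rightarrow> (real^'p) \<times> (real^'j)" assume L: "linear L"
    have l1: "real_analytic0 (\<lambda>x. a \<bullet> fst (zb + L x))" for a
    proof -
      have "linear (\<lambda>x. a \<bullet> fst (L x))"
        by (rule linearI) (simp_all add: linear_add[OF L] linear_cmul[OF L] inner_add_right)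
      from real_analytic0_add[OF real_analytic0_const real_analytic0_linear[OF this], of "a \<bullet> fst zb"] show ?thesis by (simp add: inner_add_right)
    qed
    have l2: "real_analytic0 (\<lambda>x. snd (zb + L x) $ j)" for j
    proof -
      have "linear (\<lambda>x. snd (L x) $ j)"
        by (rule linearI) (simp_all add: linear_add[OF L] linear_cmul[OF L])
      from real_analytic0_add[OF real_analytic0_const real_analytic0_linear[OF this], of "snd zb $ j"] show ?thesis by simp
    qed
    have l3: "real_analytic0 (\<lambda>x. B1_laplace q \<kappa>0 (idx j) (a \<bullet> fst (zb + L x)))" for a j
    proof -
      obtain h where h: "h holomorphic_on UNIV" "\<And>s. h (of_real s) = of_real (B1_laplace q \<kappa>0 (idx j) s)"
        using B1_laplace_holomorphic[OF q idx[of j]] by blast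
      show ?thesis by (rule real_analytic0_compose[OF l1 open_UNIV _ h(1)]) (auto simp: h)
    qed
    have l4: "real_analytic0 (\<lambda>x. y (zb + L x) $ n)" for n
      unfolding y by (intro real_analytic0_sum real_analytic0_mult l2 l3)
    have "real_analytic0 (\<lambda>x. p (E $ n) (y (zb + L x) $ n))" for n
    proof -
      obtain h where h: "h holomorphic_on {z. 0 < Re z}" "\<And>t. 0 < t \<Longrightarrow> h (of_real t) = of_real (p (E $ n) t)"
        using p2[OF E[of n]] by blast
      show ?thesis
        by (rule real_analytic0_compose[OF l4 _ _ h(1)])
          (use zbD linear_0[OF L] in \<open>auto simp: h open_halfspace_Re_gt\<close>)
    qed
    then show "real_analytic0 (\<lambda>x. g (zb + L x))" unfolding g_def by (intro real_analytic0_sum)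
  qed
  with proper lsc show ?thesis by (auto simp: KL_property_in_def)
qed

text \<open>The contribution of one measurement \<open>e\<close> with model output \<open>t\<close> to the two negative
  log-likelihoods.\<close>

definition lognormal_term :: "real \<Rightarrow> real \<Rightarrow> real" where
  "lognormal_term e t = 1/2 * (ln e - ln t)\<^sup>2"

definition poisson_term :: "real \<Rightarrow> real \<Rightarrow> real" where
  "poisson_term e t = (t - e) - e * (ln t - ln e)"

lemma lognormal_nll_eq:
  "lognormal_nll E y = (if \<forall>n. 0 < y $ n then ereal (\<Sum>n\<in>UNIV. lognormal_term (E $ n) (y $ n)) else \<infinity>)"
proof -
  have "1/2 * (norm (ln_vec E - ln_vec y))\<^sup>2 = (\<Sum>n\<in>UNIV. lognormal_term (E $ n) (y $ n))"
    unfolding power2_norm_eq_inner inner_vec_def lognormal_term_def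
    by (simp add: ln_vec_def sum_distrib_left power2_eq_square)
  then show ?thesis by (simp add: lognormal_nll_def)
qed

lemma poisson_nll_eq:
  "poisson_nll E y = (if \<forall>n. 0 < y $ n then ereal (\<Sum>n\<in>UNIV. poisson_term (E $ n) (y $ n)) else \<infinity>)"
proof -
  have "1 \<bullet> (y - E) - E \<bullet> (ln_vec y - ln_vec E) = (\<Sum>n\<in>UNIV. poisson_term (E $ n) (y $ n))"
    unfolding inner_vec_def poisson_term_def by (simp add: ln_vec_def sum_subtractf)
  then show ?thesis by (simp add: poisson_nll_def)
qed

lemma minus_ln_at_right_0: "filterlim (\<lambda>t::real. - ln t) at_top (at_right 0)"
  using ln_at_0 by (simp add: filterlim_uminus_at_top)

lemma lognormal_term_blowup: "filterlim (lognormal_term e) at_top (at_right 0)"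
proof -
  have "filterlim (\<lambda>t. ln e + - ln t) at_top (at_right 0)"
    by (rule filterlim_tendsto_add_at_top[OF tendsto_const minus_ln_at_right_0])
  then have "filterlim (\<lambda>t. (ln e + - ln t) ^ 2) at_top (at_right 0)"
    by (intro filterlim_pow_at_top) auto
  then have "filterlim (\<lambda>t. 1/2 * (ln e + - ln t) ^ 2) at_top (at_right 0)"
    by (intro filterlim_tendsto_pos_mult_at_top[OF tendsto_const]) auto
  then show ?thesis by (simp add: lognormal_term_def[abs_def])
qed

lemma poisson_term_blowup:
  assumes "0 < e" shows "filterlim (poisson_term e) at_top (at_right 0)"
proof -
  have "filterlim (\<lambda>t. e * - ln t) at_top (at_right 0)"
    using assms by (intro filterlim_tendsto_pos_mult_at_top[OF tendsto_const _ minus_ln_at_right_0])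
  moreover have "((\<lambda>t. t - e + e * ln e) \<longlongrightarrow> 0 - e + e * ln e) (at_right 0)"
    by (intro tendsto_intros)
  ultimately have "filterlim (\<lambda>t. (t - e + e * ln e) + e * - ln t) at_top (at_right 0)"
    by (rule filterlim_tendsto_add_at_top[rotated])
  moreover have "(\<lambda>t. (t - e + e * ln e) + e * - ln t) = poisson_term e"
    by (rule ext) (simp add: poisson_term_def algebra_simps)
  ultimately show ?thesis by simp
qed

lemma poisson_term_nonneg:
  assumes "0 < e" "0 < t" shows "0 \<le> poisson_term e t"
proof -
  have "ln (t / e) \<le> t / e - 1" using assms by (intro ln_le_minus_one) simp
  then have "e * (ln t - ln e) \<le> e * (t / e - 1)"
    using assms by (intro mult_left_mono) (auto simp: ln_div)
  then show ?thesis using assms by (simp add: poisson_term_def right_diff_distrib)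
qed

lemma holomorphic_Ln_halfplane: "Ln holomorphic_on {z. 0 < Re z}"
  by (intro holomorphic_on_Ln) (auto simp: complex_nonpos_Reals_iff)

lemma lognormal_term_holomorphic:
  "\<exists>h. h holomorphic_on {z. 0 < Re z} \<and> (\<forall>t>0. h (of_real t) = of_real (lognormal_term e t))"
  by (rule exI[of _ "\<lambda>z. 1/2 * (of_real (ln e) - Ln z)\<^sup>2"])
    (auto intro!: holomorphic_intros holomorphic_Ln_halfplane simp: lognormal_term_def Ln_of_real)

lemma poisson_term_holomorphic:
  "\<exists>h. h holomorphic_on {z. 0 < Re z} \<and> (\<forall>t>0. h (of_real t) = of_real (poisson_term e t))"
  by (rule exI[of _ "\<lambda>z. (z - of_real e) - of_real e * (Ln z - of_real (ln e))"])
    (auto intro!: holomorphic_intros holomorphic_Ln_halfplane simp: poisson_term_def Ln_of_real)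

text \<open>Absolute values are norms of plane vectors with second component zero.\<close>

lemma l1_reg_form:
  "l1_reg \<Psi> \<alpha> = ereal (\<Sum>k\<in>UNIV. sqrt ((column k \<Psi> \<bullet> \<alpha>)\<^sup>2 + (0 \<bullet> \<alpha>)\<^sup>2)) + nonneg_ind \<alpha>"
proof -
  have "(transpose \<Psi> *v \<alpha>) $ k = column k \<Psi> \<bullet> \<alpha>" for k
    by (simp add: matrix_vector_mult_def transpose_def column_def inner_vec_def)
  then show ?thesis by (simp add: l1_reg_def)
qed

text \<open>The vector whose inner product with an image is the difference between pixel \<open>i\<close> and the pixel at
  grid position \<open>c\<close>; it is zero if there is no pixel at \<open>c\<close>.\<close>

definition pixel_diff :: "('p \<Rightarrow> int \<times> int) \<Rightarrow> 'p::finite \<Rightarrow> int \<times> int \<Rightarrow> real^'p" where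
  "pixel_diff pos i c = (if c \<in> range pos then axis i 1 - axis (inv pos c) 1 else 0)"

lemma pixel_diff:
  assumes "inj pos"
  shows "(\<Sum>j\<in>{j. pos j = c}. (\<alpha> $ i - \<alpha> $ j)\<^sup>2) = (pixel_diff pos i c \<bullet> \<alpha>)\<^sup>2"
proof (cases "c \<in> range pos")
  case True
  then obtain j where j: "c = pos j" by blast
  have "{k. pos k = c} = {j}" using assms j by (auto simp: inj_def)
  moreover have "inv pos c = j" using assms j by simp
  ultimately show ?thesis using True by (simp add: pixel_diff_def inner_diff_left inner_axis' )
next
  case False
  then have "{k. pos k = c} = {}" by auto
  then show ?thesis using False by (simp add: pixel_diff_def)
qed

lemma tv_reg_form:
  assumes "inj pos"
  shows "tv_reg pos \<alpha> = ereal (\<Sum>i\<in>UNIV. sqrt ((pixel_diff pos i (fst (pos i), snd (pos i) + 1) \<bullet> \<alpha>)\<^sup>2 +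
     (pixel_diff pos i (fst (pos i) + 1, snd (pos i)) \<bullet> \<alpha>)\<^sup>2)) + nonneg_ind \<alpha>"
proof -
  have "(\<Sum>j\<in>nbrs pos i. (\<alpha> $ i - \<alpha> $ j)\<^sup>2) = (pixel_diff pos i (fst (pos i), snd (pos i) + 1) \<bullet> \<alpha>)\<^sup>2 +
     (pixel_diff pos i (fst (pos i) + 1, snd (pos i)) \<bullet> \<alpha>)\<^sup>2" for i
  proof -
    have "nbrs pos i = {j. pos j = (fst (pos i), snd (pos i) + 1)} \<union> {j. pos j = (fst (pos i) + 1, snd (pos i))}"
      by (auto simp: nbrs_def)
    then have "(\<Sum>j\<in>nbrs pos i. (\<alpha> $ i - \<alpha> $ j)\<^sup>2) =
       (\<Sum>j\<in>{j. pos j = (fst (pos i), snd (pos i) + 1)}. (\<alpha> $ i - \<alpha> $ j)\<^sup>2) +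
       (\<Sum>j\<in>{j. pos j = (fst (pos i) + 1, snd (pos i))}. (\<alpha> $ i - \<alpha> $ j)\<^sup>2)"
      by (simp only:) (rule sum.union_disjoint, auto)
    then show ?thesis by (simp only: pixel_diff[OF assms])
  qed
  then show ?thesis by (simp only: tv_reg_def)
qed

theorem theorem2:
  fixes q \<kappa>0 u :: real
    and idx :: "'j::finite \<Rightarrow> nat"
    and \<Phi> :: "real^'p^'n"
    and E :: "real^'n"
    and pos :: "'p \<Rightarrow> int \<times> int"
    and \<Psi> :: "real^'m^'p"
    and nll :: "real^'n \<Rightarrow> real^'n \<Rightarrow> ereal"
    and r :: "real^'p \<Rightarrow> ereal"
    and f :: "(real^'p) \<times> (real^'j) \<Rightarrow> ereal"
    and C :: "((real^'p) \<times> (real^'j)) set"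
  assumes "1 < q" and "0 < \<kappa>0" and "0 < u"
    and "bij_betw idx UNIV {1..CARD('j)}"
    and "\<forall>n i. 0 \<le> \<Phi> $ n $ i"
    and "\<forall>n. 0 < E $ n"
    and "inj pos"
    and "CARD('p) \<le> CARD('m)" and "\<Psi> ** transpose \<Psi> = mat 1"
    and "nll = lognormal_nll \<or> nll = poisson_nll"
    and "r = tv_reg pos \<or> r = l1_reg \<Psi>"
    and "f = objective (nll E) (Iout q \<kappa>0 idx \<Phi>) u r"
    and "compact C" and "C \<subseteq> edom f"
  shows "KL_property_in f C"
proof -
  have idx: "idx j \<ge> 1" for j using bij_betwE[OF assms(4)] by auto
  have E: "0 < E $ n" for n using assms(6) by blast
  obtain p where p0: "\<And>e t. 0 < e \<Longrightarrow> 0 < t \<Longrightarrow> 0 \<le> p e t"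
    and p1: "\<And>e. 0 < e \<Longrightarrow> filterlim (p e) at_top (at_right 0)"
    and p2: "\<And>e. 0 < e \<Longrightarrow> \<exists>h. h holomorphic_on {z. 0 < Re z} \<and> (\<forall>t>0. h (of_real t) = of_real (p e t))"
    and nll: "\<And>y. nll E y = (if \<forall>n. 0 < y $ n then ereal (\<Sum>n\<in>UNIV. p (E $ n) (y $ n)) else \<infinity>)"
    using assms(10)
  proof
    assume "nll = lognormal_nll"
    then show thesis
      by (intro that[of lognormal_term] lognormal_term_blowup lognormal_term_holomorphic)
        (simp_all add: lognormal_nll_eq lognormal_term_def)
  next
    assume "nll = poisson_nll"
    then show thesis
      by (intro that[of poisson_term] poisson_term_blowup poisson_term_holomorphic poisson_term_nonneg)
        (simp_all add: poisson_nll_eq)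
  qed
  note KL = KL_property_separable[OF assms(1-3) idx E _ _ _ nll _ assms(12,14)]
  from assms(11) show ?thesis
  proof
    assume r: "r = tv_reg pos"
    show ?thesis by (rule KL) (fact p0 p1 p2, fact p0 p1 p2, fact p0 p1 p2, unfold r, rule tv_reg_form[OF assms(7)])
  next
    assume r: "r = l1_reg \<Psi>"
    show ?thesis by (rule KL) (fact p0 p1 p2, fact p0 p1 p2, fact p0 p1 p2, unfold r, rule l1_reg_form)
  qed
qed

end
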